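(* Let $\alpha=[a_0;a_1,a_2,\dots]$ be an irrational number, with convergents $p_n/q_n$, such that one of the following conditions holds: - $\sum_n\frac1{\log a_n}<\infty$ (the sum being taken over all sufficiently large $n$; in particular $a_n\ge2$ for all large $n$); - there exist $C>0$ and $\gamma>0$ such that $q_n\ge C\exp(n^{2+\gamma})$ for every $n$. Let $\beta_0=\sum_{n\ge0}\rho_n$, where $\rho_n=q_n\alpha-p_n$. If $\phi^t$ is a reparametrized linear flow (in the sense of the context) with angle $\alpha$ and stopping points at $(0,0)$ and $(0,-\beta_0)$ (mod $\mathbb Z^2$), then $\phi^t$ has a physical measure.
   Context: $[a_0;a_1,a_2,\dots]$ is the continued fraction expansion and $p_n/q_n=[a_0;a_1,\dots,a_n]$ is the $n$-th convergent in lowest terms, $q_n>0$ (so $q_0=1$, $p_0=a_0$). Let $\mathbb T^2=\mathbb R^2/\mathbb Z^2$, and let $\lambda^2$ be Lebesgue (Haar) measure on $\mathbb T^2$. A reparametrized linear flow with angle $\alpha$ and stopping points at $\mathbf p$ and $\mathbf q$ is the flow $\phi^t$ on $\mathbb T^2$ generated by a vector field $X=\varphi X_0$ such that: $X_0=(1,\alpha)$ with $\alpha\in\mathbb R$ irrational; $\varphi:\mathbb T^2\to[0,\infty)$ is of class $C^3$; $\varphi$ vanishes at two distinct points $\mathbf p,\mathbf q$ and is positive elsewhere; the Hessians $D^2\varphi(\mathbf p)$ and $D^2\varphi(\mathbf q)$ are positive definite. Put $d_{\mathbf p}=\det D^2\varphi(\mathbf p)$, $d_{\mathbf q}=\det D^2\varphi(\mathbf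 q)$ and $$\mu_\infty=\frac{\sqrt{d_{\mathbf q}}}{\sqrt{d_{\mathbf p}}+\sqrt{d_{\mathbf q}}}\delta_{\mathbf p}+\frac{\sqrt{d_{\mathbf p}}}{\sqrt{d_{\mathbf p}}+\sqrt{d_{\mathbf q}}}\delta_{\mathbf q}.$$ For $\mathbf x\in\mathbb T^2$ and $t>0$ the empirical measure $\mu^t_{\mathbf x}$ is the Borel probability with $\int f\,d\mu^t_{\mathbf x}=\frac1t\int_0^t f(\phi^s(\mathbf x))\,ds$ for continuous $f$. In this setting "$\phi^t$ has a physical measure" means that $\mu^t_{\mathbf x}$ converges weak-* to $\mu_\infty$ as $t\to\infty$ for $\lambda^2$-almost every $\mathbf x\in\mathbb T^2$. *)

theory Defs
  imports "HOL-Analysis.Analysis"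
begin

text \<open>Digits of the continued fraction expansion of an irrational number, via the Gauss map.\<close>

primrec cf_remainder :: "real \<Rightarrow> nat \<Rightarrow> real" where
  "cf_remainder \<alpha> 0 = \<alpha>"
| "cf_remainder \<alpha> (Suc n) = 1 / frac (cf_remainder \<alpha> n)"

definition cf_digit :: "real \<Rightarrow> nat \<Rightarrow> int" where
  "cf_digit \<alpha> n = \<lfloor>cf_remainder \<alpha> n\<rfloor>"

fun cf_eval :: "int list \<Rightarrow> rat" where
  "cf_eval [] = 0"
| "cf_eval [a] = of_int a"
| "cf_eval (a # b # as) = of_int a + 1 / cf_eval (b # as)"

definition cf_convergent :: "real \<Rightarrow> nat \<Rightarrow> rat" where
  "cf_convergent \<alpha> n = cf_eval (map (cf_digit \<alpha>) [0..<Suc n])"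

text \<open>\<open>quotient_of\<close> returns the representation in lowest terms with positive denominator.\<close>

definition cf_num :: "real \<Rightarrow> nat \<Rightarrow> int" where
  "cf_num \<alpha> n = fst (quotient_of (cf_convergent \<alpha> n))"

definition cf_den :: "real \<Rightarrow> nat \<Rightarrow> int" where
  "cf_den \<alpha> n = snd (quotient_of (cf_convergent \<alpha> n))"

definition cf_rho :: "real \<Rightarrow> nat \<Rightarrow> real" where
  "cf_rho \<alpha> n = of_int (cf_den \<alpha> n) * \<alpha> - of_int (cf_num \<alpha> n)"

definition beta0 :: "real \<Rightarrow> real" where
  "beta0 \<alpha> = (\<Sum>n. cf_rho \<alpha> n)"

quotient_type torus = "real^2" / "\<lambda>x y. \<forall>i. x $ i - y $ i \<in> \<int>"
  morphisms torus_rep to_torus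
proof (rule equivpI)
  show "reflp (\<lambda>x y :: real^2. \<forall>i. x $ i - y $ i \<in> \<int>)"
    by (simp add: reflp_def)
  show "symp (\<lambda>x y :: real^2. \<forall>i. x $ i - y $ i \<in> \<int>)"
  proof (rule sympI, rule allI)
    fix x y :: "real^2" and i
    assume "\<forall>i. x $ i - y $ i \<in> \<int>"
    then have "- (x $ i - y $ i) \<in> \<int>"
      by (intro Ints_minus) auto
    then show "y $ i - x $ i \<in> \<int>" by simp
  qed
  show "transp (\<lambda>x y :: real^2. \<forall>i. x $ i - y $ i \<in> \<int>)"
  proof (rule transpI, rule allI)
    fix x y z :: "real^2" and i
    assume "\<forall>i. x $ i - y $ i \<in> \<int>" "\<forall>i. y $ i - z $ i \<in> \<int>"
    then have "(x $ i - y $ i) + (y $ i - z $ i) \<in> \<int>"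
      by (intro Ints_add) auto
    then show "x $ i - z $ i \<in> \<int>" by simp
  qed
qed

lemma to_torus_eq_iff: "to_torus x = to_torus y \<longleftrightarrow> (\<forall>i. x $ i - y $ i \<in> \<int>)"
  by (rule torus.abs_eq_iff)

lemma to_torus_rep [simp]: "to_torus (torus_rep z) = z"
  by (rule Quotient_abs_rep[OF Quotient_torus])

instantiation torus :: topological_space
begin

definition open_torus :: "torus set \<Rightarrow> bool" where
  "open_torus U \<longleftrightarrow> open (to_torus -` U)"

instance
proof
  show "open (UNIV :: torus set)"
    by (simp add: open_torus_def)
  show "open (S \<inter> T)" if "open S" "open T" for S T :: "torus set"
    using that by (auto simp: open_torus_def)
  show "open (\<Union>K)" if "\<forall>S\<in>K. open S" for K :: "torus set set"
    using that by (auto simp: open_torus_def vimage_Union)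
qed

end

lemma continuous_to_torus: "continuous_on UNIV to_torus"
  by (auto simp: continuous_on_open_vimage open_torus_def)

text \<open>Haar measure: the push-forward of planar Lebesgue measure on a fundamental domain.\<close>

definition torus_lebesgue :: "torus measure" where
  "torus_lebesgue = distr (restrict_space lborel {x :: real^2. \<forall>i. 0 \<le> x $ i \<and> x $ i < 1}) borel to_torus"

definition partial_deriv :: "'n \<Rightarrow> (real^'n \<Rightarrow> real) \<Rightarrow> real^'n \<Rightarrow> real" where
  "partial_deriv i f x = frechet_derivative f (at x) (axis i 1)"

primrec class_C :: "nat \<Rightarrow> (real^'n \<Rightarrow> real) \<Rightarrow> bool" where
  "class_C 0 f \<longleftrightarrow> continuous_on UNIV f"
| "class_C (Suc k) f \<longleftrightarrow> f differentiable_on UNIV \<and> (\<forall>i. class_C k (partial_deriv i f))"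

definition hessian :: "(real^'n \<Rightarrow> real) \<Rightarrow> real^'n \<Rightarrow> real^'n^'n" where
  "hessian f x = (\<chi> i j. partial_deriv i (partial_deriv j f) x)"

definition positive_definite :: "real^'n^'n \<Rightarrow> bool" where
  "positive_definite A \<longleftrightarrow> (\<forall>v. v \<noteq> 0 \<longrightarrow> v \<bullet> (A *v v) > 0)"

text \<open>Differential notions on the torus are those of the periodic lift to the plane. The choice of
  the representative is irrelevant, see \<open>torus_hessian_to_torus\<close> below.\<close>

definition torus_class_C :: "nat \<Rightarrow> (torus \<Rightarrow> real) \<Rightarrow> bool" where
  "torus_class_C k f \<longleftrightarrow> class_C k (\<lambda>x. f (to_torus x))"

definition torus_hessian :: "(torus \<Rightarrow> real) \<Rightarrow> torus \<Rightarrow> real^2^2" where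
  "torus_hessian f z = hessian (\<lambda>x. f (to_torus x)) (torus_rep z)"

lemma partial_deriv_periodic:
  assumes per: "\<And>y. f (y + c) = f y"
  shows "partial_deriv i f (x + c) = partial_deriv i f x"
proof -
  have "(f has_derivative D) (at (x + c)) \<longleftrightarrow> (f has_derivative D) (at x)" for D
  proof
    assume "(f has_derivative D) (at (x + c))"
    moreover have "((\<lambda>y. y + c) has_derivative (\<lambda>h. h)) (at x)"
      by (auto intro!: derivative_eq_intros)
    ultimately have "((\<lambda>y. f (y + c)) has_derivative (\<lambda>h. D h)) (at x)"
      by (rule has_derivative_compose[rotated])
    then show "(f has_derivative D) (at x)"
      by (simp add: per)
  next
    have per': "f (y - c) = f y" for y
      using per[of "y - c"] by simp
    assume "(f has_derivative D) (at x)"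
    then have "(f has_derivative D) (at ((x + c) - c))"
      by simp
    moreover have "((\<lambda>y. y - c) has_derivative (\<lambda>h. h)) (at (x + c))"
      by (auto intro!: derivative_eq_intros)
    ultimately have "((\<lambda>y. f (y - c)) has_derivative (\<lambda>h. D h)) (at (x + c))"
      by (rule has_derivative_compose[rotated])
    then show "(f has_derivative D) (at (x + c))"
      by (simp add: per')
  qed
  then show ?thesis
    by (simp add: partial_deriv_def frechet_derivative_def)
qed

lemma torus_hessian_to_torus:
  "torus_hessian f (to_torus x) = hessian (\<lambda>y. f (to_torus y)) x"
proof -
  define c where "c = torus_rep (to_torus x) - x"
  have "to_torus (x + c) = to_torus x"
    by (simp add: c_def)
  then have "\<forall>i. c $ i \<in> \<int>"
    by (auto simp: to_torus_eq_iff)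
  then have per: "f (to_torus (y + c)) = f (to_torus y)" for y
    using to_torus_eq_iff[of "y + c" y] by simp
  have "torus_rep (to_torus x) = x + c"
    by (simp add: c_def)
  moreover have "partial_deriv i (partial_deriv j (\<lambda>y. f (to_torus y))) (x + c) =
      partial_deriv i (partial_deriv j (\<lambda>y. f (to_torus y))) x" for i j
    by (intro partial_deriv_periodic per)
  ultimately show ?thesis
    by (simp add: torus_hessian_def hessian_def)
qed

text \<open>The tangent bundle of the torus is trivial, so a vector field is a map into the plane.
  Integral curves on the torus are the projections of integral curves of the lifted field.\<close>

definition flow_generated_by :: "(torus \<Rightarrow> real^2) \<Rightarrow> (real \<Rightarrow> torus \<Rightarrow> torus) \<Rightarrow> bool" where
  "flow_generated_by X \<phi> \<longleftrightarrow>
     (\<forall>x. \<exists>c :: real \<Rightarrow> real^2. c 0 = x \<and>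
        (\<forall>t. (c has_vector_derivative X (to_torus (c t))) (at t)) \<and>
        (\<forall>t. \<phi> t (to_torus x) = to_torus (c t)))"

definition reparametrized_linear_flow ::
  "real \<Rightarrow> torus \<Rightarrow> torus \<Rightarrow> (torus \<Rightarrow> real) \<Rightarrow> (real \<Rightarrow> torus \<Rightarrow> torus) \<Rightarrow> bool" where
  "reparametrized_linear_flow \<alpha> p q \<psi> \<phi> \<longleftrightarrow>
     \<alpha> \<notin> \<rat> \<and>
     torus_class_C 3 \<psi> \<and>
     p \<noteq> q \<and> \<psi> p = 0 \<and> \<psi> q = 0 \<and> (\<forall>z. z \<noteq> p \<and> z \<noteq> q \<longrightarrow> \<psi> z > 0) \<and>
     positive_definite (torus_hessian \<psi> p) \<and>
     positive_definite (torus_hessian \<psi> q) \<and>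
     flow_generated_by (\<lambda>z. \<psi> z *\<^sub>R vector [1, \<alpha>]) \<phi>"

definition empirical_measure :: "(real \<Rightarrow> torus \<Rightarrow> torus) \<Rightarrow> real \<Rightarrow> torus \<Rightarrow> torus measure" where
  "empirical_measure \<phi> t x = distr (uniform_measure lborel {0..t}) borel (\<lambda>s. \<phi> s x)"

definition mu_infinity :: "(torus \<Rightarrow> real) \<Rightarrow> torus \<Rightarrow> torus \<Rightarrow> torus measure" where
  "mu_infinity \<psi> p q =
     (let dp = det (torus_hessian \<psi> p); dq = det (torus_hessian \<psi> q) in
      distr (point_measure {p, q}
        (\<lambda>z. ennreal (if z = p then sqrt dq / (sqrt dp + sqrt dq)
                               else sqrt dp / (sqrt dp + sqrt dq)))) borel (\<lambda>z. z))"

text \<open>The torus is compact, so all continuous functions are admissible test functions.\<close>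

definition weak_star_limit :: "(real \<Rightarrow> torus measure) \<Rightarrow> torus measure \<Rightarrow> bool" where
  "weak_star_limit \<mu> \<nu> \<longleftrightarrow>
     (\<forall>f :: torus \<Rightarrow> real. continuous_on UNIV f \<longrightarrow>
        ((\<lambda>t. integral\<^sup>L (\<mu> t) f) \<longlongrightarrow> integral\<^sup>L \<nu> f) at_top)"

definition has_physical_measure ::
  "torus \<Rightarrow> torus \<Rightarrow> (torus \<Rightarrow> real) \<Rightarrow> (real \<Rightarrow> torus \<Rightarrow> torus) \<Rightarrow> bool" where
  "has_physical_measure p q \<psi> \<phi> \<longleftrightarrow>
     (AE x in torus_lebesgue. weak_star_limit (\<lambda>t. empirical_measure \<phi> t x) (mu_infinity \<psi> p q))"

lemma flow_continuous:
  assumes "flow_generated_by X \<phi>"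
  shows "continuous_on UNIV (\<lambda>s. \<phi> s x)"
proof -
  obtain c where c: "\<And>t. (c has_vector_derivative X (to_torus (c t))) (at t)"
      "\<And>t. \<phi> t (to_torus (torus_rep x)) = to_torus (c t)"
    using assms unfolding flow_generated_by_def by blast
  have "continuous_on UNIV c"
    by (meson c(1) continuous_at_imp_continuous_on has_vector_derivative_continuous)
  then have "continuous_on UNIV (\<lambda>t. to_torus (c t))"
    using continuous_on_compose2[OF continuous_to_torus] by blast
  then show ?thesis
    using c(2) by simp
qed

lemma integral_empirical_measure:
  fixes f :: "torus \<Rightarrow> real"
  assumes "flow_generated_by X \<phi>" "continuous_on UNIV f" "t > 0"
  shows "integral\<^sup>L (empirical_measure \<phi> t x) f = (1 / t) * (LINT s:{0..t}|lborel. f (\<phi> s x))"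
proof -
  have m: "(\<lambda>s. \<phi> s x) \<in> borel_measurable borel"
    by (rule borel_measurable_continuous_onI[OF flow_continuous[OF assms(1)]])
  have f: "f \<in> borel_measurable borel"
    by (rule borel_measurable_continuous_onI[OF assms(2)])
  have "integral\<^sup>L (empirical_measure \<phi> t x) f = (\<integral>s. f (\<phi> s x) \<partial>uniform_measure lborel {0..t})"
    unfolding empirical_measure_def using m f by (subst integral_distr) (auto simp: measurable_def)
  also have "uniform_measure lborel {0..t} =
      density lborel (\<lambda>s. ennreal (indicator {0..t} s / t))"
    unfolding uniform_measure_def using assms(3)
    by (intro density_cong)
       (auto simp: indicator_def divide_ennreal simp flip: ennreal_1 split: if_splits)
  also have "(\<integral>s. f (\<phi> s x) \<partial>density lborel (\<lambda>s. ennreal (indicator {0..t} s / t))) =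
      (\<integral>s. (indicator {0..t} s / t) *\<^sub>R f (\<phi> s x) \<partial>lborel)"
    using m f assms(3) by (intro integral_density) auto
  also have "\<dots> = (\<integral>s. (1 / t) * (indicator {0..t} s *\<^sub>R f (\<phi> s x)) \<partial>lborel)"
    by (intro Bochner_Integration.integral_cong) auto
  finally show ?thesis
    by (simp add: set_lebesgue_integral_def)
qed

lemma integral_mu_infinity:
  fixes f :: "torus \<Rightarrow> real"
  assumes "p \<noteq> q" "continuous_on UNIV f"
    and "dp = det (torus_hessian \<psi> p)" "dq = det (torus_hessian \<psi> q)" "dp \<ge> 0" "dq \<ge> 0"
  shows "integral\<^sup>L (mu_infinity \<psi> p q) f =
    sqrt dq / (sqrt dp + sqrt dq) * f p + sqrt dp / (sqrt dp + sqrt dq) * f q"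
proof -
  have f: "f \<in> borel_measurable borel"
    by (rule borel_measurable_continuous_onI[OF assms(2)])
  show ?thesis
    unfolding mu_infinity_def Let_def assms(3,4)[symmetric] using f assms(1,5,6)
    by (subst integral_distr)
       (auto simp: lebesgue_integral_point_measure_finite measurable_def space_point_measure
          sets_point_measure)
qed

end

theory Submission
  imports Defs
begin

text \<open>After a change of time, the empirical measures become quotients of integrals of \<open>F / \<psi>\<close> and
  \<open>1 / \<psi>\<close> along a linear orbit. Crossing the circle \<open>x\<^sub>1 = 0\<close> at height \<open>y\<close> costs
  \<open>2 \<pi> / (\<surd>d\<^sub>p \<parallel>y\<parallel>) + 2 \<pi> / (\<surd>d\<^sub>q \<parallel>y + \<beta>\<parallel>)\<close> units of time, up to a small relative error
  and a bounded term. Since \<open>\<Sum>\<^sub>k\<^sub><\<^sub>N 1 / \<parallel>y + k \<alpha>\<parallel>\<close> outgrows \<open>N\<close>, the claim amounts to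
  \<open>\<Sum>\<^sub>k\<^sub><\<^sub>N 1 / \<parallel>y + \<beta> + k \<alpha>\<parallel> \<sim> \<Sum>\<^sub>k\<^sub><\<^sub>N 1 / \<parallel>y + k \<alpha>\<parallel>\<close> for almost every \<open>y\<close>.

  Given a large \<open>K\<close> take \<open>j\<close> with \<open>K q\<^sub>j \<le> N < K q\<^sub>j\<^sub>+\<^sub>1\<close>. Modulo 1, \<open>\<beta>\<close> differs from
  \<open>(q\<^sub>0 + \<dots> + q\<^sub>j) \<alpha>\<close> by \<open>O(1 / q\<^sub>j\<^sub>+\<^sub>1)\<close>, so the two sums differ by \<open>O(1/K)\<close> of their size plus
  boundedly many single terms. A single term is negligible for almost every \<open>y\<close> by the
  Borel--Cantelli lemma: both hypotheses on \<open>\<alpha>\<close> force \<open>ln q\<^sub>n \<ge> c n\<^sup>2\<close>, and this makes the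
  measures of the exceptional sets, which are \<open>O(ln n / n\<^sup>2)\<close>, summable.\<close>

section \<open>Sums of reciprocal distances along blocks of an orbit\<close>

text \<open>The threshold \<open>1 / (\<epsilon> k ln k)\<close> for a close return is dictated by
  the available lower bounds. For \<open>q n \<le> N < q (n+1)\<close> the sum is in general only
  known to exceed a multiple of \<open>N ln (q n)\<close>, which can be far below
  \<open>N ln N\<close>; at a time \<open>k\<close> with distance at most \<open>1/k\<close>,
  however, it exceeds a multiple of \<open>k ln k\<close>, and a return at larger distance
  contributes less than \<open>k\<close>, which is negligible anyway. The neighbourhoods of radius
  \<open>1 / (\<epsilon> k ln k)\<close> have divergent total measure, so Borel--Cantelli is applied
  to groups of \<open>k\<close> between consecutive denominators: early in a group the
  neighbourhoods overlap heavily, and the union has measure of order \<open>1 / ln (q m)\<close>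
  plus summable corrections. The masses of the limit come from the Hessian form \<open>Q\<close>:
  the speed is close to \<open>Q / 2\<close>, so a passage at offset \<open>w\<close> lasts about
  the integral of \<open>2 / Q\<close>, which is \<open>2 \<pi> / (sqrt det |w|)\<close>. Single
  terms must be negligible for a second reason: a time average may stop in the middle of a
  passage.\<close>

definition nint_dist :: "real \<Rightarrow> real" where
  "nint_dist x = \<bar>x - of_int (round x)\<bar>"

lemma nint_dist_le: "nint_dist x \<le> \<bar>x - of_int m\<bar>"
  unfolding nint_dist_def by (rule round_diff_minimal)

lemma nint_dist_nonneg [simp]: "0 \<le> nint_dist x"
  by (simp add: nint_dist_def)

lemma nint_dist_le_abs: "nint_dist x \<le> \<bar>x\<bar>"
  using nint_dist_le[of x 0] by simp

lemma nint_dist_eq_0_iff: "nint_dist x = 0 \<longleftrightarrow> x \<in> \<int>"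
proof
  assume "nint_dist x = 0"
  then have "x = of_int (round x)" by (simp add: nint_dist_def)
  then show "x \<in> \<int>" by (metis Ints_of_int)
next
  assume "x \<in> \<int>"
  then show "nint_dist x = 0" by (auto elim!: Ints_cases simp: nint_dist_def)
qed

lemma nint_dist_add_le: "nint_dist (x + y) \<le> nint_dist x + \<bar>y\<bar>"
proof -
  have "nint_dist (x + y) \<le> \<bar>x + y - of_int (round x)\<bar>" by (rule nint_dist_le)
  also have "\<dots> \<le> nint_dist x + \<bar>y\<bar>" by (simp add: nint_dist_def)
  finally show ?thesis .
qed

lemma nint_dist_add_int [simp]: "nint_dist (x + of_int n) = nint_dist x"
proof (rule antisym)
  show "nint_dist (x + of_int n) \<le> nint_dist x"
    using nint_dist_le[of "x + of_int n" "round x + n"] by (simp add: nint_dist_def)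
  show "nint_dist x \<le> nint_dist (x + of_int n)"
    using nint_dist_le[of x "round (x + of_int n) - n"]
    by (simp add: nint_dist_def algebra_simps)
qed

lemma nint_dist_diff_int [simp]: "nint_dist (x - of_int n) = nint_dist x"
  using nint_dist_add_int[of x "-n"] by simp

lemma continuous_on_nint_dist: "continuous_on S nint_dist"
proof (rule continuous_onI)
  fix x e :: real assume "0 < e"
  have "dist (nint_dist x') (nint_dist x) \<le> e" if "dist x' x < e" for x'
    using nint_dist_add_le[of x "x' - x"] nint_dist_add_le[of x' "x - x'"] that
    by (simp add: dist_real_def)
  then show "\<exists>d>0. \<forall>x'\<in>S. dist x' x < d \<longrightarrow> dist (nint_dist x') (nint_dist x) \<le> e"
    using \<open>0 < e\<close> by blast
qed

lemma nint_dist_fraction: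
  assumes "l \<le> q" "0 < q"
  shows "nint_dist (real l / real q) = real (min l (q - l)) / real q"
proof (rule antisym)
  have "nint_dist (real l / real q) \<le> real l / real q"
    using nint_dist_le_abs[of "real l / real q"] by simp
  moreover have "nint_dist (real l / real q) \<le> real (q - l) / real q"
  proof -
    have "\<bar>real l / real q - 1\<bar> = real (q - l) / real q"
      using assms by (simp add: field_simps of_nat_diff abs_if)
    then show ?thesis using nint_dist_le[of "real l / real q" 1] by simp
  qed
  ultimately show "nint_dist (real l / real q) \<le> real (min l (q - l)) / real q"
    by (simp add: min_def)
next
  define n where "n = round (real l / real q)"
  have "real (min l (q - l)) \<le> \<bar>real l - of_int n * real q\<bar>"
  proof (cases "n \<le> 0")
    case True
    then have "of_int n * real q \<le> 0" by (simp add: mult_nonpos_nonneg)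
    then show ?thesis by simp
  next
    case False
    then have "1 * real q \<le> of_int n * real q" by (intro mult_right_mono) auto
    then have "real q - real l \<le> \<bar>real l - of_int n * real q\<bar>" by simp
    moreover have "real (min l (q - l)) \<le> real (q - l)" by simp
    ultimately show ?thesis using assms by (simp add: of_nat_diff)
  qed
  also have "real l - of_int n * real q = (real l / real q - of_int n) * real q"
    using assms by (simp add: left_diff_distrib)
  also have "\<bar>\<dots>\<bar> = nint_dist (real l / real q) * real q"
    by (simp add: nint_dist_def n_def abs_mult)
  finally show "real (min l (q - l)) / real q \<le> nint_dist (real l / real q)"
    using assms by (simp add: field_simps)
qed

abbreviation orbit_dist :: "real \<Rightarrow> real \<Rightarrow> nat \<Rightarrow> real" where
  "orbit_dist \<alpha> y k \<equiv> nint_dist (y + real k * \<alpha>)"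

definition orbit_sum :: "real \<Rightarrow> nat \<Rightarrow> real \<Rightarrow> real" where
  "orbit_sum \<alpha> n y = (\<Sum>k<n. 1 / orbit_dist \<alpha> y k)"

text \<open>Only forward iterates occur, since time averages run over positive times. The condition
  also keeps the convention \<open>1 / 0 = 0\<close> from hiding a singular term of
  \<open>orbit_sum\<close>.\<close>

definition avoids_zero :: "real \<Rightarrow> real \<Rightarrow> bool" where
  "avoids_zero \<alpha> y \<longleftrightarrow> (\<forall>k::nat. y + real k * \<alpha> \<notin> \<int>)"

lemma avoids_zero_pos: "avoids_zero \<alpha> y \<Longrightarrow> 0 < orbit_dist \<alpha> y k"
  using nint_dist_eq_0_iff[of "y + real k * \<alpha>"] nint_dist_nonneg[of "y + real k * \<alpha>"]
  by (simp add: avoids_zero_def less_le)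

lemma avoids_zero_shift: "avoids_zero \<alpha> y \<Longrightarrow> avoids_zero \<alpha> (y + real m * \<alpha>)"
  unfolding avoids_zero_def
  by (metis (no_types, opaque_lifting) add.assoc add.commute distrib_right of_nat_add)

lemma orbit_sum_nonneg [simp]: "0 \<le> orbit_sum \<alpha> n y"
  by (simp add: orbit_sum_def sum_nonneg)

lemma orbit_sum_mono: "m \<le> n \<Longrightarrow> orbit_sum \<alpha> m y \<le> orbit_sum \<alpha> n y"
  unfolding orbit_sum_def by (intro sum_mono2) auto

lemma orbit_sum_add:
  "orbit_sum \<alpha> (m + n) y = orbit_sum \<alpha> m y + orbit_sum \<alpha> n (y + real m * \<alpha>)"
  by (induction n) (auto simp: orbit_sum_def algebra_simps)

section \<open>Harmonic sums and blocks of \<open>q\<close> consecutive orbit points\<close>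

lemma harmonic_le: "(\<Sum>l<n. 1 / real (l + 1)) \<le> 1 + ln (real n)" if "0 < n"
proof -
  have "(\<Sum>l<n. 1 / real (l + 1)) = harm n"
    unfolding harm_def by (rule sum.reindex_bij_witness[of _ "\<lambda>i. i - 1" "\<lambda>i. i + 1"])
      (auto simp: divide_inverse)
  also have "\<dots> \<le> 1 + ln (real n)"
    using that
  proof (induction n rule: nat_induct_non_zero)
    case (Suc n)
    have "ln (real n / real (Suc n)) \<le> real n / real (Suc n) - 1"
      using Suc by (intro ln_le_minus_one) auto
    also have "\<dots> = - (1 / real (Suc n))" by (simp add: field_simps)
    finally have "ln (real n) + 1 / real (Suc n) \<le> ln (real (Suc n))"
      using Suc by (simp add: ln_div)
    then show ?case using Suc by (simp add: harm_Suc divide_inverse)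
  qed (simp add: harm_def)
  finally show ?thesis .
qed

lemma shifted_harmonic_ge: "ln (real n + 2) - ln 2 \<le> (\<Sum>l<n. 1 / real (l + 2))"
proof (induction n)
  case (Suc n)
  have "ln ((real n + 3) / (real n + 2)) \<le> (real n + 3) / (real n + 2) - 1"
    by (intro ln_le_minus_one) auto
  then have "ln (real n + 3) - ln (real n + 2) \<le> 1 / (real n + 2)"
    by (simp add: ln_div field_simps)
  with Suc show ?case by (simp add: algebra_simps)
qed simp

text \<open>Up to \<open>2/q\<close>, a block of \<open>q\<close> consecutive orbit points is a translate of the
  \<open>q\<close>-torsion points, because \<open>k \<mapsto> k p mod q\<close> is a permutation.\<close>

lemma block_permutation:
  fixes q :: nat and p :: int
  assumes q: "0 < q" and cop: "coprime p (int q)"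
    and app: "\<bar>real q * \<alpha> - of_int p\<bar> \<le> 1 / real q"
  obtains \<tau> :: "nat \<Rightarrow> nat" where "bij_betw \<tau> {..<q} {..<q}"
    and "\<And>k. k < q \<Longrightarrow> orbit_dist \<alpha> z k \<le> (real (\<tau> k) + 2) / real q"
    and "\<And>k. k < q \<Longrightarrow> (real (min (\<tau> k) (q - \<tau> k)) - 2) / real q \<le> orbit_dist \<alpha> z k"
proof -
  \<comment> \<open>Replacing \<open>z\<close> by \<open>w / q\<close> and \<open>\<alpha>\<close>
    by \<open>p / q\<close> costs at most \<open>1 / q\<close> each; these are the errors
    \<open>e1\<close> and \<open>e2\<close> below.\<close>
  define w where "w = \<lfloor>z * real q\<rfloor>"
  define \<tau> where "\<tau> k = nat ((int k * p + w) mod int q)" for k :: nat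
  have lt: "\<tau> k < q" for k
    using q by (simp add: \<tau>_def nat_less_iff)
  have tau: "int (\<tau> k) = (int k * p + w) mod int q" for k
    using q by (simp add: \<tau>_def)
  have inj: "inj_on \<tau> {..<q}"
  proof (rule inj_onI)
    fix k l assume kl: "k \<in> {..<q}" "l \<in> {..<q}" "\<tau> k = \<tau> l"
    then have "(int k * p + w) mod int q = (int l * p + w) mod int q"
      using tau by metis
    then have "int q dvd (int k * p + w) - (int l * p + w)"
      by (simp add: mod_eq_dvd_iff)
    then have "int q dvd (int k - int l) * p" by (simp add: algebra_simps)
    then have "int q dvd int k - int l"
      using cop by (simp add: coprime_commute coprime_dvd_mult_left_iff)
    then have "int k mod int q = int l mod int q" by (simp add: mod_eq_dvd_iff)
    then show "k = l" using kl by simp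
  qed
  have bij: "bij_betw \<tau> {..<q} {..<q}"
    unfolding bij_betw_def using inj lt
    by (metis card_image card_subset_eq finite_lessThan image_subsetI lessThan_iff)
  have close: "\<exists>n e. z + real k * \<alpha> = real (\<tau> k) / real q + e + of_int n \<and> \<bar>e\<bar> \<le> 2 / real q"
    if "k < q" for k
  proof -
    define n where "n = (int k * p + w) div int q"
    define e1 where "e1 = (z * real q - of_int w) / real q"
    define e2 where "e2 = real k * (real q * \<alpha> - of_int p) / real q"
    have "int k * p + w = int q * n + int (\<tau> k)"
      by (simp add: n_def tau)
    then have "real_of_int (int k * p + w) = real_of_int (int q * n + int (\<tau> k))" by simp
    then have eq: "real k * of_int p + of_int w = real q * of_int n + real (\<tau> k)" by simp
    have "real q * (real (\<tau> k) / real q + (e1 + e2) + of_int n) = real q * (z + real k * \<alpha>)"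
      using q eq by (simp add: e1_def e2_def distrib_left) (simp add: algebra_simps)
    then have "z + real k * \<alpha> = real (\<tau> k) / real q + (e1 + e2) + of_int n"
      using q by simp
    moreover have "\<bar>e1\<bar> \<le> 1 / real q"
    proof -
      have "0 \<le> z * real q - of_int w" "z * real q - of_int w \<le> 1"
        unfolding w_def by linarith+
      then show ?thesis using q by (simp add: e1_def divide_right_mono)
    qed
    moreover have "\<bar>e2\<bar> \<le> 1 / real q"
    proof -
      have "real k * \<bar>real q * \<alpha> - of_int p\<bar> \<le> real q * (1 / real q)"
        using that app by (intro mult_mono) auto
      then show ?thesis using q by (simp add: e2_def abs_mult divide_right_mono)
    qed
    ultimately show ?thesis
      by (intro exI[of _ n] exI[of _ "e1 + e2"]) auto
  qed
  show thesis
  proof (rule that[OF bij])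
    fix k assume "k < q"
    then obtain n e where ne: "z + real k * \<alpha> = real (\<tau> k) / real q + e + of_int n" "\<bar>e\<bar> \<le> 2 / real q"
      using close by blast
    have eq: "orbit_dist \<alpha> z k = nint_dist (real (\<tau> k) / real q + e)"
      unfolding ne(1) by simp
    have "nint_dist (real (\<tau> k) / real q + e) \<le> \<bar>real (\<tau> k) / real q + e\<bar>"
      by (rule nint_dist_le_abs)
    also have "\<dots> \<le> real (\<tau> k) / real q + \<bar>e\<bar>"
      using abs_triangle_ineq[of "real (\<tau> k) / real q" e] by simp
    finally show "orbit_dist \<alpha> z k \<le> (real (\<tau> k) + 2) / real q"
      using ne(2) eq by (simp add: add_divide_distrib)
    have "real (min (\<tau> k) (q - \<tau> k)) / real q = nint_dist (real (\<tau> k) / real q)"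
      using lt[of k] q by (simp add: nint_dist_fraction)
    also have "\<dots> \<le> nint_dist (real (\<tau> k) / real q + e) + \<bar>e\<bar>"
      using nint_dist_add_le[of "real (\<tau> k) / real q + e" "-e"] by simp
    finally show "(real (min (\<tau> k) (q - \<tau> k)) - 2) / real q \<le> orbit_dist \<alpha> z k"
      using ne(2) eq by (simp add: diff_divide_distrib)
  qed
qed

text \<open>The bound \<open>(l + 2) / q\<close> for the distance with index \<open>l\<close> turns
  the block into a harmonic sum that starts only at \<open>1 / 2\<close>; this costs the
  \<open>ln 2\<close>.\<close>

lemma block_sum_ge:
  fixes q :: nat and p :: int
  assumes "0 < q" "coprime p (int q)" "\<bar>real q * \<alpha> - of_int p\<bar> \<le> 1 / real q"
    and av: "avoids_zero \<alpha> z"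
  shows "real q * (ln (real q) - ln 2) \<le> orbit_sum \<alpha> q z"
proof -
  obtain \<tau> where bij: "bij_betw \<tau> {..<q} {..<q}"
    and up: "\<And>k. k < q \<Longrightarrow> orbit_dist \<alpha> z k \<le> (real (\<tau> k) + 2) / real q"
    using block_permutation[OF assms(1-3), of z] by metis
  have "real q * (ln (real q) - ln 2) \<le> real q * (ln (real q + 2) - ln 2)"
    using assms(1) by (intro mult_left_mono) auto
  also have "\<dots> \<le> real q * (\<Sum>l<q. 1 / real (l + 2))"
    by (intro mult_left_mono shifted_harmonic_ge) auto
  also have "\<dots> = (\<Sum>l<q. real q / real (l + 2))" by (simp add: sum_distrib_left)
  also have "\<dots> = (\<Sum>k<q. real q / real (\<tau> k + 2))"
    by (rule sum.reindex_bij_betw[OF bij, symmetric])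
  also have "\<dots> \<le> orbit_sum \<alpha> q z"
    unfolding orbit_sum_def
  proof (intro sum_mono)
    fix k assume "k \<in> {..<q}"
    then have "1 / ((real (\<tau> k) + 2) / real q) \<le> 1 / orbit_dist \<alpha> z k"
      using avoids_zero_pos[OF av] up by (intro divide_left_mono mult_pos_pos) (auto intro!: divide_pos_pos simp: assms(1))
    then show "real q / real (\<tau> k + 2) \<le> 1 / orbit_dist \<alpha> z k"
      by (simp add: add.commute)
  qed
  finally show ?thesis .
qed

text \<open>The lower bound for the distance is useless at the five indices
  \<open>0, 1, 2, q - 2, q - 1\<close>, so these are paid for with \<open>M\<close>. Elsewhere the
  minimum over the two sides of the circle is replaced by a sum of two reciprocals, which yields two
  harmonic sums.\<close>

lemma block_sum_le:
  fixes q :: nat and p :: int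
  assumes q: "0 < q" "coprime p (int q)" "\<bar>real q * \<alpha> - of_int p\<bar> \<le> 1 / real q"
    and M: "\<And>k. k < q \<Longrightarrow> 1 / orbit_dist \<alpha> z k \<le> M"
  shows "orbit_sum \<alpha> q z \<le> 2 * real q * (1 + ln (real q)) + 5 * M"
proof -
  obtain \<tau> where bij: "bij_betw \<tau> {..<q} {..<q}"
    and lo: "\<And>k. k < q \<Longrightarrow> (real (min (\<tau> k) (q - \<tau> k)) - 2) / real q \<le> orbit_dist \<alpha> z k"
    using block_permutation[OF assms(1-3), of z] by metis
  have M0: "0 \<le> M" using M[of 0] q(1) by (meson divide_nonneg_nonneg nint_dist_nonneg order_trans zero_le_one)
  let ?S = "{l \<in> {..<q}. l \<le> 2 \<or> q \<le> l + 2}"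
  define g where "g l = (if l \<le> 2 \<or> q \<le> l + 2 then M else real q / (real l - 2) + real q / (real q - real l - 2))" for l
  have "orbit_sum \<alpha> q z \<le> (\<Sum>k<q. g (\<tau> k))"
    unfolding orbit_sum_def
  proof (intro sum_mono)
    fix k assume k: "k \<in> {..<q}"
    show "1 / orbit_dist \<alpha> z k \<le> g (\<tau> k)"
    proof (cases "\<tau> k \<le> 2 \<or> q \<le> \<tau> k + 2")
      case True
      then show ?thesis using M k by (simp add: g_def)
    next
      case False
      let ?m = "min (\<tau> k) (q - \<tau> k)"
      have m: "real ?m - 2 > 0" using False by auto
      then have "1 / orbit_dist \<alpha> z k \<le> 1 / ((real ?m - 2) / real q)"
        using lo[of k] k q(1) by (intro divide_left_mono mult_pos_pos less_le_trans[OF _ lo]) auto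
      also have "\<dots> = real q / (real ?m - 2)" by simp
      also have "\<dots> \<le> real q / (real (\<tau> k) - 2) + real q / (real q - real (\<tau> k) - 2)"
        using False by (auto simp: min_def of_nat_diff)
      finally show ?thesis using False by (simp add: g_def)
    qed
  qed
  also have "\<dots> = (\<Sum>l<q. g l)" by (rule sum.reindex_bij_betw[OF bij])
  also have "\<dots> = (\<Sum>l\<in>?S. g l) + (\<Sum>l\<in>{..<q} - ?S. g l)"
    by (subst sum.subset_diff[of ?S]) auto
  also have "(\<Sum>l\<in>?S. g l) = real (card ?S) * M" by (simp add: g_def)
  also have "\<dots> \<le> 5 * M"
  proof -
    have "?S \<subseteq> {0,1,2,q-1,q-2}" by auto
    then have "card ?S \<le> card {0,1,2,q-1,q-2}" by (intro card_mono) auto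
    also have "\<dots> \<le> 5" by (simp add: card_insert_if)
    finally show ?thesis using M0 by (intro mult_right_mono) auto
  qed
  also have "(\<Sum>l\<in>{..<q} - ?S. g l) = (\<Sum>l\<in>{3..<q-2}. real q / (real l - 2)) + (\<Sum>l\<in>{3..<q-2}. real q / (real q - real l - 2))"
    unfolding sum.distrib[symmetric]
    by (intro sum.cong) (auto simp: g_def)
  also have "(\<Sum>l\<in>{3..<q-2}. real q / (real l - 2)) = (\<Sum>l<q-5. real q / real (l + 1))"
    by (rule sum.reindex_bij_witness[of _ "\<lambda>i. i + 3" "\<lambda>i. i - 3"]) auto
  also have "(\<Sum>l\<in>{3..<q-2}. real q / (real q - real l - 2)) = (\<Sum>l<q-5. real q / real (l + 1))"
    by (rule sum.reindex_bij_witness[of _ "\<lambda>i. q - 3 - i" "\<lambda>i. q - 3 - i"]) auto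
  also have "(\<Sum>l<q-5. real q / real (l + 1)) \<le> (\<Sum>l<q. real q / real (l + 1))"
    by (intro sum_mono2) auto
  also have "\<dots> = real q * (\<Sum>l<q. 1 / real (l + 1))" by (simp add: sum_distrib_left)
  also have "\<dots> \<le> real q * (1 + ln (real q))"
    using harmonic_le[OF q(1)] by (intro mult_left_mono) auto
  finally show ?thesis by simp
qed

text \<open>Up to the error \<open>2 / q\<close>, a point this close to an integer has an index
  within \<open>D + 2\<close> of \<open>0\<close> or of \<open>q\<close>: \<open>D + 3\<close>
  indices on the left, and \<open>D + 2\<close> on the right because \<open>q\<close> itself is not
  an index.\<close>

lemma block_count_le:
  fixes q D :: nat and p :: int
  assumes q: "0 < q" "coprime p (int q)" "\<bar>real q * \<alpha> - of_int p\<bar> \<le> 1 / real q"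
  shows "card {k. k < q \<and> orbit_dist \<alpha> z k \<le> real D / real q} \<le> 2 * D + 5"
proof -
  obtain \<tau> where bij: "bij_betw \<tau> {..<q} {..<q}"
    and lo: "\<And>k. k < q \<Longrightarrow> (real (min (\<tau> k) (q - \<tau> k)) - 2) / real q \<le> orbit_dist \<alpha> z k"
    using block_permutation[OF assms(1-3), of z] by metis
  let ?A = "{k. k < q \<and> orbit_dist \<alpha> z k \<le> real D / real q}"
  have "\<tau> ` ?A \<subseteq> {..<D+3} \<union> {q-D-2..<q}"
  proof
    fix l assume "l \<in> \<tau> ` ?A"
    then obtain k where k: "k < q" "orbit_dist \<alpha> z k \<le> real D / real q" "l = \<tau> k" by auto
    have "(real (min l (q - l)) - 2) / real q \<le> real D / real q"
      using lo[OF k(1)] k by simp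
    then have "real (min l (q - l)) \<le> real (D + 2)" using q(1) by (simp add: divide_le_cancel)
    then have "min l (q - l) \<le> D + 2" by linarith
    moreover have "l < q" using bij k by (auto simp: bij_betw_def)
    ultimately show "l \<in> {..<D+3} \<union> {q-D-2..<q}" by auto
  qed
  then have "card (\<tau> ` ?A) \<le> card ({..<D+3} \<union> {q-D-2..<q})" by (intro card_mono) auto
  also have "\<dots> \<le> card {..<D+3} + card {q-D-2..<q}" by (rule card_Un_le)
  also have "\<dots> \<le> 2 * D + 5" by simp
  finally show ?thesis
    using bij by (subst (asm) card_image) (auto simp: bij_betw_def intro: inj_on_subset)
qed

section \<open>Convergents of a continued fraction\<close>

text \<open>Indices are shifted by one: \<open>p\<^sub>n = cf_numer a (Suc n)\<close> and \<open>q\<^sub>n = cf_denom a (Suc n)\<close>,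
  while index 0 stands for \<open>p\<^sub>-\<^sub>1 = 1\<close> and \<open>q\<^sub>-\<^sub>1 = 0\<close>.\<close>

fun cf_numer :: "(nat \<Rightarrow> int) \<Rightarrow> nat \<Rightarrow> int" where
  "cf_numer a 0 = 1"
| "cf_numer a (Suc 0) = a 0"
| "cf_numer a (Suc (Suc n)) = a (Suc n) * cf_numer a (Suc n) + cf_numer a n"

fun cf_denom :: "(nat \<Rightarrow> int) \<Rightarrow> nat \<Rightarrow> int" where
  "cf_denom a 0 = 0"
| "cf_denom a (Suc 0) = 1"
| "cf_denom a (Suc (Suc n)) = a (Suc n) * cf_denom a (Suc n) + cf_denom a n"

text \<open>A finite continued fraction with a real last entry. A digit as last entry gives a
  convergent, the complete quotient gives \<open>\<alpha>\<close> itself, so both are values of one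
  function.\<close>

definition cf_fold :: "int list \<Rightarrow> real \<Rightarrow> real" where
  "cf_fold as x = foldr (\<lambda>a v. of_int a + 1 / v) as x"

lemma of_rat_cf_eval: "of_rat (cf_eval (as @ [d])) = cf_fold as (of_int d)"
proof (induction as)
  case (Cons a as)
  obtain b bs where "as @ [d] = b # bs" by (cases "as @ [d]") auto
  then show ?case using Cons by (simp add: cf_fold_def of_rat_add of_rat_divide)
qed (simp add: cf_fold_def)

lemma cf_determinant:
  "cf_numer a (Suc n) * cf_denom a n - cf_numer a n * cf_denom a (Suc n) = (-1) ^ Suc n"
  by (induction n) (auto simp: algebra_simps)

lemma coprime_cf_numer_denom: "coprime (cf_numer a n) (cf_denom a n)"
proof (rule coprimeI)
  fix d assume d: "d dvd cf_numer a n" "d dvd cf_denom a n"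
  then have "d dvd cf_numer a (Suc n) * cf_denom a n - cf_numer a n * cf_denom a (Suc n)"
    by (intro dvd_diff) auto
  then have "d dvd (-1) ^ Suc n" by (simp only: cf_determinant)
  then show "is_unit d" by (simp add: minus_one_power_iff split: if_splits)
qed

context
  fixes a :: "nat \<Rightarrow> int"
  assumes a_ge_1: "\<And>n. 1 \<le> a (Suc n)"
begin

lemma cf_denom_nonneg: "0 \<le> cf_denom a n \<and> 0 < cf_denom a (Suc n)"
proof (induction n)
  case (Suc n)
  have "1 * 1 \<le> a (Suc n) * cf_denom a (Suc n)"
    using a_ge_1[of n] Suc by (intro mult_mono) auto
  then show ?case using Suc by simp
qed simp

text \<open>Each digit acts as a Moebius map. The induction absorbs the last digit into the
  argument, which is why \<open>x\<close> stays arbitrary.\<close>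

lemma cf_fold_eq:
  assumes "0 < x"
  shows "cf_fold (map a [0..<Suc n]) x =
    (of_int (cf_numer a (Suc n)) * x + of_int (cf_numer a n)) /
    (of_int (cf_denom a (Suc n)) * x + of_int (cf_denom a n))"
  using assms
proof (induction n arbitrary: x)
  case 0
  then show ?case by (simp add: cf_fold_def field_simps)
next
  case (Suc n)
  let ?x = "of_int (a (Suc n)) + 1 / x"
  have pos: "0 < ?x" using a_ge_1[of n] Suc.prems by (intro add_pos_pos) auto
  have "cf_fold (map a [0..<Suc (Suc n)]) x = cf_fold (map a [0..<Suc n]) ?x"
    by (simp add: cf_fold_def)
  also have "\<dots> = (of_int (cf_numer a (Suc n)) * ?x + of_int (cf_numer a n)) /
    (of_int (cf_denom a (Suc n)) * ?x + of_int (cf_denom a n))"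
    by (rule Suc.IH[OF pos])
  also have "\<dots> = ((of_int (cf_numer a (Suc n)) * ?x + of_int (cf_numer a n)) * x) /
    ((of_int (cf_denom a (Suc n)) * ?x + of_int (cf_denom a n)) * x)"
    using Suc.prems by simp
  also have "(of_int (cf_numer a (Suc n)) * ?x + of_int (cf_numer a n)) * x =
      of_int (cf_numer a (Suc (Suc n))) * x + of_int (cf_numer a (Suc n))"
    using Suc.prems by (simp add: algebra_simps)
  also have "(of_int (cf_denom a (Suc n)) * ?x + of_int (cf_denom a n)) * x =
      of_int (cf_denom a (Suc (Suc n))) * x + of_int (cf_denom a (Suc n))"
    using Suc.prems by (simp add: algebra_simps)
  finally show ?case .
qed

end

context
  fixes \<alpha> :: real
  assumes irrational: "\<alpha> \<notin> \<rat>"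
begin

lemma cf_remainder_irrational: "cf_remainder \<alpha> n \<notin> \<rat>"
proof (induction n)
  case (Suc n)
  show ?case
  proof
    assume "cf_remainder \<alpha> (Suc n) \<in> \<rat>"
    then have "inverse (1 / frac (cf_remainder \<alpha> n)) \<in> \<rat>" by (intro Rats_inverse) simp
    then have "frac (cf_remainder \<alpha> n) \<in> \<rat>" by simp
    then have "frac (cf_remainder \<alpha> n) + of_int \<lfloor>cf_remainder \<alpha> n\<rfloor> \<in> \<rat>"
      by (rule Rats_add[OF _ Rats_of_int])
    then show False using Suc by (simp add: frac_def)
  qed
qed (use irrational in simp)

lemma cf_remainder_frac_pos: "0 < frac (cf_remainder \<alpha> n)"
  using cf_remainder_irrational[of n] by (metis Ints_subset_Rats frac_gt_0_iff subsetD)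

lemma cf_remainder_gt_1: "1 < cf_remainder \<alpha> (Suc n)"
  using cf_remainder_frac_pos[of n] frac_lt_1[of "cf_remainder \<alpha> n"] by simp

lemma cf_digit_ge_1: "1 \<le> cf_digit \<alpha> (Suc n)"
  using cf_remainder_gt_1[of n] by (simp add: cf_digit_def del: cf_remainder.simps)

lemma cf_remainder_eq: "cf_remainder \<alpha> n = of_int (cf_digit \<alpha> n) + 1 / cf_remainder \<alpha> (Suc n)"
  by (simp add: cf_digit_def frac_def)

lemma cf_fold_remainder: "cf_fold (map (cf_digit \<alpha>) [0..<n]) (cf_remainder \<alpha> n) = \<alpha>"
proof (induction n)
  case (Suc n)
  have "cf_fold (map (cf_digit \<alpha>) [0..<Suc n]) (cf_remainder \<alpha> (Suc n)) =
      cf_fold (map (cf_digit \<alpha>) [0..<n]) (cf_remainder \<alpha> n)"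
    unfolding cf_remainder_eq[of n] by (simp add: cf_fold_def)
  with Suc show ?case by simp
qed (simp add: cf_fold_def)

text \<open>The determinant identity makes the recursively computed fraction reduced, so the lowest
  terms chosen by \<open>quotient_of\<close> are given by the recursion.\<close>

lemma quotient_of_cf_convergent:
  "quotient_of (cf_convergent \<alpha> n) =
    (cf_numer (cf_digit \<alpha>) (Suc n), cf_denom (cf_digit \<alpha>) (Suc n))"
proof -
  let ?p = "cf_numer (cf_digit \<alpha>) (Suc n)" and ?q = "cf_denom (cf_digit \<alpha>) (Suc n)"
  have "of_rat (cf_convergent \<alpha> n) = (of_int ?p / of_int ?q :: real)"
  proof (cases n)
    case 0
    then show ?thesis by (simp add: cf_convergent_def)
  next
    case (Suc m)
    have "of_rat (cf_convergent \<alpha> n) =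
        cf_fold (map (cf_digit \<alpha>) [0..<Suc m]) (of_int (cf_digit \<alpha> (Suc m)))"
      using of_rat_cf_eval[of "map (cf_digit \<alpha>) [0..<Suc m]" "cf_digit \<alpha> (Suc m)"]
      by (simp add: cf_convergent_def Suc)
    also have "\<dots> = of_int ?p / of_int ?q"
      using cf_digit_ge_1[of m]
        cf_fold_eq[where a = "cf_digit \<alpha>", OF cf_digit_ge_1, of "of_int (cf_digit \<alpha> (Suc m))" m]
      by (simp add: Suc mult.commute)
    finally show ?thesis .
  qed
  also have "\<dots> = of_rat (of_int ?p / of_int ?q)" by (simp add: of_rat_divide)
  finally have "cf_convergent \<alpha> n = of_int ?p / of_int ?q" by (simp only: of_rat_eq_iff)
  then have "cf_convergent \<alpha> n = Fract ?p ?q" by (simp add: Fract_of_int_quotient)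
  moreover have "0 < ?q" using cf_denom_nonneg[where a = "cf_digit \<alpha>", OF cf_digit_ge_1] by simp
  moreover have "coprime ?p ?q" by (rule coprime_cf_numer_denom)
  ultimately show ?thesis by (simp add: quotient_of_Fract normalize_stable)
qed

lemma cf_num_eq: "cf_num \<alpha> n = cf_numer (cf_digit \<alpha>) (Suc n)"
  and cf_den_eq: "cf_den \<alpha> n = cf_denom (cf_digit \<alpha>) (Suc n)"
  by (simp_all add: cf_num_def cf_den_def quotient_of_cf_convergent)

lemma cf_den_pos: "0 < cf_den \<alpha> n"
  using cf_denom_nonneg[where a = "cf_digit \<alpha>", OF cf_digit_ge_1] by (simp add: cf_den_eq)

lemma coprime_cf_num_den: "coprime (cf_num \<alpha> n) (cf_den \<alpha> n)"
  unfolding cf_num_eq cf_den_eq by (rule coprime_cf_numer_denom)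

lemma cf_den_Suc_ge: "cf_digit \<alpha> (Suc n) * cf_den \<alpha> n \<le> cf_den \<alpha> (Suc n)"
  using cf_denom_nonneg[where a = "cf_digit \<alpha>", OF cf_digit_ge_1] by (simp add: cf_den_eq)

lemma cf_den_mono: "cf_den \<alpha> n \<le> cf_den \<alpha> (Suc n)"
  using cf_den_Suc_ge[of n] mult_right_mono[OF cf_digit_ge_1, of "cf_den \<alpha> n" n] cf_den_pos[of n]
  by linarith

lemma cf_den_add_le: "cf_den \<alpha> n + cf_den \<alpha> (Suc n) \<le> cf_den \<alpha> (Suc (Suc n))"
proof -
  have "cf_den \<alpha> (Suc (Suc n)) = cf_digit \<alpha> (Suc (Suc n)) * cf_den \<alpha> (Suc n) + cf_den \<alpha> n"
    by (simp add: cf_den_eq)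
  with mult_right_mono[OF cf_digit_ge_1, of "cf_den \<alpha> (Suc n)" "Suc n"] cf_den_pos[of "Suc n"]
  show ?thesis by simp
qed

text \<open>Writing \<open>\<alpha>\<close> as the Moebius image of its complete quotient
  \<open>x\<close> and using the determinant gives
  \<open>\<bar>\<rho>\<bar> = 1 / (Q1 * x + Q0)\<close> exactly; lowering \<open>x\<close> to its
  integer part turns the denominator into the next \<open>cf_den\<close>.\<close>

lemma abs_cf_rho_le: "\<bar>cf_rho \<alpha> n\<bar> \<le> 1 / of_int (cf_den \<alpha> (Suc n))"
proof -
  define P1 P0 Q1 Q0 where PQ: "P1 = cf_numer (cf_digit \<alpha>) (Suc n)" "P0 = cf_numer (cf_digit \<alpha>) n"
    "Q1 = cf_denom (cf_digit \<alpha>) (Suc n)" "Q0 = cf_denom (cf_digit \<alpha>) n"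
  define x where "x = cf_remainder \<alpha> (Suc n)"
  have x: "1 < x" unfolding x_def by (rule cf_remainder_gt_1)
  have Q: "0 < Q1" "0 \<le> Q0" using cf_denom_nonneg[where a = "cf_digit \<alpha>", OF cf_digit_ge_1] by (simp_all add: PQ)
  define d where "d = of_int Q1 * x + of_int Q0"
  have d: "0 < d" unfolding d_def using x Q by (intro add_pos_nonneg) auto
  have "\<alpha> = (of_int P1 * x + of_int P0) / d"
    using cf_fold_eq[where a = "cf_digit \<alpha>", OF cf_digit_ge_1, of x n] cf_fold_remainder[of "Suc n"] x
    by (simp add: PQ d_def x_def del: cf_remainder.simps upt_Suc)
  then have "cf_rho \<alpha> n = of_int Q1 * ((of_int P1 * x + of_int P0) / d) - of_int P1"
    by (simp add: cf_rho_def cf_num_eq cf_den_eq PQ)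
  also have "\<dots> = of_int (- (P1 * Q0 - P0 * Q1)) / d"
    using d by (simp add: field_simps) (simp add: d_def algebra_simps)
  also have "P1 * Q0 - P0 * Q1 = (-1) ^ Suc n"
    unfolding PQ by (rule cf_determinant)
  finally have "\<bar>cf_rho \<alpha> n\<bar> = 1 / d" using d by (simp add: abs_mult power_abs)
  also have "\<dots> \<le> 1 / of_int (cf_den \<alpha> (Suc n))"
  proof (rule divide_left_mono)
    have "of_int (cf_digit \<alpha> (Suc n)) \<le> x"
      by (simp add: cf_digit_def x_def del: cf_remainder.simps)
    then have "of_int (cf_digit \<alpha> (Suc n)) * real_of_int Q1 \<le> x * of_int Q1"
      using Q by (intro mult_right_mono) auto
    then show "of_int (cf_den \<alpha> (Suc n)) \<le> d"
      by (simp add: cf_den_eq d_def PQ mult.commute)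
    show "0 < d * of_int (cf_den \<alpha> (Suc n))"
      using d cf_den_pos[of "Suc n"] by simp
  qed simp
  finally show ?thesis .
qed

end

section \<open>Lower bounds for orbit sums\<close>

text \<open>What the estimates for orbit sums need to know about continued fractions.
  \<open>q_add_le\<close> stands for the recursion with digits at least 1 and yields doubling in two
  steps.\<close>

locale convergents =
  fixes \<alpha> :: real and p :: "nat \<Rightarrow> int" and q :: "nat \<Rightarrow> nat"
  assumes q_pos: "0 < q n"
    and q_mono_Suc: "q n \<le> q (Suc n)"
    and q_add_le: "q n + q (Suc n) \<le> q (Suc (Suc n))"
    and coprime_pq: "coprime (p n) (int (q n))"
    and abs_rho_le: "\<bar>real (q n) * \<alpha> - of_int (p n)\<bar> \<le> 1 / real (q (Suc n))"
begin

lemma q_mono: "m \<le> n \<Longrightarrow> q m \<le> q n"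
  using q_mono_Suc by (rule lift_Suc_mono_le)

lemma q_ge: "n \<le> q (Suc n)"
proof (induction n)
  case (Suc n)
  with q_add_le[of n] q_pos[of n] show ?case by linarith
qed simp

lemma filterlim_q: "filterlim q at_top at_top"
proof (subst filterlim_at_top, intro allI)
  fix Z show "\<forall>\<^sub>F n in sequentially. Z \<le> q n"
    using q_ge q_mono by (intro eventually_sequentiallyI[of "Suc Z"]) (meson order_trans)
qed

lemma abs_rho_le': "\<bar>real (q n) * \<alpha> - of_int (p n)\<bar> \<le> 1 / real (q n)"
proof -
  have "1 / real (q (Suc n)) \<le> 1 / real (q n)"
    using q_mono_Suc[of n] q_pos[of n] q_pos[of "Suc n"] by (intro divide_left_mono) auto
  then show ?thesis using abs_rho_le[of n] by linarith
qed

lemmas block_sum_ge_q = block_sum_ge[OF q_pos coprime_pq abs_rho_le']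
lemmas block_sum_le_q = block_sum_le[OF q_pos coprime_pq abs_rho_le']
lemmas block_count_le_q = block_count_le[OF q_pos coprime_pq abs_rho_le']

lemma orbit_sum_blocks_ge:
  assumes "avoids_zero \<alpha> y"
  shows "real i * (real (q n) * (ln (real (q n)) - ln 2)) \<le> orbit_sum \<alpha> (i * q n) y"
  using assms
proof (induction i)
  case (Suc i)
  have "real (q n) * (ln (real (q n)) - ln 2) \<le> orbit_sum \<alpha> (q n) (y + real (i * q n) * \<alpha>)"
    using Suc.prems by (intro block_sum_ge_q avoids_zero_shift)
  then show ?case
    using Suc orbit_sum_add[of \<alpha> "i * q n" "q n" y] by (simp add: add.commute algebra_simps)
qed simp

lemma orbit_sum_ge:
  assumes av: "avoids_zero \<alpha> y" and "q n \<le> N"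
  shows "real N / 2 * (ln (real (q n)) - ln 2) \<le> orbit_sum \<alpha> N y"
\<comment> \<open>For \<open>q n = 1\<close> the factor \<open>ln (q n) - ln 2\<close> is negative
  and the bound is trivial. Otherwise the factor is nonnegative, and dropping the incomplete last
  block loses at most half of \<open>N\<close>.\<close>
proof (cases "q n = 1")
  case True
  have "real N / 2 * (- ln 2) \<le> real N / 2 * 0" by (intro mult_left_mono) auto
  also have "\<dots> \<le> orbit_sum \<alpha> N y" by simp
  finally show ?thesis using True by simp
next
  case False
  define i where "i = N div q n"
  have q2: "2 \<le> q n" using False q_pos[of n] by linarith
  have i: "1 \<le> i" using assms q_pos[of n] by (simp add: i_def Suc_le_eq div_greater_zero_iff)
  have "N < (i + 1) * q n" unfolding i_def by (metis add.commute dividend_less_div_times q_pos plus_1_eq_Suc mult_Suc)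
  also have "\<dots> \<le> (2 * i) * q n" using i by (intro mult_right_mono) auto
  finally have "real N \<le> real (2 * i * q n)" by (simp only: of_nat_le_iff)
  then have "real N / 2 \<le> real i * real (q n)" by simp
  moreover have "ln 2 \<le> ln (real (q n))" using q2 by simp
  ultimately have "real N / 2 * (ln (real (q n)) - ln 2) \<le> real i * real (q n) * (ln (real (q n)) - ln 2)"
    by (intro mult_right_mono) auto
  also have "\<dots> \<le> orbit_sum \<alpha> (i * q n) y"
    using orbit_sum_blocks_ge[OF av, of i n] by (simp add: mult.assoc)
  also have "\<dots> \<le> orbit_sum \<alpha> N y"
    by (intro orbit_sum_mono) (simp add: i_def)
  finally show ?thesis .
qed

lemma orbit_sum_div_at_top:
  assumes av: "avoids_zero \<alpha> y"
  shows "filterlim (\<lambda>N. orbit_sum \<alpha> N y / real N) at_top at_top"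
  unfolding filterlim_at_top
proof
  fix Z :: real
  have "filterlim (\<lambda>n. ln (real (q n))) at_top at_top"
    by (intro filterlim_compose[OF ln_at_top] filterlim_compose[OF filterlim_real_sequentially] filterlim_q)
  then obtain n where n: "2 * Z + ln 2 \<le> ln (real (q n))"
    unfolding filterlim_at_top by (meson eventually_happens sequentially_bot)
  show "\<forall>\<^sub>F N in sequentially. Z \<le> orbit_sum \<alpha> N y / real N"
  proof (rule eventually_sequentiallyI[of "q n"])
    fix N assume N: "q n \<le> N"
    then have "0 < N" using q_pos[of n] by linarith
    have "Z * real N \<le> real N / 2 * (ln (real (q n)) - ln 2)"
      using mult_left_mono[OF n, of "real N"] by (simp add: algebra_simps)
    also note orbit_sum_ge[OF av N]
    finally show "Z \<le> orbit_sum \<alpha> N y / real N" using \<open>0 < N\<close> by (simp add: field_simps)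
  qed
qed

text \<open>When \<open>y + k \<alpha>\<close> is close to an integer, so are the points \<open>y + (k - i q\<^sub>n) \<alpha>\<close>,
  and their contribution makes up for the gap between \<open>ln q\<^sub>n\<close> and \<open>ln k\<close>.\<close>

lemma orbit_sum_ge_at_return:
  assumes av: "avoids_zero \<alpha> y" and k: "q n \<le> k" "k < q (Suc n)"
    and close: "orbit_dist \<alpha> y k \<le> 1 / real k"
  shows "real k / 4 * (ln (real k) - 2 * ln 2) \<le> orbit_sum \<alpha> k y"
proof -
  \<comment> \<open>The points with index \<open>k - (l + 1) * q n\<close>, \<open>l < h\<close>,
    still lie on the forward orbit, and each step back adds at most \<open>1 / k\<close> to the
    distance because \<open>k < q (Suc n)\<close>.\<close>
  define h where "h = k div q n"
  have k0: "0 < k" using k q_pos[of n] by linarith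
  have "k < (h + 1) * q n"
    unfolding h_def using q_pos[of n] by (metis add.commute dividend_less_div_times mult_Suc plus_1_eq_Suc)
  then have "real k \<le> (real h + 1) * real (q n)"
    by (metis less_imp_le of_nat_1 of_nat_add of_nat_le_iff of_nat_mult)
  then have "real k / real (q n) \<le> real h + 2"
    using q_pos[of n] by (simp add: field_simps)
  then have "ln (real k / real (q n)) \<le> ln (real h + 2)"
    using k0 q_pos[of n] by (subst ln_le_cancel_iff) auto
  then have h: "ln (real k) - ln (real (q n)) \<le> ln (real h + 2)"
    using k0 q_pos[of n] by (simp add: ln_div)
  have "real k * (ln (real h + 2) - ln 2) \<le> real k * (\<Sum>l<h. 1 / real (l + 2))"
    by (intro mult_left_mono shifted_harmonic_ge) auto
  also have "\<dots> = (\<Sum>l<h. real k / real (l + 2))" by (simp add: sum_distrib_left)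
  also have "\<dots> \<le> (\<Sum>l<h. 1 / orbit_dist \<alpha> y (k - (l + 1) * q n))"
  proof (intro sum_mono)
    fix l assume "l \<in> {..<h}"
    then have "(l + 1) * q n \<le> h * q n" by (intro mult_right_mono) auto
    also have "\<dots> \<le> k" by (simp add: h_def)
    finally have le: "(l + 1) * q n \<le> k" .
    let ?j = "k - (l + 1) * q n"
    define \<rho> where "\<rho> = real (q n) * \<alpha> - of_int (p n)"
    have "y + real ?j * \<alpha> = (y + real k * \<alpha>) + (- real (l + 1) * \<rho>) + of_int (- int (l + 1) * p n)"
      using le by (simp add: of_nat_diff \<rho>_def algebra_simps)
    then have "nint_dist (y + real ?j * \<alpha>) = nint_dist ((y + real k * \<alpha>) + (- real (l + 1) * \<rho>))"
      by (simp only: nint_dist_add_int)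
    also have "\<dots> \<le> 1 / real k + real (l + 1) * \<bar>\<rho>\<bar>"
      using nint_dist_add_le[of "y + real k * \<alpha>" "- real (l + 1) * \<rho>"] close
      by (simp add: abs_mult del: of_nat_Suc)
    also have "real (l + 1) * \<bar>\<rho>\<bar> \<le> real (l + 1) * (1 / real k)"
    proof (rule mult_left_mono)
      have "1 / real (q (Suc n)) \<le> 1 / real k" using k k0 by (intro divide_left_mono) auto
      then show "\<bar>\<rho>\<bar> \<le> 1 / real k" using abs_rho_le[of n] by (simp add: \<rho>_def)
    qed auto
    also have "1 / real k + real (l + 1) * (1 / real k) = real (l + 2) / real k"
      by (simp add: add_divide_distrib)
    finally have "nint_dist (y + real ?j * \<alpha>) \<le> real (l + 2) / real k" by simp
    then have "1 / (real (l + 2) / real k) \<le> 1 / nint_dist (y + real ?j * \<alpha>)"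
      using avoids_zero_pos[OF av, of ?j] k0 by (intro divide_left_mono) auto
    then show "real k / real (l + 2) \<le> 1 / nint_dist (y + real ?j * \<alpha>)" by simp
  qed
  also have "\<dots> = (\<Sum>j\<in>(\<lambda>l. k - (l + 1) * q n) ` {..<h}. 1 / orbit_dist \<alpha> y j)"
  proof (rule sum.reindex_cong[symmetric, OF _ refl])
    show "inj_on (\<lambda>l. k - (l + 1) * q n) {..<h}"
    proof (rule inj_onI)
      fix l l' assume l: "l \<in> {..<h}" "l' \<in> {..<h}" and eq: "k - (l + 1) * q n = k - (l' + 1) * q n"
      have "(l + 1) * q n \<le> h * q n" "(l' + 1) * q n \<le> h * q n"
        using l by (auto intro!: mult_right_mono simp del: mult_Suc add_mult_distrib)
      moreover have "h * q n \<le> k" by (simp add: h_def)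
      ultimately have "(l + 1) * q n = (l' + 1) * q n" using eq by linarith
      then show "l = l'" using q_pos[of n] by simp
    qed
  qed simp
  also have "\<dots> \<le> orbit_sum \<alpha> k y"
    unfolding orbit_sum_def using k0 q_pos[of n] by (intro sum_mono2) auto
  finally have 1: "real k * (ln (real h + 2) - ln 2) \<le> orbit_sum \<alpha> k y" .
  have 2: "real k / 2 * (ln (real (q n)) - ln 2) \<le> orbit_sum \<alpha> k y"
    by (rule orbit_sum_ge[OF av k(1)])
  \<comment> \<open>The two lower bounds are averaged; \<open>ln (h + 2)\<close> is at least the gap
    \<open>ln k - ln (q n)\<close>.\<close>
  have "real k * (ln (real h + 2) - ln 2) \<ge> real k / 2 * (ln (real h + 2) - ln 2)"
    by (intro mult_right_mono) auto
  moreover have "real k / 2 * (ln (real k) - ln (real (q n))) \<le> real k / 2 * ln (real h + 2)"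
    using h by (intro mult_left_mono) auto
  ultimately show ?thesis using 1 2 by (simp add: algebra_simps)
qed

end

section \<open>Close returns\<close>

definition spike_free :: "real \<Rightarrow> real \<Rightarrow> bool" where
  "spike_free \<alpha> y \<longleftrightarrow> avoids_zero \<alpha> y \<and>
    (\<forall>\<epsilon>>0. \<exists>n0. \<forall>n\<ge>n0. \<forall>k<n. 1 / orbit_dist \<alpha> y k \<le> \<epsilon> * orbit_sum \<alpha> n y)"

lemma filterlim_at_top_bracket:
  fixes f :: "nat \<Rightarrow> nat"
  assumes "f m \<le> k" and lim: "filterlim f at_top at_top"
  obtains n where "m \<le> n" "f n \<le> k" "k < f (Suc n)"
proof (rule ccontr)
  assume "\<not> thesis"
  with that have step: "f (Suc n) \<le> k" if "m \<le> n" "f n \<le> k" for n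
    using that by (meson not_le)
  have "f n \<le> k" if "m \<le> n" for n
    using that by (induction n rule: dec_induct) (use assms step in auto)
  moreover have "\<forall>\<^sub>F n in sequentially. Suc k \<le> f n"
    using lim unfolding filterlim_at_top by blast
  then obtain n where "m \<le> n" "Suc k \<le> f n"
    unfolding eventually_sequentially by (meson le_cases)
  ultimately show False by fastforce
qed

lemma filterlim_at_top_of_div:
  fixes f :: "nat \<Rightarrow> real"
  assumes "filterlim (\<lambda>n. f n / real n) at_top at_top"
  shows "filterlim f at_top at_top"
proof (rule filterlim_at_top_mono)
  show "filterlim (\<lambda>n. real n * (f n / real n)) at_top at_top"
    by (intro filterlim_at_top_mult_at_top filterlim_real_sequentially assms)
  show "\<forall>\<^sub>F n in sequentially. real n * (f n / real n) \<le> f n"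
    using eventually_gt_at_top[of 0] by eventually_elim simp
qed

context convergents
begin

lemmas orbit_sum_at_top = filterlim_at_top_of_div[OF orbit_sum_div_at_top]

text \<open>It suffices to compare each late term with the sum before it: the sum grows with its
  length, and it diverges, which takes care of the finitely many early terms.\<close>

lemma spike_freeI:
  assumes av: "avoids_zero \<alpha> y"
    and *: "\<And>\<epsilon>. 0 < \<epsilon> \<Longrightarrow> \<forall>\<^sub>F k in sequentially. 1 / orbit_dist \<alpha> y k \<le> \<epsilon> * orbit_sum \<alpha> k y"
  shows "spike_free \<alpha> y"
  unfolding spike_free_def
proof (intro conjI av allI impI)
  fix \<epsilon> :: real assume e: "0 < \<epsilon>"
  obtain k0 where k0: "\<And>k. k0 \<le> k \<Longrightarrow> 1 / orbit_dist \<alpha> y k \<le> \<epsilon> * orbit_sum \<alpha> k y"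
    using *[OF e] unfolding eventually_sequentially by blast
  define M where "M = (\<Sum>k<k0. 1 / orbit_dist \<alpha> y k)"
  obtain n0 where n0: "\<And>n. n0 \<le> n \<Longrightarrow> M / \<epsilon> \<le> orbit_sum \<alpha> n y"
    using orbit_sum_at_top[OF av] unfolding filterlim_at_top eventually_sequentially by blast
  show "\<exists>n0. \<forall>n\<ge>n0. \<forall>k<n. 1 / orbit_dist \<alpha> y k \<le> \<epsilon> * orbit_sum \<alpha> n y"
  proof (intro exI allI impI)
    fix n k assume n: "n0 \<le> n" "k < n"
    show "1 / orbit_dist \<alpha> y k \<le> \<epsilon> * orbit_sum \<alpha> n y"
    proof (cases "k < k0")
      case True
      then have "1 / orbit_dist \<alpha> y k \<le> M"
        unfolding M_def by (intro member_le_sum) auto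
      also have "\<dots> \<le> \<epsilon> * orbit_sum \<alpha> n y" using n0[OF n(1)] e by (simp add: field_simps)
      finally show ?thesis .
    next
      case False
      then have "1 / orbit_dist \<alpha> y k \<le> \<epsilon> * orbit_sum \<alpha> k y" using k0 by simp
      also have "\<dots> \<le> \<epsilon> * orbit_sum \<alpha> n y" using n e by (intro mult_left_mono orbit_sum_mono) auto
      finally show ?thesis .
    qed
  qed
qed

text \<open>A term below \<open>k\<close> is negligible because the sum outgrows \<open>k\<close>. A
  larger term means a close return, where the sum is at least \<open>k * ln k / 8\<close>; hence the
  rate is applied with \<open>\<epsilon> / 8\<close>.\<close>

lemma spike_free_of_approach_rate:
  assumes av: "avoids_zero \<alpha> y"
    and *: "\<And>\<epsilon>. 0 < \<epsilon> \<Longrightarrow>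
      \<forall>\<^sub>F k in sequentially. 1 / (\<epsilon> * real k * ln (real k)) \<le> orbit_dist \<alpha> y k"
  shows "spike_free \<alpha> y"
proof (rule spike_freeI[OF av])
  fix \<epsilon> :: real assume e: "0 < \<epsilon>"
  have "\<forall>\<^sub>F k in sequentially. 1 / \<epsilon> \<le> orbit_sum \<alpha> k y / real k"
    using orbit_sum_div_at_top[OF av] unfolding filterlim_at_top by blast
  moreover have "\<forall>\<^sub>F k in sequentially. 1 / ((\<epsilon> / 8) * real k * ln (real k)) \<le> orbit_dist \<alpha> y k"
    using e by (intro *) auto
  \<comment> \<open>From \<open>k \<ge> 2^4\<close> on, \<open>ln k - 2 * ln 2\<close> is at least
    half of \<open>ln k\<close>; \<open>k \<ge> q 0\<close> places \<open>k\<close> between two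
    consecutive denominators.\<close>
  moreover have "\<forall>\<^sub>F k in sequentially. 16 + q 0 \<le> k" by (rule eventually_ge_at_top)
  ultimately show "\<forall>\<^sub>F k in sequentially. 1 / orbit_dist \<alpha> y k \<le> \<epsilon> * orbit_sum \<alpha> k y"
  proof eventually_elim
    case (elim k)
    then have k: "16 \<le> k" "q 0 \<le> k" by auto
    have pos: "0 < orbit_dist \<alpha> y k" by (rule avoids_zero_pos[OF av])
    show ?case
    proof (cases "orbit_dist \<alpha> y k \<le> 1 / real k")
      case False
      then have "1 / orbit_dist \<alpha> y k \<le> real k" using pos k by (simp add: field_simps)
      also have "\<dots> \<le> \<epsilon> * orbit_sum \<alpha> k y" using elim(1) e k by (simp add: field_simps)
      finally show ?thesis .
    next
      case True
      obtain n where n: "q n \<le> k" "k < q (Suc n)"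
        using filterlim_at_top_bracket[of q 0 k] k(2) filterlim_q by blast
      have "ln 16 \<le> ln (real k)" using k by (subst ln_le_cancel_iff) auto
      moreover have "ln (16::real) = 4 * ln 2"
        using ln_realpow[of 2 4] by simp
      ultimately have "real k / 8 * ln (real k) \<le> real k / 8 * (2 * (ln (real k) - 2 * ln 2))"
        by (intro mult_left_mono) auto
      also have "\<dots> = real k / 4 * (ln (real k) - 2 * ln 2)" by simp
      also have "\<dots> \<le> orbit_sum \<alpha> k y"
        by (rule orbit_sum_ge_at_return[OF av n True])
      finally have "\<epsilon> * (real k / 8 * ln (real k)) \<le> \<epsilon> * orbit_sum \<alpha> k y"
        using e by (intro mult_left_mono) auto
      moreover have "0 < (\<epsilon> / 8) * real k * ln (real k)" using e k by (intro mult_pos_pos) auto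
      then have "1 / orbit_dist \<alpha> y k \<le> (\<epsilon> / 8) * real k * ln (real k)"
        using elim(2) pos by (simp add: field_simps)
      ultimately show ?thesis by simp
    qed
  qed
qed

end

text \<open>On a window of length 1 the integer nearest to \<open>y + c\<close> takes at most three
  values, each contributing an interval of length \<open>2 * d\<close>.\<close>

lemma measure_nint_dist_less:
  fixes c d b :: real
  assumes d: "0 \<le> d"
  shows "{y \<in> {b..b+1}. nint_dist (y + c) < d} \<in> sets lborel"
    "measure lborel {y \<in> {b..b+1}. nint_dist (y + c) < d} \<le> 6 * d"
proof -
  let ?A = "{y \<in> {b..b+1}. nint_dist (y + c) < d}"
  have [measurable]: "nint_dist \<in> borel_measurable borel"
    by (intro borel_measurable_continuous_onI continuous_on_nint_dist)
  show meas: "?A \<in> sets lborel" by measurable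
  define f where "f = \<lfloor>b + c\<rfloor>"
  have sub: "?A \<subseteq> (\<Union>m\<in>{f, f+1, f+2}. {of_int m - c - d .. of_int m - c + d})"
  proof
    fix y assume y: "y \<in> ?A"
    define m where "m = round (y + c)"
    have "f \<le> m" "m \<le> f + 2"
    proof -
      have "f = round (of_int f :: real)" by simp
      also have "\<dots> \<le> round (y + c)" using y unfolding f_def by (intro round_mono) (auto, linarith)
      finally show "f \<le> m" by (simp add: m_def)
      have "round (y + c) \<le> round (of_int (f + 2) :: real)"
        using y unfolding f_def by (intro round_mono) (auto, linarith)
      then show "m \<le> f + 2" by (simp add: m_def del: of_int_add)
    qed
    then have "m \<in> {f, f+1, f+2}" by auto
    moreover have "\<bar>y + c - of_int m\<bar> < d" using y by (simp add: nint_dist_def m_def)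
    ultimately show "y \<in> (\<Union>m\<in>{f, f+1, f+2}. {of_int m - c - d .. of_int m - c + d})"
      by (intro UN_I[of m]) auto
  qed
  have "measure lborel ?A \<le> measure lborel (\<Union>m\<in>{f, f+1, f+2}. {of_int m - c - d .. of_int m - c + d})"
    by (intro measure_mono_fmeasurable sub meas fmeasurable.finite_UN)
      (auto simp: fmeasurable_def emeasure_lborel_Icc_eq)
  also have "\<dots> \<le> (\<Sum>m\<in>{f, f+1, f+2}. measure lborel {of_int m - c - d .. of_int m - c + d})"
    by (intro measure_UNION_le) auto
  also have "\<dots> = 6 * d" using d by simp
  finally show "measure lborel ?A \<le> 6 * d" .
qed

lemma sum_inverse_le:
  fixes a b :: nat
  assumes "1 \<le> a" "a \<le> b"
  shows "(\<Sum>k=a..<b. 1 / real k) \<le> 1 / real a + ln (real b / real a)"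
proof (cases "a = b")
  case False
  have "(\<Sum>k=a..<Suc n. 1 / real k) \<le> 1 / real a + ln (real n / real a)" if "a \<le> n" for n
    using that
  proof (induction n rule: dec_induct)
    case (step n)
    have "ln (real n / real (Suc n)) \<le> real n / real (Suc n) - 1"
      using assms step by (intro ln_le_minus_one) auto
    also have "\<dots> = - (1 / real (Suc n))" by (simp add: field_simps)
    finally have "ln (real n) + 1 / real (Suc n) \<le> ln (real (Suc n))"
      using assms step by (simp add: ln_div)
    then show ?case using assms step by (simp add: ln_div)
  qed (use assms in simp)
  from this[of "b - 1"] have "(\<Sum>k=a..<b. 1 / real k) \<le> 1 / real a + ln (real (b - 1) / real a)"
    using assms False by simp
  also have "ln (real (b - 1) / real a) \<le> ln (real b / real a)"
    using assms False by (subst ln_le_cancel_iff) (auto simp: divide_right_mono)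
  finally show ?thesis by simp
qed (use assms in simp)

lemma summable_ln_over_square: "summable (\<lambda>m. (1 + 2 * ln (real (Suc m))) / real (Suc m) ^ 2)"
proof (rule summable_comparison_test')
  have "summable (\<lambda>m. real m powr (-3/2))" by (subst summable_real_powr_iff) auto
  then have "summable (\<lambda>m. real (Suc m) powr (-3/2))" by (subst summable_Suc_iff)
  then show "summable (\<lambda>m. 5 * real (Suc m) powr (-3/2))" by (rule summable_mult)
  fix m :: nat
  let ?x = "real (Suc m)"
  have "2 * ln ?x = 4 * ln (sqrt ?x)" by (simp add: ln_sqrt)
  also have "\<dots> \<le> 4 * (sqrt ?x - 1)" by (intro mult_left_mono ln_le_minus_one) auto
  finally have "1 + 2 * ln ?x \<le> 5 * sqrt ?x" by (smt (verit) of_nat_Suc of_nat_0_le_iff real_sqrt_ge_one)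
  then have "(1 + 2 * ln ?x) / ?x ^ 2 \<le> 5 * (sqrt ?x / ?x ^ 2)"
    by (simp add: divide_right_mono)
  also have "sqrt ?x / ?x ^ 2 = ?x powr (1/2) / ?x powr 2" by (simp add: powr_half_sqrt)
  also have "\<dots> = ?x powr (1/2 - 2)" by (rule powr_diff[symmetric])
  also have "\<dots> = ?x powr (-3/2)" by simp
  finally show "norm ((1 + 2 * ln ?x) / ?x ^ 2) \<le> 5 * ?x powr (-3/2)"
    by simp
qed

locale fast_convergents = convergents +
  fixes c :: real
  assumes c_pos: "0 < c"
    and growth: "\<forall>\<^sub>F n in sequentially. c * real n ^ 2 \<le> ln (real (q n))"
begin

text \<open>Put \<open>T = q\<^sub>m\<^sub>+\<^sub>1 / (m + 1)\<^sup>2\<close>. For \<open>k < T\<close> the point \<open>k \<alpha>\<close> lies within \<open>T / (q\<^sub>m q\<^sub>m\<^sub>+\<^sub>1)\<close>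
  of \<open>(k mod q\<^sub>m) \<alpha>\<close>, so only \<open>q\<^sub>m\<close> slightly enlarged intervals matter; for \<open>k \<ge> T\<close> the
  measures are simply added up.\<close>

lemma measure_close_returns_le:
  assumes e: "0 < \<epsilon>" and m: "1 \<le> m" "4 / c \<le> real m" "c * real m ^ 2 \<le> ln (real (q m))"
    "c * real (Suc m) ^ 2 \<le> ln (real (q (Suc m)))"
  shows "measure lborel (\<Union>k\<in>{q m..<q (Suc m)}. {y\<in>{b..b+1}. orbit_dist \<alpha> y k < 1 / (\<epsilon> * real k * ln (real k))})
    \<le> 6 / (\<epsilon> * c * real m ^ 2) + 6 / real (Suc m) ^ 2
      + 12 / (\<epsilon> * c) * ((1 + 2 * ln (real (Suc m))) / real (Suc m) ^ 2)"
proof -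
  let ?S = "\<lambda>x d. {y\<in>{b..b+1}. nint_dist (y + x) < d}"
  define A where "A k = ?S (real k * \<alpha>) (1 / (\<epsilon> * real k * ln (real k)))" for k :: nat
  have fm: "?S x d \<in> fmeasurable lborel" if "0 \<le> d" for x d
  proof (rule fmeasurableI2)
    show "{b..b+1} \<in> fmeasurable lborel" by (auto simp: fmeasurable_def emeasure_lborel_Icc_eq)
  qed (use measure_nint_dist_less(1)[OF that] in auto)
  define M where "M = real (Suc m)"
  define T where "T = real (q (Suc m)) / M ^ 2"
  define a where "a = nat \<lceil>T\<rceil>"
  \<comment> \<open>The first summand is the largest radius in the group, attained at
    \<open>k = q m\<close>. The second is the drift: at most \<open>T / q m\<close> returns, each
    moving the point by at most \<open>1 / q (Suc m)\<close>.\<close>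
  define d where "d = 1 / (\<epsilon> * real (q m) * ln (real (q m))) + 1 / (real (q m) * M ^ 2)"
  have M: "1 \<le> M" "0 < M" by (auto simp: M_def)
  have T0: "0 < T" using q_pos[of "Suc m"] M by (simp add: T_def)
  have a: "T \<le> real a" "1 \<le> a" using T0 unfolding a_def by linarith+
  have "T \<le> real (q (Suc m))"
    using M mult_left_mono[of 1 "M\<^sup>2" "real (q (Suc m))"] by (simp add: T_def divide_le_eq one_le_power)
  then have a': "a \<le> q (Suc m)" unfolding a_def by linarith
  have lnq: "0 < ln (real (q m))"
    using m c_pos by (intro less_le_trans[OF _ m(3)]) auto
  have q1: "1 < q m" using lnq q_pos[of m] by (cases "q m = 1") auto
  have d0: "0 \<le> d" using e lnq M by (simp add: d_def)
  have A_fm: "A k \<in> fmeasurable lborel" for k unfolding A_def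
    by (rule fm) (use e in \<open>cases k, auto\<close>)
  have A_le: "measure lborel (A k) \<le> 6 * (1 / (\<epsilon> * real k * ln (real k)))" for k
    unfolding A_def by (rule measure_nint_dist_less(2)) (use e in \<open>cases k, auto\<close>)
  have sub: "(\<Union>k\<in>{q m..<q (Suc m)}. A k) \<subseteq> (\<Union>s<q m. ?S (real s * \<alpha>) d) \<union> (\<Union>k\<in>{a..<q (Suc m)}. A k)"
  proof
    fix y assume "y \<in> (\<Union>k\<in>{q m..<q (Suc m)}. A k)"
    then obtain k where k: "q m \<le> k" "k < q (Suc m)" "y \<in> A k" by auto
    show "y \<in> (\<Union>s<q m. ?S (real s * \<alpha>) d) \<union> (\<Union>k\<in>{a..<q (Suc m)}. A k)"
    proof (cases "a \<le> k")
      case True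
      then show ?thesis using k by auto
    next
      case False
      then have kT: "real k \<le> T" unfolding a_def by linarith
      define i s where "i = k div q m" and "s = k mod q m"
      define \<rho> where "\<rho> = real (q m) * \<alpha> - of_int (p m)"
      have s: "s < q m" using q_pos[of m] by (simp add: s_def)
      have keq: "k = i * q m + s" by (simp add: i_def s_def)
      have "y + real s * \<alpha> = (y + real k * \<alpha>) + (- real i * \<rho>) + of_int (- int i * p m)"
        unfolding \<rho>_def by (simp add: keq algebra_simps)
      then have "orbit_dist \<alpha> y s = nint_dist ((y + real k * \<alpha>) + (- real i * \<rho>))"
        by (simp only: nint_dist_add_int)
      also have "\<dots> \<le> orbit_dist \<alpha> y k + real i * \<bar>\<rho>\<bar>"
        using nint_dist_add_le[of "y + real k * \<alpha>" "- real i * \<rho>"] by (simp add: abs_mult)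
      also have "real i * \<bar>\<rho>\<bar> \<le> (T / real (q m)) * (1 / real (q (Suc m)))"
      proof (rule mult_mono)
        have "real i * real (q m) \<le> real k" by (simp add: keq)
        then show "real i \<le> T / real (q m)" using kT q_pos[of m] by (simp add: field_simps)
        show "\<bar>\<rho>\<bar> \<le> 1 / real (q (Suc m))" using abs_rho_le[of m] by (simp add: \<rho>_def)
      qed (use T0 in auto)
      also have "\<dots> = 1 / (real (q m) * M ^ 2)"
        using q_pos[of "Suc m"] by (simp add: T_def)
      also have "orbit_dist \<alpha> y k < 1 / (\<epsilon> * real k * ln (real k))"
        using k(3) by (simp add: A_def)
      also have "\<dots> \<le> 1 / (\<epsilon> * real (q m) * ln (real (q m)))"
        using e k(1) q1 lnq by (intro divide_left_mono mult_mono mult_pos_pos) auto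
      finally have "orbit_dist \<alpha> y s < d" by (simp add: d_def)
      then show ?thesis using s k(3) by (auto simp: A_def)
    qed
  qed
  have 1: "measure lborel (\<Union>s<q m. ?S (real s * \<alpha>) d) \<le> 6 / (\<epsilon> * c * real m ^ 2) + 6 / M ^ 2"
  proof -
    have "measure lborel (\<Union>s<q m. ?S (real s * \<alpha>) d) \<le> (\<Sum>s<q m. measure lborel (?S (real s * \<alpha>) d))"
      by (intro measure_UNION_le measure_nint_dist_less d0) auto
    also have "\<dots> \<le> (\<Sum>s<q m. 6 * d)" by (intro sum_mono measure_nint_dist_less d0)
    also have "\<dots> = 6 / (\<epsilon> * ln (real (q m))) + 6 / M ^ 2"
      using q_pos[of m] by (simp add: d_def field_simps)
    also have "6 / (\<epsilon> * ln (real (q m))) \<le> 6 / (\<epsilon> * c * real m ^ 2)"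
      using e m c_pos lnq mult_left_mono[OF m(3), of \<epsilon>]
      by (intro divide_left_mono) (auto simp: mult.assoc)
    finally show ?thesis by simp
  qed
  \<comment> \<open>Here \<open>ln T = ln (q (Suc m)) - 2 * ln M \<ge> c * M^2 - 2 * M\<close>, and
    \<open>4 \<le> c * M\<close> lets half of the main term absorb \<open>2 * M\<close>.\<close>
  have lnT: "c / 2 * M ^ 2 \<le> ln (real k)" if "a \<le> k" for k
  proof -
    have "T \<le> real k" using a that by linarith
    then have "ln T \<le> ln (real k)" using T0 by (subst ln_le_cancel_iff) auto
    moreover have "ln T = ln (real (q (Suc m))) - 2 * ln M"
      using M q_pos[of "Suc m"] by (simp add: T_def ln_div ln_realpow)
    moreover have "ln M \<le> M" using M ln_le_minus_one[of M] by simp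
    moreover have "4 \<le> c * M" using m(2) c_pos by (simp add: M_def field_simps)
    then have "4 * M \<le> c * M * M" using M by (intro mult_right_mono) auto
    moreover have "c * M ^ 2 \<le> ln (real (q (Suc m)))" using m(4) by (simp only: M_def)
    ultimately show ?thesis by (simp add: power2_eq_square)
  qed
  have A_sets: "A k \<in> sets lborel" for k using A_fm by (rule fmeasurableD)
  \<comment> \<open>Beyond \<open>T\<close> the factor \<open>1 / ln k\<close> is of order
    \<open>1 / M^2\<close>, and the reciprocals \<open>1 / k\<close> from \<open>T\<close> to
    \<open>q (Suc m) = M^2 * T\<close> add up to at most \<open>1 + 2 * ln M\<close>.\<close>
  have 2: "measure lborel (\<Union>k\<in>{a..<q (Suc m)}. A k) \<le> 12 / (\<epsilon> * c) * ((1 + 2 * ln M) / M ^ 2)"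
  proof -
    have "measure lborel (\<Union>k\<in>{a..<q (Suc m)}. A k) \<le> (\<Sum>k=a..<q (Suc m). measure lborel (A k))"
      using A_sets by (intro measure_UNION_le) auto
    also have "\<dots> \<le> (\<Sum>k=a..<q (Suc m). 12 / (\<epsilon> * c * M ^ 2) * (1 / real k))"
    proof (rule sum_mono)
      fix k assume k: "k \<in> {a..<q (Suc m)}"
      then have k0: "0 < real k" "c / 2 * M ^ 2 \<le> ln (real k)" using a lnT[of k] by auto
      have pos: "0 < c / 2 * M ^ 2" using c_pos M by simp
      have "6 * (1 / (\<epsilon> * real k * ln (real k))) \<le> 6 * (1 / (\<epsilon> * real k * (c / 2 * M ^ 2)))"
        using e c_pos M k0 pos less_le_trans[OF pos k0(2)]
        by (intro mult_left_mono divide_left_mono mult_pos_pos) auto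
      then show "measure lborel (A k) \<le> 12 / (\<epsilon> * c * M ^ 2) * (1 / real k)"
        using A_le[of k] by (simp add: mult_ac)
    qed
    also have "\<dots> = 12 / (\<epsilon> * c * M ^ 2) * (\<Sum>k=a..<q (Suc m). 1 / real k)"
      by (simp add: sum_distrib_left)
    also have "\<dots> \<le> 12 / (\<epsilon> * c * M ^ 2) * (1 + 2 * ln M)"
    proof (rule mult_left_mono)
      have "(\<Sum>k=a..<q (Suc m). 1 / real k) \<le> 1 / real a + ln (real (q (Suc m)) / real a)"
        by (rule sum_inverse_le[OF a(2) a'])
      also have "\<dots> \<le> 1 + ln (real (q (Suc m)) / T)"
        using a T0 q_pos[of "Suc m"] by (intro add_mono) (auto simp: divide_left_mono)
      also have "real (q (Suc m)) / T = M ^ 2" using q_pos[of "Suc m"] M by (simp add: T_def)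
      also have "ln (M ^ 2) = 2 * ln M" using M by (simp add: ln_realpow)
      finally show "(\<Sum>k=a..<q (Suc m). 1 / real k) \<le> 1 + 2 * ln M" .
    qed (use e c_pos in auto)
    finally show ?thesis by (simp add: mult_ac)
  qed
  have "measure lborel (\<Union>k\<in>{q m..<q (Suc m)}. A k) \<le>
      measure lborel ((\<Union>s<q m. ?S (real s * \<alpha>) d) \<union> (\<Union>k\<in>{a..<q (Suc m)}. A k))"
    using A_fm A_sets fm[OF d0] by (intro measure_mono_fmeasurable sub fmeasurable.Un fmeasurable.finite_UN sets.finite_UN) auto
  also have "\<dots> \<le> measure lborel (\<Union>s<q m. ?S (real s * \<alpha>) d) + measure lborel (\<Union>k\<in>{a..<q (Suc m)}. A k)"
    using A_sets fmeasurableD[OF fm[OF d0]] by (intro measure_Un_le sets.finite_UN) auto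
  finally show ?thesis using 1 2 unfolding A_def M_def by linarith
qed

text \<open>Borel--Cantelli for the groups \<open>E m\<close> of close returns; the window of length
  1 keeps all measures finite.\<close>

lemma AE_approach_rate_unit:
  assumes e: "0 < \<epsilon>"
  shows "AE y in lborel. y \<in> {b..b+1} \<longrightarrow>
    (\<forall>\<^sub>F k in sequentially. 1 / (\<epsilon> * real k * ln (real k)) \<le> orbit_dist \<alpha> y k)"
proof -
  define A where "A k = {y\<in>{b..b+1}. orbit_dist \<alpha> y k < 1 / (\<epsilon> * real k * ln (real k))}" for k :: nat
  define E where "E m = (\<Union>k\<in>{q m..<q (Suc m)}. A k)" for m
  have A: "A k \<in> sets lborel" for k
    unfolding A_def by (rule measure_nint_dist_less(1)) (use e in \<open>cases k, auto\<close>)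
  have E: "E m \<in> sets lborel" for m unfolding E_def using A by (intro sets.finite_UN) auto
  have "emeasure lborel (E m) \<le> emeasure lborel {b..b+1}" for m
    unfolding E_def A_def by (intro emeasure_mono) auto
  then have fin: "emeasure lborel (E m) < \<infinity>" for m
    by (rule le_less_trans) (simp add: emeasure_lborel_Icc_eq)
  have "\<forall>\<^sub>F m in sequentially. c * real (Suc m) ^ 2 \<le> ln (real (q (Suc m)))"
    using growth by (rule eventually_sequentially_Suc[THEN iffD2])
  moreover have "\<forall>\<^sub>F m in sequentially. 4 / c \<le> real m"
    using filterlim_real_sequentially unfolding filterlim_at_top by blast
  ultimately have "\<forall>\<^sub>F m in sequentially. norm (measure lborel (E m)) \<le> 6 / (\<epsilon> * c * real m ^ 2) + 6 / real (Suc m) ^ 2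
      + 12 / (\<epsilon> * c) * ((1 + 2 * ln (real (Suc m))) / real (Suc m) ^ 2)"
    using growth eventually_ge_at_top[of 1]
    by eventually_elim (use measure_close_returns_le[OF e] in \<open>simp add: E_def A_def\<close>)
  moreover have "summable (\<lambda>m. 6 / (\<epsilon> * c * real m ^ 2) + 6 / real (Suc m) ^ 2
      + 12 / (\<epsilon> * c) * ((1 + 2 * ln (real (Suc m))) / real (Suc m) ^ 2))"
  proof (intro summable_add summable_mult summable_ln_over_square)
    have s: "summable (\<lambda>m. 1 / real m ^ 2)"
      using inverse_power_summable[of 2, where ?'a = real] by (simp add: divide_inverse)
    then show "summable (\<lambda>m. 6 / (\<epsilon> * c * real m ^ 2))"
      using summable_mult[of "\<lambda>m. 1 / real m ^ 2" "6 / (\<epsilon> * c)"] by simp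
    have "summable (\<lambda>m. 1 / real (Suc m) ^ 2)" by (subst summable_Suc_iff[of "\<lambda>m. 1 / real m ^ 2"]) (rule s)
    then show "summable (\<lambda>m. 6 / real (Suc m) ^ 2)"
      using summable_mult[of "\<lambda>m. 1 / real (Suc m) ^ 2" 6] by simp
  qed
  ultimately have "summable (\<lambda>m. measure lborel (E m))"
    by (rule summable_comparison_test_ev)
  then have "AE y in lborel. \<forall>\<^sub>F m in sequentially. y \<in> space lborel - E m"
    by (intro borel_cantelli_AE1 E fin)
  then show ?thesis
  proof (rule AE_mp, intro AE_I2 impI)
    fix y assume ev: "\<forall>\<^sub>F m in sequentially. y \<in> space lborel - E m" and y: "y \<in> {b..b+1}"
    obtain m0 where m0: "\<And>m. m0 \<le> m \<Longrightarrow> y \<notin> E m"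
      using ev unfolding eventually_sequentially by auto
    show "\<forall>\<^sub>F k in sequentially. 1 / (\<epsilon> * real k * ln (real k)) \<le> orbit_dist \<alpha> y k"
    proof (rule eventually_sequentiallyI[of "q m0"])
      fix k assume "q m0 \<le> k"
      then obtain m where m: "m0 \<le> m" "q m \<le> k" "k < q (Suc m)"
        using filterlim_at_top_bracket[of q m0 k] filterlim_q by blast
      then have "y \<notin> A k" using m0[OF m(1)] by (auto simp: E_def)
      then show "1 / (\<epsilon> * real k * ln (real k)) \<le> orbit_dist \<alpha> y k"
        using y by (auto simp: A_def)
    qed
  qed
qed

text \<open>Countably many exceptional sets suffice: windows with integer end points and
  \<open>\<epsilon> = 1 / (i + 1)\<close>, since for \<open>k \<ge> 2\<close> the claim gets weaker
  as \<open>\<epsilon>\<close> grows.\<close>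

lemma AE_approach_rate:
  "AE y in lborel. \<forall>\<epsilon>>0. \<forall>\<^sub>F k in sequentially. 1 / (\<epsilon> * real k * ln (real k)) \<le> orbit_dist \<alpha> y k"
proof -
  have "AE y in lborel. \<forall>i::nat. \<forall>b::int. y \<in> {of_int b..of_int b+1} \<longrightarrow>
    (\<forall>\<^sub>F k in sequentially. 1 / (1 / real (Suc i) * real k * ln (real k)) \<le> orbit_dist \<alpha> y k)"
    unfolding AE_all_countable by (intro allI AE_approach_rate_unit) simp
  then show ?thesis
  proof (rule AE_mp, intro AE_I2 impI allI)
    fix y \<epsilon> :: real
    assume *: "\<forall>i::nat. \<forall>b::int. y \<in> {of_int b..of_int b+1} \<longrightarrow>
    (\<forall>\<^sub>F k in sequentially. 1 / (1 / real (Suc i) * real k * ln (real k)) \<le> orbit_dist \<alpha> y k)"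
      and e: "0 < \<epsilon>"
    obtain i where i: "1 / real (Suc i) < \<epsilon>" using nat_approx_posE[OF e] by blast
    have "y \<in> {of_int \<lfloor>y\<rfloor>..of_int \<lfloor>y\<rfloor>+1}" by auto
    with * have "\<forall>\<^sub>F k in sequentially. 1 / (1 / real (Suc i) * real k * ln (real k)) \<le> orbit_dist \<alpha> y k"
      by blast
    with eventually_ge_at_top[of 2]
    show "\<forall>\<^sub>F k in sequentially. 1 / (\<epsilon> * real k * ln (real k)) \<le> orbit_dist \<alpha> y k"
    proof eventually_elim
      case (elim k)
      have "1 / (\<epsilon> * (real k * ln (real k))) \<le> 1 / (1 / real (Suc i) * (real k * ln (real k)))"
        using i e elim(1) by (intro divide_left_mono mult_right_mono mult_pos_pos) auto
      then show ?case using elim(2) by (simp only: mult.assoc)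
    qed
  qed
qed

lemma AE_spike_free: "AE y in lborel. spike_free \<alpha> y"
proof -
  let ?Z = "range (\<lambda>(n::int, k::nat). of_int n - real k * \<alpha>)"
  have "countable ?Z" by (intro countable_image) simp
  then have "?Z \<in> null_sets lborel" by (rule countable_imp_null_set_lborel)
  then have "AE y in lborel. y \<notin> ?Z" by (rule AE_not_in)
  then have "AE y in lborel. avoids_zero \<alpha> y"
  proof (rule AE_mp, intro AE_I2 impI)
    fix y assume y: "y \<notin> ?Z"
    show "avoids_zero \<alpha> y"
      unfolding avoids_zero_def
    proof (intro allI notI)
      fix k :: nat assume "y + real k * \<alpha> \<in> \<int>"
      then obtain n where "y + real k * \<alpha> = of_int n" by (auto elim: Ints_cases)
      then have "y = (\<lambda>(n::int, k::nat). of_int n - real k * \<alpha>) (n, k)" by simp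
      then show False using y by blast
    qed
  qed
  then show ?thesis using AE_approach_rate
    by eventually_elim (intro spike_free_of_approach_rate, auto)
qed

end

section \<open>Orbit sums at two base points\<close>

context convergents
begin

lemma q_double: "2 * q n \<le> q (Suc (Suc n))"
  using q_add_le[of n] q_mono_Suc[of n] by linarith

text \<open>The denominators double in two steps, so the induction advances by two; the constant
  solves \<open>1 + 1 + 4 / 2 = 4\<close>.\<close>

lemma sum_inverse_q_le: "(\<Sum>i<N. 1 / real (q (i + n))) \<le> 4 / real (q n)"
proof (induction N arbitrary: n rule: less_induct)
  case (less N)
  have q1: "1 / real (q (Suc n)) \<le> 1 / real (q n)"
    using q_mono_Suc[of n] q_pos by (intro divide_left_mono) auto
  have q2: "4 / real (q (Suc (Suc n))) \<le> 2 / real (q n)"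
    using q_double[of n] q_pos[of n] q_pos[of "Suc (Suc n)"] by (simp add: field_simps)
  consider "N = 0" | "N = 1" | M where "N = Suc (Suc M)"
    by (metis One_nat_def not0_implies_Suc)
  then show ?case
  proof cases
    case 3
    have "(\<Sum>i<N. 1 / real (q (i + n))) =
        1 / real (q n) + 1 / real (q (Suc n)) + (\<Sum>i<M. 1 / real (q (i + Suc (Suc n))))"
      unfolding 3 by (simp add: sum.lessThan_Suc_shift del: sum.lessThan_Suc)
    also have "\<dots> \<le> 1 / real (q n) + 1 / real (q n) + 2 / real (q n)"
      using q1 q2 less.IH[of M "Suc (Suc n)"] 3 by (intro add_mono) auto
    finally show ?thesis by simp
  qed (use q_pos[of n] in \<open>auto simp: field_simps\<close>)
qed

lemma summable_abs_rho: "summable (\<lambda>n. \<bar>real (q n) * \<alpha> - of_int (p n)\<bar>)"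
proof (rule summable_comparison_test')
  show "summable (\<lambda>n. 1 / real (q (n + 1)))"
  proof (rule bounded_imp_summable)
    fix n show "(\<Sum>k\<le>n. 1 / real (q (k + 1))) \<le> 4 / real (q 1)"
      using sum_inverse_q_le[of 1 "Suc n"] by (simp only: lessThan_Suc_atMost)
  qed simp
qed (use abs_rho_le in auto)

lemma abs_rho_tail_le:
  "\<bar>\<Sum>i. real (q (i + Suc j)) * \<alpha> - of_int (p (i + Suc j))\<bar> \<le> 4 / real (q (Suc j))"
proof -
  let ?\<rho> = "\<lambda>i. real (q (i + Suc j)) * \<alpha> - of_int (p (i + Suc j))"
  have s: "summable (\<lambda>i. \<bar>?\<rho> i\<bar>)"
    using summable_abs_rho by (subst summable_iff_shift[of "\<lambda>n. \<bar>real (q n) * \<alpha> - of_int (p n)\<bar>"])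
  have "\<bar>suminf ?\<rho>\<bar> \<le> (\<Sum>i. \<bar>?\<rho> i\<bar>)" by (rule summable_rabs[OF s])
  also have "\<dots> \<le> 4 / real (q (Suc j))"
  proof (rule suminf_le_const[OF s])
    fix N
    have "(\<Sum>i<N. \<bar>?\<rho> i\<bar>) \<le> (\<Sum>i<N. 1 / real (q (i + Suc j)))"
    proof (rule sum_mono)
      fix i
      show "\<bar>?\<rho> i\<bar> \<le> 1 / real (q (i + Suc j))"
        by (rule abs_rho_le')
    qed
    also note sum_inverse_q_le
    finally show "(\<Sum>i<N. \<bar>?\<rho> i\<bar>) \<le> 4 / real (q (Suc j))" .
  qed
  finally show ?thesis .
qed

text \<open>Again an induction by two steps; the constant 3 reproduces itself because \<open>3 * q i
  + q (i+1) \<le> 2 * (q i + q (i+1)) \<le> 2 * q (i+2)\<close>.\<close>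

lemma sum_q_le: "(\<Sum>i\<le>j. q i) \<le> 3 * q j"
proof (induction j rule: less_induct)
  case (less j)
  consider "j = 0" | "j = 1" | i where "j = Suc (Suc i)"
    by (metis One_nat_def not0_implies_Suc)
  then show ?case
  proof cases
    case 2
    then show ?thesis using q_mono_Suc[of 0] by simp
  next
    case 3
    then show ?thesis using less[of i] q_add_le[of i] q_mono_Suc[of i] by simp
  qed simp
qed

lemma shift_decomposition:
  fixes \<beta> j
  assumes \<beta>: "\<beta> = (\<Sum>n. real (q n) * \<alpha> - of_int (p n))"
  obtains s :: nat and n :: int and r :: real
  where "s \<le> 3 * q j" "\<bar>r\<bar> \<le> 4 / real (q (Suc j))" "\<beta> = real s * \<alpha> + r + of_int n"
proof
  let ?\<rho> = "\<lambda>n. real (q n) * \<alpha> - of_int (p n)"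
  show "(\<Sum>i\<le>j. q i) \<le> 3 * q j" by (rule sum_q_le)
  show "\<bar>\<Sum>i. ?\<rho> (i + Suc j)\<bar> \<le> 4 / real (q (Suc j))" by (rule abs_rho_tail_le)
  have "summable ?\<rho>" using summable_abs_rho by (rule summable_rabs_cancel)
  from suminf_split_initial_segment[OF this, of "Suc j"]
  show "\<beta> = real (\<Sum>i\<le>j. q i) * \<alpha> + (\<Sum>i. ?\<rho> (i + Suc j)) + of_int (- (\<Sum>i\<le>j. p i))"
    by (simp add: \<beta> sum_subtractf lessThan_Suc_atMost sum_distrib_right)
qed

text \<open>Controls the terms that enter or leave the window when the base point moves by
  \<open>s * \<alpha>\<close> with \<open>s \<le> 3 * q j\<close>.\<close>

lemma three_blocks_le:
  assumes "\<And>k. k < 3 * q j \<Longrightarrow> 1 / orbit_dist \<alpha> z k \<le> M"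
  shows "orbit_sum \<alpha> (3 * q j) z \<le> 6 * (real (q j) * (1 + ln (real (q j)))) + 15 * M"
proof -
  have "orbit_sum \<alpha> (q j) (z + real m * \<alpha>) \<le> 2 * real (q j) * (1 + ln (real (q j))) + 5 * M"
    if "m \<le> 2 * q j" for m
  proof (rule block_sum_le_q)
    fix k assume "k < q j"
    then show "1 / nint_dist (z + real m * \<alpha> + real k * \<alpha>) \<le> M"
      using assms[of "m + k"] that by (simp add: algebra_simps)
  qed
  from this[of 0] this[of "q j"] this[of "2 * q j"]
  have "orbit_sum \<alpha> (q j) z + orbit_sum \<alpha> (q j) (z + real (q j) * \<alpha>) + orbit_sum \<alpha> (q j) (z + real (2 * q j) * \<alpha>)
    \<le> 6 * (real (q j) * (1 + ln (real (q j)))) + 15 * M"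
    by simp
  moreover have "orbit_sum \<alpha> (3 * q j) z =
      orbit_sum \<alpha> (q j) z + orbit_sum \<alpha> (q j) (z + real (q j) * \<alpha>) + orbit_sum \<alpha> (q j) (z + real (2 * q j) * \<alpha>)"
    using orbit_sum_add[of \<alpha> "2 * q j" "q j" z] orbit_sum_add[of \<alpha> "q j" "q j" z]
    by (simp add: mult_2[symmetric])
  ultimately show ?thesis by simp
qed

lemma count_blocks_le:
  "card {k. k < i * q j \<and> orbit_dist \<alpha> z k \<le> real D / real (q j)} \<le> i * (2 * D + 5)"
proof (induction i)
  case (Suc i)
  let ?B = "{k. k < q j \<and> nint_dist (z + real (i * q j) * \<alpha> + real k * \<alpha>) \<le> real D / real (q j)}"
  have "{k. k < Suc i * q j \<and> orbit_dist \<alpha> z k \<le> real D / real (q j)} \<subseteq>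
      {k. k < i * q j \<and> orbit_dist \<alpha> z k \<le> real D / real (q j)} \<union> (\<lambda>k. i * q j + k) ` ?B"
  proof (intro subsetI)
    fix k assume k: "k \<in> {k. k < Suc i * q j \<and> orbit_dist \<alpha> z k \<le> real D / real (q j)}"
    show "k \<in> {k. k < i * q j \<and> orbit_dist \<alpha> z k \<le> real D / real (q j)} \<union> (\<lambda>k. i * q j + k) ` ?B"
    proof (cases "k < i * q j")
      case False
      then obtain l where l: "k = i * q j + l" using le_Suc_ex not_less by blast
      then have "l \<in> ?B" using k by (simp add: algebra_simps)
      then show ?thesis using l by blast
    qed (use k in simp)
  qed
  then have "card {k. k < Suc i * q j \<and> orbit_dist \<alpha> z k \<le> real D / real (q j)} \<le>
      card ({k. k < i * q j \<and> orbit_dist \<alpha> z k \<le> real D / real (q j)} \<union> (\<lambda>k. i * q j + k) ` ?B)"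
    by (intro card_mono) auto
  also have "\<dots> \<le> card {k. k < i * q j \<and> orbit_dist \<alpha> z k \<le> real D / real (q j)} + card ((\<lambda>k. i * q j + k) ` ?B)"
    by (rule card_Un_le)
  also have "card ((\<lambda>k. i * q j + k) ` ?B) \<le> card ?B" by (intro card_image_le) auto
  also have "card ?B \<le> 2 * D + 5" by (rule block_count_le_q)
  finally show ?case using Suc by simp
qed simp

text \<open>Where the distance \<open>b\<close> of the moved point is at least
  \<open>K * \<bar>r\<bar>\<close>, the identity \<open>1/a - 1/b = (b - a) / (a * b)\<close> gives
  a change of at most \<open>1/K\<close> relative to \<open>1/a\<close>. The remaining points are
  only counted, each at the price \<open>M + M'\<close>.\<close>

lemma orbit_sum_perturbation_le:
  fixes r :: real and K :: nat
  assumes z: "avoids_zero \<alpha> z" and w: "avoids_zero \<alpha> w" and wz: "w = z + r + of_int n" and K: "0 < K"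
    and M: "\<And>k. k < N \<Longrightarrow> 1 / orbit_dist \<alpha> z k \<le> M" "\<And>k. k < N \<Longrightarrow> 1 / orbit_dist \<alpha> w k \<le> M'"
  shows "\<bar>orbit_sum \<alpha> N z - orbit_sum \<alpha> N w\<bar> \<le>
    orbit_sum \<alpha> N z / real K + real (card {k. k < N \<and> orbit_dist \<alpha> w k < real K * \<bar>r\<bar>}) * (M + M')"
proof -
  let ?B = "{k. k < N \<and> orbit_dist \<alpha> w k < real K * \<bar>r\<bar>}"
  let ?a = "\<lambda>k. orbit_dist \<alpha> z k" and ?b = "\<lambda>k. orbit_dist \<alpha> w k"
  have "\<bar>1 / ?a k - 1 / ?b k\<bar> \<le> (1 / ?a k) / real K + (if k \<in> ?B then M + M' else 0)" if k: "k < N" for k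
  proof -
    have ab: "0 < ?a k" "0 < ?b k" using avoids_zero_pos z w by blast+
    show ?thesis
    proof (cases "k \<in> ?B")
      case True
      have "\<bar>1 / ?a k - 1 / ?b k\<bar> \<le> 1 / ?a k + 1 / ?b k" using ab by (simp add: abs_le_iff)
      also have "\<dots> \<le> M + M'" using M k by (intro add_mono) auto
      also have "\<dots> \<le> (1 / ?a k) / real K + (M + M')" using ab by simp
      finally show ?thesis using True by simp
    next
      case False
      then have b: "real K * \<bar>r\<bar> \<le> ?b k" using k by simp
      have eq: "w + real k * \<alpha> = (z + real k * \<alpha> + r) + of_int n" by (simp add: wz)
      have "\<bar>?a k - ?b k\<bar> \<le> \<bar>r\<bar>"
        using nint_dist_add_le[of "z + real k * \<alpha>" r] nint_dist_add_le[of "z + real k * \<alpha> + r" "-r"]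
        unfolding eq nint_dist_add_int by simp
      then have "real K * \<bar>?a k - ?b k\<bar> \<le> real K * \<bar>r\<bar>" by (intro mult_left_mono) auto
      with b have "real K * \<bar>?a k - ?b k\<bar> \<le> ?b k" by linarith
      then have "\<bar>?a k - ?b k\<bar> \<le> ?b k / real K" using K by (simp add: pos_le_divide_eq mult.commute)
      then have "\<bar>?a k - ?b k\<bar> / (?a k * ?b k) \<le> (?b k / real K) / (?a k * ?b k)"
        using ab by (intro divide_right_mono) auto
      moreover have "\<bar>1 / ?a k - 1 / ?b k\<bar> = \<bar>?a k - ?b k\<bar> / (?a k * ?b k)"
      proof -
        have "1 / ?a k - 1 / ?b k = (?b k - ?a k) / (?a k * ?b k)" using ab by (simp add: field_simps)
        then show ?thesis using ab by (simp add: abs_mult abs_minus_commute)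
      qed
      moreover have "(?b k / real K) / (?a k * ?b k) = (1 / ?a k) / real K"
        using ab by (simp add: field_simps)
      ultimately show ?thesis using False by (simp only: if_False)
    qed
  qed
  then have "(\<Sum>k<N. \<bar>1 / ?a k - 1 / ?b k\<bar>) \<le> (\<Sum>k<N. (1 / ?a k) / real K + (if k \<in> ?B then M + M' else 0))"
    by (intro sum_mono) auto
  also have "\<dots> = orbit_sum \<alpha> N z / real K + (\<Sum>k<N. if k \<in> ?B then M + M' else 0)"
    by (simp add: sum.distrib orbit_sum_def sum_divide_distrib del: mem_Collect_eq)
  also have "(\<Sum>k<N. if k \<in> ?B then M + M' else 0) = (\<Sum>k\<in>{..<N} \<inter> ?B. M + M')"
    by (subst sum.inter_restrict) auto
  also have "{..<N} \<inter> ?B = ?B" by auto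
  also have "(\<Sum>k\<in>?B. M + M') = real (card ?B) * (M + M')" by simp
  finally have "(\<Sum>k<N. \<bar>1 / ?a k - 1 / ?b k\<bar>) \<le> orbit_sum \<alpha> N z / real K + real (card ?B) * (M + M')" .
  moreover have "\<bar>orbit_sum \<alpha> N z - orbit_sum \<alpha> N w\<bar> \<le> (\<Sum>k<N. \<bar>1 / ?a k - 1 / ?b k\<bar>)"
    unfolding orbit_sum_def sum_subtractf[symmetric] by (rule sum_abs)
  ultimately show ?thesis by linarith
qed

text \<open>Translation by \<open>\<beta>\<close> is translation by \<open>(q\<^sub>0 + \<dots> + q\<^sub>j) \<alpha>\<close>, which changes an orbit sum by two
  boundary blocks, followed by a move of size at most \<open>4 / q\<^sub>j\<^sub>+\<^sub>1\<close>, which only affects the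
  \<open>O(K\<^sup>2)\<close> points closest to the singularity.\<close>

lemma orbit_sum_shift_le:
  fixes K :: nat
  assumes \<beta>: "\<beta> = (\<Sum>n. real (q n) * \<alpha> - of_int (p n))"
    and y: "avoids_zero \<alpha> y" and y': "avoids_zero \<alpha> (y + \<beta>)"
    and K: "4 \<le> K" and N: "K * q j \<le> N" "N < K * q (Suc j)" and large: "1 + 2 * ln 2 \<le> ln (real (q j))"
    and spike: "\<And>n k. N \<le> n \<Longrightarrow> k < n \<Longrightarrow> 1 / orbit_dist \<alpha> y k \<le> 1 / real K ^ 3 * orbit_sum \<alpha> n y"
    and spike': "\<And>k. k < N \<Longrightarrow> 1 / orbit_dist \<alpha> (y + \<beta>) k \<le> 1 / real K ^ 3 * orbit_sum \<alpha> N (y + \<beta>)"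
  shows "\<bar>orbit_sum \<alpha> N y - orbit_sum \<alpha> N (y + \<beta>)\<bar> \<le> 1200 / real K * (orbit_sum \<alpha> N y + orbit_sum \<alpha> N (y + \<beta>))"
proof -
  define U U' where "U = orbit_sum \<alpha> N y" and "U' = orbit_sum \<alpha> N (y + \<beta>)"
  \<comment> \<open>At most \<open>13 * K^2\<close> points are exceptional; if a single term takes
    at most the fraction \<open>1 / K^3\<close> of the sum, they still cost only
    \<open>O(1 / K)\<close>.\<close>
  define e where "e = 1 / real K ^ 3"
  define L where "L = real (q j) * (1 + ln (real (q j)))"
  have U0: "0 \<le> U" "0 \<le> U'" by (auto simp: U_def U'_def)
  have "4 ^ 3 \<le> real K ^ 3" using K by (intro power_mono) auto
  then have e: "0 < e" "30 * e \<le> 1" using K by (auto simp: e_def field_simps)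
  have eK: "e \<le> 1 / real K"
    using K self_le_power[of "real K" 3] by (simp add: e_def frac_le)
  obtain s n r where s: "s \<le> 3 * q j" and r: "\<bar>r\<bar> \<le> 4 / real (q (Suc j))"
    and dec: "\<beta> = real s * \<alpha> + r + of_int n"
    using shift_decomposition[OF \<beta>] by blast
  have qN: "3 * q j \<le> N" using K mult_right_mono[of 3 K "q j"] N by linarith
  have L: "L \<le> 4 / real K * U"
  \<comment> \<open>The hypothesis \<open>large\<close> says
    \<open>1 + ln (q j) \<le> 2 * (ln (q j) - ln 2)\<close>, and \<open>K * q j \<le> N\<close>
    supplies the factor \<open>1 / K\<close>.\<close>
  proof -
    have ln2: "ln 2 \<le> ln (real (q j))" using large ln_gt_zero[of "2::real"] by linarith
    have "real K * L \<le> 4 * (real (K * q j) / 2 * (ln (real (q j)) - ln 2))"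
      using mult_left_mono[OF large, of "real K * real (q j)"] by (simp add: L_def algebra_simps)
    also have "\<dots> \<le> 4 * (real N / 2 * (ln (real (q j)) - ln 2))"
      using N(1) ln2 by (intro mult_left_mono mult_right_mono divide_right_mono) (auto simp flip: of_nat_mult)
    also have "\<dots> \<le> 4 * U"
      using orbit_sum_ge[OF y, of j N] qN q_pos[of j] by (simp add: U_def)
    finally show ?thesis using K by (simp add: field_simps)
  qed
  define S1 S2 where "S1 = orbit_sum \<alpha> (3 * q j) y" and "S2 = orbit_sum \<alpha> (3 * q j) (y + real N * \<alpha>)"
  have S1: "S1 \<le> 6 * L + 15 * (e * U)"
    unfolding S1_def L_def e_def U_def using qN by (intro three_blocks_le spike) auto
  have US2: "orbit_sum \<alpha> (N + 3 * q j) y = U + S2"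
    by (simp add: orbit_sum_add U_def S2_def)
  \<comment> \<open>The block behind the window is not part of \<open>U\<close>, so its largest term
    is measured against \<open>U + S2\<close>; \<open>30 * e \<le> 1\<close> then absorbs
    \<open>S2\<close> on the left.\<close>
  have "S2 \<le> 6 * L + 15 * (e * (U + S2))"
    unfolding S2_def L_def
  proof (rule three_blocks_le)
    fix k assume "k < 3 * q j"
    then show "1 / nint_dist (y + real N * \<alpha> + real k * \<alpha>) \<le> e * (U + orbit_sum \<alpha> (3 * q j) (y + real N * \<alpha>))"
      using spike[of "N + 3 * q j" "N + k"] US2 S2_def by (simp add: e_def distrib_right add.assoc)
  qed
  moreover have "30 * e * S2 \<le> S2" using mult_right_mono[OF e(2), of S2] by (simp add: S2_def)
  ultimately have S2: "S2 \<le> 12 * L + 30 * (e * U)" by (simp add: algebra_simps)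
  have eU: "e * U \<le> U / real K" using mult_right_mono[OF eK U0(1)] by simp
  define z where "z = y + real s * \<alpha>"
  have Uz: "orbit_sum \<alpha> (s + N) y = orbit_sum \<alpha> s y + orbit_sum \<alpha> N z"
    by (simp add: orbit_sum_add z_def)
  have 1: "orbit_sum \<alpha> (s + N) y \<le> U + S2"
    unfolding US2[symmetric] using s by (intro orbit_sum_mono) auto
  have 2: "orbit_sum \<alpha> s y \<le> S1" unfolding S1_def using s by (rule orbit_sum_mono)
  have 3: "U \<le> orbit_sum \<alpha> (s + N) y" unfolding U_def by (intro orbit_sum_mono) auto
  \<comment> \<open>With \<open>L \<le> 4 * U / K\<close> and \<open>e * U \<le> U / K\<close> the
    constants are \<open>6 * 4 + 15 = 39\<close> and \<open>12 * 4 + 30 = 78\<close>.\<close>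
  have S: "S1 \<le> 78 / real K * U" "S2 \<le> 78 / real K * U"
  proof -
    have "78 / real K * U = 78 * (U / real K)" "4 / real K * U = 4 * (U / real K)" by simp_all
    moreover have "0 \<le> U / real K" using U0 by simp
    ultimately show "S1 \<le> 78 / real K * U" "S2 \<le> 78 / real K * U"
      using S1 S2 L eU by linarith+
  qed
  have diff: "\<bar>U - orbit_sum \<alpha> N z\<bar> \<le> 78 / real K * U"
    using Uz 1 2 3 S orbit_sum_nonneg[of \<alpha> s y] unfolding abs_le_iff by linarith
  have "78 / real K * U \<le> 78 * U" using K U0 by (intro mult_right_mono) (auto simp: divide_le_eq)
  then have V: "orbit_sum \<alpha> (s + N) y \<le> 79 * U" "orbit_sum \<alpha> N z \<le> 79 * U"
    using 1 S(2) Uz orbit_sum_nonneg[of \<alpha> s y] by linarith+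
  let ?B = "{k. k < N \<and> orbit_dist \<alpha> (y + \<beta>) k < real K * \<bar>r\<bar>}"
  have "\<bar>orbit_sum \<alpha> N z - orbit_sum \<alpha> N (y + \<beta>)\<bar> \<le>
      orbit_sum \<alpha> N z / real K + real (card ?B) * (e * (79 * U) + e * U')"
  proof (rule orbit_sum_perturbation_le)
    show "avoids_zero \<alpha> z" unfolding z_def by (rule avoids_zero_shift[OF y])
    show "y + \<beta> = z + r + of_int n" by (simp add: z_def dec)
    fix k assume k: "k < N"
    have "1 / orbit_dist \<alpha> z k \<le> e * orbit_sum \<alpha> (s + N) y"
      using spike[of "s + N" "s + k"] k by (simp add: z_def e_def algebra_simps)
    also have "\<dots> \<le> e * (79 * U)" using V e by (intro mult_left_mono) auto
    finally show "1 / orbit_dist \<alpha> z k \<le> e * (79 * U)" .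
    show "1 / orbit_dist \<alpha> (y + \<beta>) k \<le> e * U'"
      using spike'[OF k] by (simp add: e_def U'_def)
  qed (use y' K in auto)
  \<comment> \<open>Exceptional points lie within \<open>4 * K / q (Suc j)\<close> of an integer,
    and \<open>N < K * q (Suc j)\<close> is covered by \<open>K\<close> blocks with at most
    \<open>8 * K + 5 \<le> 13 * K\<close> such points each.\<close>
  also have "real (card ?B) * (e * (79 * U) + e * U') \<le> 13 / real K * (79 * U + U')"
  proof -
    have "real K * \<bar>r\<bar> \<le> real (4 * K) / real (q (Suc j))"
      using mult_left_mono[OF r, of "real K"] by (simp add: mult.commute)
    then have "?B \<subseteq> {k. k < K * q (Suc j) \<and> orbit_dist \<alpha> (y + \<beta>) k \<le> real (4 * K) / real (q (Suc j))}"
      using N(2) by auto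
    then have "card ?B \<le> card {k. k < K * q (Suc j) \<and> orbit_dist \<alpha> (y + \<beta>) k \<le> real (4 * K) / real (q (Suc j))}"
      by (intro card_mono) auto
    also have "\<dots> \<le> K * (2 * (4 * K) + 5)" by (rule count_blocks_le)
    also have "\<dots> \<le> K * (13 * K)" using K by (intro mult_left_mono) auto
    finally have "real (card ?B) \<le> real (K * (13 * K))" by (simp only: of_nat_le_iff)
    then have "real (card ?B) * e \<le> (13 * real K ^ 2) * e"
      using e by (intro mult_right_mono) (auto simp: power2_eq_square)
    also have "\<dots> = 13 / real K" using K by (simp add: e_def power2_eq_square power3_eq_cube)
    finally have "real (card ?B) * e * (79 * U + U') \<le> 13 / real K * (79 * U + U')"
      using U0 by (intro mult_right_mono) auto
    then show ?thesis by (simp add: algebra_simps)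
  qed
  also have "orbit_sum \<alpha> N z / real K \<le> 1 / real K * (79 * U)"
    using V(2) K by (simp add: divide_right_mono)
  finally have "\<bar>U - U'\<bar> \<le> 78 / real K * U + 1 / real K * (79 * U) + 13 / real K * (79 * U + U')"
    using diff unfolding U'_def by linarith
  also have "\<dots> = (1184 * U + 13 * U') / real K" by (simp add: add_divide_distrib distrib_left)
  also have "\<dots> \<le> 1200 * (U + U') / real K" using U0 by (intro divide_right_mono) auto
  finally show ?thesis by (simp add: U_def U'_def)
qed

lemma orbit_sum_ratio_tendsto_1:
  assumes \<beta>: "\<beta> = (\<Sum>n. real (q n) * \<alpha> - of_int (p n))"
    and y: "spike_free \<alpha> y" and y': "spike_free \<alpha> (y + \<beta>)"
  shows "(\<lambda>N. orbit_sum \<alpha> N (y + \<beta>) / orbit_sum \<alpha> N y) \<longlonglongrightarrow> 1"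
proof (rule LIMSEQ_I)
  fix \<eta> :: real assume \<eta>: "0 < \<eta>"
  have av: "avoids_zero \<alpha> y" "avoids_zero \<alpha> (y + \<beta>)" using y y' by (auto simp: spike_free_def)
  \<comment> \<open>A relative error \<open>\<delta> \<le> 1/2\<close> with respect to
    \<open>U + U'\<close> forces \<open>U' \<le> 3 * U\<close>, so the error relative to
    \<open>U\<close> alone is at most \<open>4 * \<delta> < \<eta>\<close>.\<close>
  define \<delta> where "\<delta> = min (1/2) (\<eta> / 5)"
  have \<delta>: "0 < \<delta>" "\<delta> \<le> 1/2" "4 * \<delta> < \<eta>" using \<eta> by (auto simp: \<delta>_def min_def)
  obtain K0 :: nat where K0: "1200 / \<delta> < real K0" using reals_Archimedean2 by blast
  define K where "K = max 4 K0"
  have K: "4 \<le> K" "1200 / \<delta> \<le> real K" using K0 by (auto simp: K_def)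
  then have K': "1200 / real K \<le> \<delta>" using \<delta> by (simp add: field_simps)
  have e: "0 < 1 / real K ^ 3" using K by simp
  obtain n1 where n1: "\<And>n k. n1 \<le> n \<Longrightarrow> k < n \<Longrightarrow> 1 / orbit_dist \<alpha> y k \<le> 1 / real K ^ 3 * orbit_sum \<alpha> n y"
    using y e unfolding spike_free_def by meson
  obtain n2 where n2: "\<And>n k. n2 \<le> n \<Longrightarrow> k < n \<Longrightarrow> 1 / orbit_dist \<alpha> (y + \<beta>) k \<le> 1 / real K ^ 3 * orbit_sum \<alpha> n (y + \<beta>)"
    using y' e unfolding spike_free_def by meson
  have "filterlim (\<lambda>n. ln (real (q n))) at_top at_top"
    by (intro filterlim_compose[OF ln_at_top] filterlim_compose[OF filterlim_real_sequentially] filterlim_q)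
  then obtain J where J: "\<And>j. J \<le> j \<Longrightarrow> 1 + 2 * ln 2 \<le> ln (real (q j))"
    unfolding filterlim_at_top eventually_sequentially by meson
  have limKq: "filterlim (\<lambda>j. K * q j) at_top at_top"
  proof (rule filterlim_at_top_mono[OF filterlim_q], intro always_eventually allI)
    fix j show "q j \<le> K * q j" using K mult_right_mono[of 1 K "q j"] by simp
  qed
  show "\<exists>no. \<forall>N\<ge>no. norm (orbit_sum \<alpha> N (y + \<beta>) / orbit_sum \<alpha> N y - 1) < \<eta>"
  proof (intro exI allI impI)
    fix N assume N: "Max {1, n1, n2, K * q J} \<le> N"
    then have "K * q J \<le> N" by simp
    then obtain j where j: "J \<le> j" "K * q j \<le> N" "N < K * q (Suc j)"
      using filterlim_at_top_bracket[OF _ limKq] by blast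
    let ?U = "orbit_sum \<alpha> N y" and ?U' = "orbit_sum \<alpha> N (y + \<beta>)"
    have "\<bar>?U - ?U'\<bar> \<le> 1200 / real K * (?U + ?U')"
      using N by (intro orbit_sum_shift_le[OF \<beta> av K(1) j(2,3) J[OF j(1)]] n1 n2) auto
    also have "\<dots> \<le> \<delta> * (?U + ?U')" using K' by (intro mult_right_mono) auto
    finally have le: "\<bar>?U - ?U'\<bar> \<le> \<delta> * (?U + ?U')" .
    have "0 < 1 / nint_dist (y + real 0 * \<alpha>)" using avoids_zero_pos[OF av(1), of 0] by simp
    also have "\<dots> \<le> ?U" unfolding orbit_sum_def using N by (intro member_le_sum) auto
    finally have U: "0 < ?U" .
    have "\<delta> * (?U + ?U') \<le> 1/2 * (?U + ?U')" using \<delta> U by (intro mult_right_mono) auto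
    with le have "\<bar>?U - ?U'\<bar> \<le> 1/2 * (?U + ?U')" by (rule order_trans)
    then have "?U' \<le> 3 * ?U" using abs_ge_minus_self[of "?U - ?U'"] by (simp add: distrib_left)
    then have "\<delta> * (?U + ?U') \<le> \<delta> * (4 * ?U)" using \<delta> by (intro mult_left_mono) auto
    then have "\<bar>?U' - ?U\<bar> \<le> 4 * \<delta> * ?U" using le by linarith
    moreover have "?U' / ?U - 1 = (?U' - ?U) / ?U" using U by (simp add: field_simps)
    ultimately have "\<bar>?U' / ?U - 1\<bar> \<le> 4 * \<delta>" using U by (simp add: abs_divide divide_le_eq)
    then show "norm (?U' / ?U - 1) < \<eta>" using \<delta> by simp
  qed
qed

end

section \<open>Growth of the denominators\<close>

lemma convergents_cf:
  assumes "\<alpha> \<notin> \<rat>"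
  shows "convergents \<alpha> (cf_num \<alpha>) (\<lambda>n. nat (cf_den \<alpha> n))"
proof
  fix n
  note pos = cf_den_pos[OF assms]
  show "0 < nat (cf_den \<alpha> n)" using pos by simp
  show "nat (cf_den \<alpha> n) \<le> nat (cf_den \<alpha> (Suc n))" using cf_den_mono[OF assms] by (rule nat_mono)
  show "nat (cf_den \<alpha> n) + nat (cf_den \<alpha> (Suc n)) \<le> nat (cf_den \<alpha> (Suc (Suc n)))"
    using cf_den_add_le[OF assms, of n] pos[of n] pos[of "Suc n"] by linarith
  show "coprime (cf_num \<alpha> n) (int (nat (cf_den \<alpha> n)))"
    using coprime_cf_num_den[OF assms, of n] pos[of n] by simp
  show "\<bar>real (nat (cf_den \<alpha> n)) * \<alpha> - of_int (cf_num \<alpha> n)\<bar> \<le> 1 / real (nat (cf_den \<alpha> (Suc n)))"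
    using abs_cf_rho_le[OF assms, of n] pos[of n] pos[of "Suc n"] by (simp add: cf_rho_def)
qed

text \<open>From \<open>q (n+1) \<ge> a (n+1) * q n\<close> the logarithm of the denominator
  dominates the sum of the \<open>ln a\<close>. Cauchy--Schwarz bounds \<open>m^2\<close> by that
  sum times the sum of the \<open>1 / ln a\<close>, which stays below \<open>S\<close>.\<close>

lemma ln_cf_den_ge_of_digits:
  assumes irr: "\<alpha> \<notin> \<rat>" and ge2: "\<And>n. N \<le> n \<Longrightarrow> 2 \<le> cf_digit \<alpha> n"
    and sm: "summable (\<lambda>n. 1 / ln (real_of_int (cf_digit \<alpha> (n + N))))"
  shows "\<exists>c>0. \<forall>\<^sub>F n in sequentially. c * real n ^ 2 \<le> ln (real (nat (cf_den \<alpha> n)))"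
proof -
  define x where "x i = ln (real_of_int (cf_digit \<alpha> (i + N)))" for i
  have x: "0 < x i" for i using ge2[of "i + N"] by (simp add: x_def)
  define S where "S = (\<Sum>i. 1 / x i) + 1"
  have sm': "summable (\<lambda>i. 1 / x i)" using sm by (simp add: x_def)
  have S: "(\<Sum>i<m. 1 / x (Suc i)) \<le> S" for m
  proof -
    have "(\<Sum>i<m. 1 / x (Suc i)) \<le> (\<Sum>i<Suc m. 1 / x i)"
      using x[of 0] by (simp add: sum.lessThan_Suc_shift del: sum.lessThan_Suc)
    also have "\<dots> \<le> (\<Sum>i. 1 / x i)" using x by (intro sum_le_suminf[OF sm']) (auto simp: less_imp_le)
    finally show ?thesis by (simp add: S_def)
  qed
  have S0: "0 < S" using suminf_nonneg[OF sm'] x by (simp add: S_def less_imp_le add_nonneg_pos)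
  have prod: "(\<Sum>i<m. x (Suc i)) \<le> ln (real_of_int (cf_den \<alpha> (N + m)))" for m
  proof (induction m)
    case 0
    then show ?case using cf_den_pos[OF irr, of N] by simp
  next
    case (Suc m)
    have d: "2 \<le> cf_digit \<alpha> (Suc (N + m))" by (rule ge2) simp
    have "ln (real_of_int (cf_digit \<alpha> (Suc (N + m)) * cf_den \<alpha> (N + m))) \<le> ln (real_of_int (cf_den \<alpha> (Suc (N + m))))"
      using cf_den_Suc_ge[OF irr, of "N + m"] cf_den_pos[OF irr] d
      by (subst ln_le_cancel_iff) (simp_all del: of_int_mult)
    also have "ln (real_of_int (cf_digit \<alpha> (Suc (N + m)) * cf_den \<alpha> (N + m))) = x (Suc m) + ln (real_of_int (cf_den \<alpha> (N + m)))"
      using cf_den_pos[OF irr, of "N + m"] d by (simp add: ln_mult x_def add.commute)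
    finally show ?case using Suc by simp
  qed
  have sq: "real m ^ 2 \<le> S * ln (real_of_int (cf_den \<alpha> (N + m)))" for m
  proof -
    have "real m ^ 2 = (\<Sum>i<m. sqrt (1 / x (Suc i)) * sqrt (x (Suc i))) ^ 2"
      using x by (simp flip: real_sqrt_mult) (simp add: less_imp_neq[symmetric])
    also have "\<dots> \<le> (\<Sum>i<m. (sqrt (1 / x (Suc i))) ^ 2) * (\<Sum>i<m. (sqrt (x (Suc i))) ^ 2)"
      by (rule Cauchy_Schwarz_ineq_sum)
    also have "\<dots> = (\<Sum>i<m. 1 / x (Suc i)) * (\<Sum>i<m. x (Suc i))"
      using x by (simp add: less_imp_le)
    also have "\<dots> \<le> S * ln (real_of_int (cf_den \<alpha> (N + m)))"
      using S prod S0 x by (intro mult_mono) (auto simp: less_imp_le sum_nonneg)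
    finally show ?thesis .
  qed
  show ?thesis
  \<comment> \<open>For \<open>n \<ge> 2 * N\<close> at least \<open>n / 2\<close> of the digits are
    controlled; squaring gives the factor 4.\<close>
  proof (intro exI[of _ "1 / (4 * S)"] conjI eventually_sequentiallyI[of "2 * N"])
    fix n assume n: "2 * N \<le> n"
    have "(real n / 2) ^ 2 \<le> real (n - N) ^ 2" using n by (intro power_mono) auto
    also have "\<dots> \<le> S * ln (real_of_int (cf_den \<alpha> n))" using sq[of "n - N"] n by simp
    finally have "real n ^ 2 \<le> 4 * S * ln (real_of_int (cf_den \<alpha> n))" by (simp add: power_divide)
    then show "1 / (4 * S) * real n ^ 2 \<le> ln (real (nat (cf_den \<alpha> n)))"
      using S0 cf_den_pos[OF irr, of n] by (simp add: divide_le_eq mult_ac)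
  qed (use S0 in simp)
qed

lemma ln_cf_den_ge_of_exp:
  assumes irr: "\<alpha> \<notin> \<rat>" and C: "0 < C" and \<gamma>: "0 < \<gamma>"
    and ge: "\<And>n. C * exp (real n powr (2 + \<gamma>)) \<le> real_of_int (cf_den \<alpha> n)"
  shows "\<exists>c>0. \<forall>\<^sub>F n in sequentially. c * real n ^ 2 \<le> ln (real (nat (cf_den \<alpha> n)))"
proof (intro exI[of _ "1/2"] conjI)
  have "filterlim (\<lambda>n. (1/2) * real n) at_top at_top"
    by (intro filterlim_tendsto_pos_mult_at_top[OF tendsto_const] filterlim_real_sequentially) simp
  then have "\<forall>\<^sub>F n in sequentially. - ln C \<le> (1/2) * real n" unfolding filterlim_at_top by blast
  with eventually_ge_at_top[of 1]
  show "\<forall>\<^sub>F n in sequentially. 1/2 * real n ^ 2 \<le> ln (real (nat (cf_den \<alpha> n)))"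
  proof eventually_elim
    case (elim n)
    have "real n \<le> real n ^ 2" using elim(1) by (intro self_le_power) auto
    have "real n ^ 2 = real n powr 2" using elim(1) by (simp add: powr_numeral)
    also have "\<dots> \<le> real n powr (2 + \<gamma>)" using elim(1) \<gamma> by (intro powr_mono) auto
    finally have "1/2 * real n ^ 2 \<le> ln C + real n powr (2 + \<gamma>)"
      using elim(2) \<open>real n \<le> real n ^ 2\<close> by linarith
    also have "\<dots> = ln (C * exp (real n powr (2 + \<gamma>)))" using C by (simp add: ln_mult)
    also have "\<dots> \<le> ln (real_of_int (cf_den \<alpha> n))"
      using C ge[of n] cf_den_pos[OF irr, of n] by (subst ln_le_cancel_iff) auto
    finally show ?case using cf_den_pos[OF irr, of n] by simp
  qed
qed simp

section \<open>Nondegenerate minima and passages near them\<close>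

lemma sum_mult_axis: "(\<Sum>l\<in>UNIV. c l * axis j a $ l) = c j * (a::real)"
  by (simp add: axis_def if_distrib cong: if_cong)

lemma has_derivative_partial_deriv:
  fixes f :: "real^'n \<Rightarrow> real"
  assumes "f differentiable (at x)"
  shows "(f has_derivative (\<lambda>h. \<Sum>i\<in>UNIV. partial_deriv i f x * h $ i)) (at x)"
proof -
  let ?D = "frechet_derivative f (at x)"
  have D: "(f has_derivative ?D) (at x)" using assms by (simp add: frechet_derivative_works)
  interpret D: bounded_linear ?D using D by (rule has_derivative_bounded_linear)
  have "?D h = (\<Sum>i\<in>UNIV. partial_deriv i f x * h $ i)" for h
  proof -
    have "?D h = ?D (\<Sum>i\<in>UNIV. h $ i *\<^sub>R axis i 1)"
      by (metis (no_types, lifting) basis_expansion scalar_mult_eq_scaleR sum.cong)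
    also have "\<dots> = (\<Sum>i\<in>UNIV. partial_deriv i f x * h $ i)"
      by (simp add: D.sum D.scaleR partial_deriv_def mult.commute)
    finally show ?thesis .
  qed
  then show ?thesis using D by presburger
qed

lemma partial_deriv_eq_0_at_minimum:
  fixes f :: "real^'n \<Rightarrow> real"
  assumes "f differentiable (at x)" "\<And>y. f x \<le> f y"
  shows "partial_deriv i f x = 0"
proof -
  have "(f has_derivative frechet_derivative f (at x)) (at x)"
    using assms(1) by (simp add: frechet_derivative_works)
  then have "frechet_derivative f (at x) = (\<lambda>h. 0)"
    using assms(2) by (intro differential_zero_maxmin[of x UNIV f]) auto
  then show ?thesis by (simp add: partial_deriv_def)
qed

context
  fixes f :: "real^'n \<Rightarrow> real" and k :: nat
  assumes C2: "class_C (Suc (Suc k)) f"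
begin

lemma differentiable_C2: "f differentiable (at x)" "partial_deriv i f differentiable (at x)"
  using C2 by (auto simp: differentiable_on_def)

lemma has_derivative_C2: "(f has_derivative (\<lambda>h. \<Sum>i\<in>UNIV. partial_deriv i f x * h $ i)) (at x)"
  by (rule has_derivative_partial_deriv[OF differentiable_C2(1)])

lemma has_real_derivative_along_line:
  "((\<lambda>s. f (x + s *\<^sub>R u)) has_real_derivative (\<Sum>i\<in>UNIV. partial_deriv i f (x + s *\<^sub>R u) * u $ i)) (at s)"
proof -
  have "((\<lambda>s. x + s *\<^sub>R u) has_derivative (\<lambda>s. s *\<^sub>R u)) (at s)"
    by (auto intro!: derivative_eq_intros)
  from has_derivative_compose[OF this has_derivative_C2]
  show ?thesis unfolding has_field_derivative_def
    by (rule has_derivative_eq_rhs) (auto simp: sum_distrib_left sum_distrib_right mult_ac)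
qed

abbreviation hessian_col :: "real^'n \<Rightarrow> 'n \<Rightarrow> real^'n \<Rightarrow> real" where
  "hessian_col x i u \<equiv> \<Sum>j\<in>UNIV. hessian f x $ j $ i * u $ j"

lemma partial_deriv_linear_approx:
  assumes "0 < e"
  shows "\<exists>d>0. \<forall>i u. norm u < d \<longrightarrow>
    \<bar>partial_deriv i f (x + u) - partial_deriv i f x - hessian_col x i u\<bar> \<le> e * norm u"
proof -
  have "\<exists>d>0. \<forall>u. norm u < d \<longrightarrow>
    \<bar>partial_deriv i f (x + u) - partial_deriv i f x - hessian_col x i u\<bar> \<le> e * norm u" for i
  proof -
    have "(partial_deriv i f has_derivative (\<lambda>h. \<Sum>j\<in>UNIV. partial_deriv j (partial_deriv i f) x * h $ j)) (at x)"
      by (rule has_derivative_partial_deriv[OF differentiable_C2(2)])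
    then obtain d where "0 < d" and d: "\<And>y. norm (y - x) < d \<Longrightarrow>
        norm (partial_deriv i f y - partial_deriv i f x - (\<Sum>j\<in>UNIV. partial_deriv j (partial_deriv i f) x * (y - x) $ j)) \<le> e * norm (y - x)"
      using assms unfolding has_derivative_at_alt by blast
    show ?thesis
      using \<open>0 < d\<close> d[of "x + _"] by (intro exI[of _ d]) (simp add: hessian_def)
  qed
  then obtain d where d: "\<And>i. 0 < d i" "\<And>i u. norm u < d i \<Longrightarrow>
    \<bar>partial_deriv i f (x + u) - partial_deriv i f x - hessian_col x i u\<bar> \<le> e * norm u"
    by metis
  show ?thesis
  proof (intro exI[of _ "Min (range d)"] conjI allI impI)
    show "0 < Min (range d)" using d(1) by simp
  qed (use d(2) in simp)
qed

text \<open>The second difference \<open>D h i j\<close> is symmetric in \<open>i\<close> and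
  \<open>j\<close>. The mean value theorem in direction \<open>i\<close> and differentiability of
  the \<open>i\<close>-th partial derivative at \<open>x\<close> identify it with \<open>h^2\<close>
  times one mixed derivative, up to \<open>o(h^2)\<close>. Symmetry is needed to match the
  discriminant of the form with \<open>det\<close>.\<close>

lemma hessian_symmetric: "hessian f x $ i $ j = hessian f x $ j $ i"
proof -
  define D where "D h i j = f (x + h *\<^sub>R axis i 1 + h *\<^sub>R axis j 1) - f (x + h *\<^sub>R axis i 1)
    - f (x + h *\<^sub>R axis j 1) + f x" for h i j
  have sym: "D h i j = D h j i" for h i j by (simp add: D_def algebra_simps)
  have *: "\<exists>d>0. \<forall>h. 0 < h \<longrightarrow> h < d \<longrightarrow> \<bar>D h i j - h\<^sup>2 * hessian f x $ j $ i\<bar> \<le> 3 * e * h\<^sup>2" if e: "0 < e" for e i j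
  proof -
    obtain d where d: "0 < d" "\<And>i u. norm u < d \<Longrightarrow>
      \<bar>partial_deriv i f (x + u) - partial_deriv i f x - hessian_col x i u\<bar> \<le> e * norm u"
      using partial_deriv_linear_approx[OF e, of x] by blast
    show ?thesis
    proof (intro exI[of _ "d / 2"] conjI allI impI)
      fix h :: real assume h: "0 < h" "h < d / 2"
      define g where "g = partial_deriv i f"
      define H where "H = hessian f x"
      define \<phi> where "\<phi> s = f ((x + h *\<^sub>R axis j 1) + s *\<^sub>R axis i 1) - f (x + s *\<^sub>R axis i 1)" for s
      have "(\<phi> has_real_derivative g ((x + h *\<^sub>R axis j 1) + s *\<^sub>R axis i 1) - g (x + s *\<^sub>R axis i 1)) (at s)" for s
        unfolding \<phi>_def
        using DERIV_diff[OF has_real_derivative_along_line[of "x + h *\<^sub>R axis j 1" "axis i 1" s]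
          has_real_derivative_along_line[of x "axis i 1" s]]
        unfolding sum_mult_axis g_def by simp
      then obtain s where s: "0 < s" "s < h" and
        eq: "\<phi> h - \<phi> 0 = (h - 0) * (g ((x + h *\<^sub>R axis j 1) + s *\<^sub>R axis i 1) - g (x + s *\<^sub>R axis i 1))"
        using MVT2[OF h(1), of \<phi> "\<lambda>s. g ((x + h *\<^sub>R axis j 1) + s *\<^sub>R axis i 1) - g (x + s *\<^sub>R axis i 1)"]
        by blast
      let ?u = "h *\<^sub>R axis j 1 + s *\<^sub>R axis i 1 :: real^'n" and ?v = "s *\<^sub>R axis i 1 :: real^'n"
      have "norm ?u \<le> norm (h *\<^sub>R axis j (1::real) :: real^'n) + norm ?v" by (rule norm_triangle_ineq)
      then have nu: "norm ?u \<le> 2 * h" and nv: "norm ?v \<le> h" using s by simp_all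
      have u: "\<bar>g (x + ?u) - g x - (\<Sum>l\<in>UNIV. H $ l $ i * ?u $ l)\<bar> \<le> e * norm ?u"
        unfolding g_def H_def using nu h by (intro d(2)) simp
      have v: "\<bar>g (x + ?v) - g x - (\<Sum>l\<in>UNIV. H $ l $ i * ?v $ l)\<bar> \<le> e * norm ?v"
        unfolding g_def H_def using nv h by (intro d(2)) simp
      have diff: "(\<Sum>l\<in>UNIV. H $ l $ i * ?u $ l) - (\<Sum>l\<in>UNIV. H $ l $ i * ?v $ l) = h * H $ j $ i"
        using sum_mult_axis[of "\<lambda>l. H $ l $ i * h" j 1]
        by (simp add: sum.distrib distrib_left mult.assoc)
      have "e * norm ?u \<le> e * (2 * h)" "e * norm ?v \<le> e * h"
        using nu nv e by (auto intro!: mult_left_mono)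
      then have "\<bar>g (x + ?u) - g (x + ?v) - h * H $ j $ i\<bar> \<le> 3 * e * h"
        using u v diff unfolding abs_le_iff by linarith
      then have "h * \<bar>g (x + ?u) - g (x + ?v) - h * H $ j $ i\<bar> \<le> h * (3 * e * h)"
        using h by (intro mult_left_mono) auto
      moreover have "D h i j = h * (g (x + ?u) - g (x + ?v))"
        using eq by (simp add: D_def \<phi>_def algebra_simps)
      then have "D h i j - h\<^sup>2 * H $ j $ i = h * (g (x + ?u) - g (x + ?v) - h * H $ j $ i)"
        by (simp add: power2_eq_square algebra_simps)
      ultimately show "\<bar>D h i j - h\<^sup>2 * hessian f x $ j $ i\<bar> \<le> 3 * e * h\<^sup>2"
        using h by (simp add: abs_mult H_def[symmetric] power2_eq_square mult_ac)
    qed (use d in simp)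
  qed
  have "\<bar>hessian f x $ j $ i - hessian f x $ i $ j\<bar> \<le> e" if "0 < e" for e
  proof -
    have e6: "0 < e / 6" using that by simp
    obtain d1 where d1: "0 < d1" "\<And>h. 0 < h \<Longrightarrow> h < d1 \<Longrightarrow> \<bar>D h i j - h\<^sup>2 * hessian f x $ j $ i\<bar> \<le> 3 * (e / 6) * h\<^sup>2"
      using *[OF e6] by metis
    obtain d2 where d2: "0 < d2" "\<And>h. 0 < h \<Longrightarrow> h < d2 \<Longrightarrow> \<bar>D h j i - h\<^sup>2 * hessian f x $ i $ j\<bar> \<le> 3 * (e / 6) * h\<^sup>2"
      using *[OF e6] by metis
    define h where "h = min d1 d2 / 2"
    have h: "0 < h" "h < d1" "h < d2" using d1(1) d2(1) by (auto simp: h_def min_def)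
    have "\<bar>h\<^sup>2 * hessian f x $ j $ i - h\<^sup>2 * hessian f x $ i $ j\<bar> \<le> e * h\<^sup>2"
      using d1(2)[OF h(1,2)] d2(2)[OF h(1,3)] sym[of h i j] unfolding abs_le_iff by linarith
    then have "h\<^sup>2 * \<bar>hessian f x $ j $ i - hessian f x $ i $ j\<bar> \<le> h\<^sup>2 * e"
      by (simp add: right_diff_distrib[symmetric] abs_mult mult.commute)
    then show ?thesis using h by simp
  qed
  then show ?thesis using field_le_epsilon[of "\<bar>hessian f x $ j $ i - hessian f x $ i $ j\<bar>" 0] by simp
qed

text \<open>The mean value theorem for \<open>f (x + s u) - s^2 / 2 * B\<close> on
  \<open>[0, 1]\<close> reduces the claim to the linear approximation of the gradient, which
  vanishes at \<open>x\<close> because \<open>x\<close> is a minimum.\<close>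

lemma quadratic_approx_at_zero_minimum:
  assumes "f x = 0" "\<And>y. 0 \<le> f y" "0 < e"
  obtains d where "0 < d" "\<And>u. norm u < d \<Longrightarrow> \<bar>f (x + u) - (u \<bullet> (hessian f x *v u)) / 2\<bar> \<le> e * (norm u)\<^sup>2"
proof -
  define e' where "e' = e / real CARD('n)"
  have e': "0 < e'" using assms(3) by (simp add: e'_def)
  obtain d where d: "0 < d" "\<And>i u. norm u < d \<Longrightarrow>
      \<bar>partial_deriv i f (x + u) - partial_deriv i f x - hessian_col x i u\<bar> \<le> e' * norm u"
    using partial_deriv_linear_approx[OF e', of x] by blast
  have g0: "partial_deriv i f x = 0" for i
    using assms(1,2) by (intro partial_deriv_eq_0_at_minimum differentiable_C2) auto
  show thesis
  proof (rule that[OF d(1)])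
    fix u :: "real^'n" assume u: "norm u < d"
    define B where "B = u \<bullet> (hessian f x *v u)"
    have B: "B = (\<Sum>i\<in>UNIV. hessian_col x i u * u $ i)"
    proof -
      have "B = (\<Sum>i\<in>UNIV. \<Sum>j\<in>UNIV. hessian f x $ i $ j * u $ j * u $ i)"
        unfolding B_def inner_vec_def matrix_vector_mult_def
        by (simp add: sum_distrib_left mult_ac)
      also have "\<dots> = (\<Sum>j\<in>UNIV. \<Sum>i\<in>UNIV. hessian f x $ i $ j * u $ j * u $ i)"
        by (rule sum.swap)
      also have "\<dots> = (\<Sum>j\<in>UNIV. (\<Sum>i\<in>UNIV. hessian f x $ i $ j * u $ i) * u $ j)"
        unfolding sum_distrib_right by (intro sum.cong refl) (simp add: mult_ac)
      finally show ?thesis .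
    qed
    define \<phi> where "\<phi> s = f (x + s *\<^sub>R u) - s\<^sup>2 / 2 * B" for s
    have "(\<phi> has_real_derivative ((\<Sum>i\<in>UNIV. partial_deriv i f (x + s *\<^sub>R u) * u $ i) - s * B)) (at s)" for s
    proof -
      have "((\<lambda>s. s\<^sup>2 / 2 * B) has_real_derivative s * B) (at s)"
        by (auto intro!: derivative_eq_intros)
      from DERIV_diff[OF has_real_derivative_along_line[of x u s] this] show ?thesis
        unfolding \<phi>_def .
    qed
    then obtain s where s: "0 < s" "s < 1" and
      eq: "\<phi> 1 - \<phi> 0 = (1 - 0) * ((\<Sum>i\<in>UNIV. partial_deriv i f (x + s *\<^sub>R u) * u $ i) - s * B)"
      using MVT2[of 0 1 \<phi> "\<lambda>s. (\<Sum>i\<in>UNIV. partial_deriv i f (x + s *\<^sub>R u) * u $ i) - s * B"] by auto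
    have lin: "hessian_col x i (s *\<^sub>R u) = s * hessian_col x i u" for i
      unfolding sum_distrib_left by (intro sum.cong refl) simp
    have "\<phi> 1 - \<phi> 0 = (\<Sum>i\<in>UNIV. partial_deriv i f (x + s *\<^sub>R u) * u $ i) -
        (\<Sum>i\<in>UNIV. s * (hessian_col x i u * u $ i))"
      unfolding eq B sum_distrib_left[symmetric] by simp
    also have "\<dots> = (\<Sum>i\<in>UNIV. (partial_deriv i f (x + s *\<^sub>R u) - hessian_col x i (s *\<^sub>R u)) * u $ i)"
      unfolding sum_subtractf[symmetric] lin
      by (intro sum.cong refl) (simp only: left_diff_distrib mult.assoc)
    finally have "\<bar>\<phi> 1 - \<phi> 0\<bar> = \<bar>\<Sum>i\<in>UNIV. (partial_deriv i f (x + s *\<^sub>R u) - hessian_col x i (s *\<^sub>R u)) * u $ i\<bar>"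
      by simp
    also have "\<dots> \<le> (\<Sum>i\<in>UNIV. \<bar>(partial_deriv i f (x + s *\<^sub>R u) - hessian_col x i (s *\<^sub>R u)) * u $ i\<bar>)"
      by (rule sum_abs)
    also have "\<dots> \<le> (\<Sum>i\<in>(UNIV::'n set). e' * norm u * norm u)"
    proof (rule sum_mono)
      fix i
      have nsu: "norm (s *\<^sub>R u) \<le> norm u" using s mult_right_mono[of s 1 "norm u"] by simp
      then have "norm (s *\<^sub>R u) < d" using u by linarith
      then have "\<bar>partial_deriv i f (x + s *\<^sub>R u) - partial_deriv i f x - hessian_col x i (s *\<^sub>R u)\<bar> \<le> e' * norm (s *\<^sub>R u)"
        by (rule d(2))
      also have "\<dots> \<le> e' * norm u" using nsu e' by (intro mult_left_mono) auto
      finally show "\<bar>(partial_deriv i f (x + s *\<^sub>R u) - hessian_col x i (s *\<^sub>R u)) * u $ i\<bar> \<le> e' * norm u * norm u"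
        unfolding abs_mult g0 using component_le_norm_cart[of u i] e'
        by (intro mult_mono) (simp_all only: diff_zero abs_ge_zero norm_ge_zero mult_nonneg_nonneg less_imp_le)
    qed
    also have "\<dots> = e * (norm u)\<^sup>2" by (simp add: e'_def power2_eq_square)
    finally show "\<bar>f (x + u) - (u \<bullet> (hessian f x *v u)) / 2\<bar> \<le> e * (norm u)\<^sup>2"
      using assms(1) by (simp add: \<phi>_def B_def)
  qed
qed

end

lemma positive_definite_lower_bound:
  fixes A :: "real^'n^'n"
  assumes "positive_definite A"
  obtains m where "0 < m" "\<And>u. m * (norm u)\<^sup>2 \<le> u \<bullet> (A *v u)"
proof -
  have cont: "continuous_on (sphere 0 1) (\<lambda>u. u \<bullet> (A *v u))"
    by (intro continuous_intros linear_continuous_on matrix_vector_mul_bounded_linear)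
  obtain v :: "real^'n" where v: "v \<in> sphere 0 1" "\<And>u. u \<in> sphere 0 1 \<Longrightarrow> v \<bullet> (A *v v) \<le> u \<bullet> (A *v u)"
    using continuous_attains_inf[OF compact_sphere _ cont] by auto
  have "v \<noteq> 0" using v(1) by auto
  show thesis
  proof (rule that)
    show "0 < v \<bullet> (A *v v)" using assms \<open>v \<noteq> 0\<close> by (simp add: positive_definite_def)
    fix u :: "real^'n"
    show "v \<bullet> (A *v v) * (norm u)\<^sup>2 \<le> u \<bullet> (A *v u)"
    proof (cases "u = 0")
      case False
      have "v \<bullet> (A *v v) \<le> (u /\<^sub>R norm u) \<bullet> (A *v (u /\<^sub>R norm u))"
        using False by (intro v(2)) simp
      also have "\<dots> = (u \<bullet> (A *v u)) / (norm u)\<^sup>2"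
        by (simp add: matrix_vector_mult_scaleR power2_eq_square divide_inverse mult_ac)
      finally show ?thesis using False by (simp add: field_simps)
    qed simp
  qed
qed

lemma inverse_approx_at_nondegenerate_zero:
  fixes f :: "real^'n \<Rightarrow> real"
  assumes C2: "class_C (Suc (Suc k)) f" and f: "f x = 0" "\<And>y. 0 \<le> f y"
    and pd: "positive_definite (hessian f x)" and e: "0 < e"
  shows "\<exists>d>0. \<forall>u. 0 < norm u \<longrightarrow> norm u < d \<longrightarrow>
    \<bar>1 / f (x + u) - 2 / (u \<bullet> (hessian f x *v u))\<bar> \<le> e * (2 / (u \<bullet> (hessian f x *v u)))"
proof -
  obtain m where m: "0 < m" "\<And>u. m * (norm u)\<^sup>2 \<le> u \<bullet> (hessian f x *v u)"
    using positive_definite_lower_bound[OF pd] by metis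
  \<comment> \<open>The cap \<open>1/4\<close> keeps the function above \<open>Q / 4\<close>;
    inverting then multiplies the relative error by 4.\<close>
  define e' where "e' = min (1/4) (e / 4)"
  have e': "0 < e'" "e' \<le> 1/4" "4 * e' \<le> e" using e by (auto simp: e'_def min_def)
  obtain d where d: "0 < d" "\<And>u. norm u < d \<Longrightarrow> \<bar>f (x + u) - (u \<bullet> (hessian f x *v u)) / 2\<bar> \<le> (e' * m) * (norm u)\<^sup>2"
    using quadratic_approx_at_zero_minimum[OF C2 f, of "e' * m"] e' m by auto
  show ?thesis
  proof (intro exI[of _ d] conjI d(1) allI impI)
    fix u :: "real^'n" assume u: "0 < norm u" "norm u < d"
    define Q where "Q = u \<bullet> (hessian f x *v u)"
    have Q: "0 < Q" using pd u by (simp add: positive_definite_def Q_def)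
    have "\<bar>f (x + u) - Q / 2\<bar> \<le> e' * (m * (norm u)\<^sup>2)" using d(2)[OF u(2)] by (simp add: Q_def mult_ac)
    also have "\<dots> \<le> e' * Q" using m(2)[of u] e' by (intro mult_left_mono) (auto simp: Q_def)
    finally have fQ: "\<bar>f (x + u) - Q / 2\<bar> \<le> e' * Q" .
    have "e' * Q \<le> 1/4 * Q" using e' Q by (intro mult_right_mono) auto
    then have fpos: "Q / 4 \<le> f (x + u)" "0 < f (x + u)" using fQ Q by linarith+
    have "1 / f (x + u) - 2 / Q = (- 2) * (f (x + u) - Q / 2) / (f (x + u) * Q)"
      using fpos Q by (simp add: field_simps)
    then have "\<bar>1 / f (x + u) - 2 / Q\<bar> = 2 * \<bar>f (x + u) - Q / 2\<bar> / (f (x + u) * Q)"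
      using fpos Q by (simp only: abs_mult abs_divide)
    also have "\<dots> \<le> 2 * (e' * Q) / (Q / 4 * Q)"
      using fpos Q fQ e' by (intro frac_le mult_left_mono mult_right_mono mult_nonneg_nonneg mult_pos_pos) auto
    also have "\<dots> = 4 * e' * (2 / Q)" using Q by (simp add: field_simps)
    also have "\<dots> \<le> e * (2 / Q)" using e' Q by (intro mult_right_mono) auto
    finally show "\<bar>1 / f (x + u) - 2 / (u \<bullet> (hessian f x *v u))\<bar> \<le> e * (2 / (u \<bullet> (hessian f x *v u)))"
      by (simp add: Q_def)
  qed
qed

text \<open>If \<open>\<bar>b * w\<bar> \<le> A / 4\<close>, the argument \<open>u\<close> is at
  least \<open>A / (4 * D * \<bar>w\<bar>)\<close> and
  \<open>pi / 2 - arctan u = arctan (1 / u) \<le> 1 / u\<close>. Otherwise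
  \<open>\<bar>w\<bar>\<close> is bounded below and the trivial bound \<open>pi\<close>
  suffices.\<close>

lemma abs_arctan_minus_half_pi_le:
  fixes D A b w :: real
  assumes "0 < A" "0 < D" "w \<noteq> 0"
  shows "\<bar>arctan ((A / 2 + b * w) / (D * \<bar>w\<bar>)) - pi / 2\<bar> \<le> (4 * D + 4 * pi * \<bar>b\<bar>) / A * \<bar>w\<bar>"
proof (cases "\<bar>b * w\<bar> \<le> A / 4")
  case True
  define u where "u = (A / 2 + b * w) / (D * \<bar>w\<bar>)"
  have "A / 4 \<le> A / 2 + b * w" using True by (auto simp: abs_le_iff)
  then have ge: "(A / 4) / (D * \<bar>w\<bar>) \<le> u" unfolding u_def
    using assms by (intro divide_right_mono) auto
  moreover have pos: "0 < (A / 4) / (D * \<bar>w\<bar>)" using assms by simp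
  ultimately have u: "0 < u" by linarith
  have "arctan (1 / u) = pi / 2 - arctan u"
    using arctan_inverse[of u] u by (simp add: inverse_eq_divide)
  moreover have "0 \<le> arctan (1 / u)" "arctan (1 / u) \<le> 1 / u" using u by (auto intro: arctan_le_self)
  moreover have "1 / u \<le> 1 / ((A / 4) / (D * \<bar>w\<bar>))" by (rule frac_le[OF zero_le_one order_refl pos ge])
  ultimately have "\<bar>arctan u - pi / 2\<bar> \<le> 4 * D / A * \<bar>w\<bar>" by simp
  also have "\<dots> \<le> (4 * D + 4 * pi * \<bar>b\<bar>) / A * \<bar>w\<bar>"
    using assms by (intro mult_right_mono divide_right_mono) auto
  finally show ?thesis by (simp add: u_def)
next
  case False
  have "\<bar>arctan ((A / 2 + b * w) / (D * \<bar>w\<bar>)) - pi / 2\<bar> \<le> pi"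
    using arctan_bounded[of "(A / 2 + b * w) / (D * \<bar>w\<bar>)"] by (auto simp: abs_le_iff)
  also have "\<dots> \<le> 4 * pi * \<bar>b\<bar> / A * \<bar>w\<bar>"
    using False assms by (simp add: abs_mult field_simps)
  also have "\<dots> \<le> (4 * D + 4 * pi * \<bar>b\<bar>) / A * \<bar>w\<bar>"
    using assms by (intro mult_right_mono divide_right_mono) auto
  finally show ?thesis .
qed

abbreviation binary_form :: "real \<Rightarrow> real \<Rightarrow> real \<Rightarrow> real \<Rightarrow> real \<Rightarrow> real" where
  "binary_form A B C s w \<equiv> A * s\<^sup>2 + 2 * B * s * w + C * w\<^sup>2"

lemma quadratic_form_lower_bounds:
  fixes A B C :: real
  assumes "0 < A" "0 < C"
  shows "(A * C - B\<^sup>2) / A * w\<^sup>2 \<le> binary_form A B C s w"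
    "(A * C - B\<^sup>2) / C * s\<^sup>2 \<le> binary_form A B C s w"
proof -
  have "A * binary_form A B C s w = (A * s + B * w)\<^sup>2 + (A * C - B\<^sup>2) * w\<^sup>2"
    by (simp add: power2_eq_square algebra_simps)
  then have "(A * C - B\<^sup>2) * w\<^sup>2 \<le> A * binary_form A B C s w" by simp
  then show "(A * C - B\<^sup>2) / A * w\<^sup>2 \<le> binary_form A B C s w"
    using assms by (simp add: field_simps)
  have "C * binary_form A B C s w = (C * w + B * s)\<^sup>2 + (A * C - B\<^sup>2) * s\<^sup>2"
    by (simp add: power2_eq_square algebra_simps)
  then have "(A * C - B\<^sup>2) * s\<^sup>2 \<le> C * binary_form A B C s w" by simp
  then show "(A * C - B\<^sup>2) / C * s\<^sup>2 \<le> binary_form A B C s w"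
    using assms by (simp add: field_simps)
qed

lemma cauchy_density_eq:
  fixes P A v :: real
  assumes "P \<noteq> 0"
  shows "2 / P * (A / P / (1 + (v / P)\<^sup>2)) = 2 * A / (P\<^sup>2 + v\<^sup>2)"
proof -
  have "1 + (v / P)\<^sup>2 = (P\<^sup>2 + v\<^sup>2) / P\<^sup>2"
    using assms by (simp add: power_divide add_divide_distrib)
  then show ?thesis using assms by (simp add: power2_eq_square)
qed

text \<open>Completing the square gives the primitive \<open>2 / (D \<bar>w\<bar>) * arctan ((A s +
  B w) / (D \<bar>w\<bar>))\<close>. At both ends the arctangent misses its limit by
  \<open>O(\<bar>w\<bar>)\<close>, which cancels the prefactor and leaves an error uniform in
  \<open>w\<close>.\<close>

lemma passage_integral_approx:
  fixes A B C :: real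
  assumes A: "0 < A" and \<Delta>: "0 < A * C - B\<^sup>2"
  obtains M where "\<And>w. w \<noteq> 0 \<Longrightarrow>
    \<bar>integral {-1/2..1/2} (\<lambda>s. 2 / binary_form A B C s w) - 2 * pi / sqrt (A * C - B\<^sup>2) / \<bar>w\<bar>\<bar> \<le> M"
proof -
  define D where "D = sqrt (A * C - B\<^sup>2)"
  have D: "0 < D" "D\<^sup>2 = A * C - B\<^sup>2" using \<Delta> by (auto simp: D_def)
  show thesis
  proof (rule that)
    fix w :: real assume w: "w \<noteq> 0"
    define G where "G s = 2 / (D * \<bar>w\<bar>) * arctan ((A * s + B * w) / (D * \<bar>w\<bar>))" for s
    have "(G has_real_derivative 2 / binary_form A B C s w) (at s)" for s
    proof -
      have "(G has_real_derivative 2 / (D * \<bar>w\<bar>) * (A / (D * \<bar>w\<bar>) / (1 + ((A * s + B * w) / (D * \<bar>w\<bar>))\<^sup>2))) (at s)"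
      proof -
        have "((\<lambda>s. (A * s + B * w) / (D * \<bar>w\<bar>)) has_real_derivative A / (D * \<bar>w\<bar>)) (at s)"
          by (auto intro!: derivative_eq_intros simp: divide_inverse)
        from DERIV_cmult[OF DERIV_chain2[OF DERIV_arctan this], of "2 / (D * \<bar>w\<bar>)"]
        show ?thesis unfolding G_def by (simp add: divide_inverse mult_ac)
      qed
      moreover have "2 / (D * \<bar>w\<bar>) * (A / (D * \<bar>w\<bar>) / (1 + ((A * s + B * w) / (D * \<bar>w\<bar>))\<^sup>2)) =
          2 * A / (D\<^sup>2 * w\<^sup>2 + (A * s + B * w)\<^sup>2)"
        using cauchy_density_eq[of "D * \<bar>w\<bar>" A "A * s + B * w"] D w by (simp add: power_mult_distrib)
      moreover have "D\<^sup>2 * w\<^sup>2 + (A * s + B * w)\<^sup>2 = A * binary_form A B C s w"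
        unfolding D(2) by (simp add: power2_eq_square algebra_simps)
      ultimately show ?thesis using A by simp
    qed
    then have "((\<lambda>s. 2 / binary_form A B C s w) has_integral (G (1/2) - G (-1/2))) {-1/2..1/2}"
      by (intro fundamental_theorem_of_calculus)
        (auto simp: has_real_derivative_iff_has_vector_derivative[symmetric] intro: has_field_derivative_at_within)
    then have I: "integral {-1/2..1/2} (\<lambda>s. 2 / binary_form A B C s w) = G (1/2) - G (-1/2)"
      by (rule integral_unique)
    define u1 u2 where "u1 = (A / 2 + B * w) / (D * \<bar>w\<bar>)" and "u2 = (A / 2 + (- B) * w) / (D * \<bar>w\<bar>)"
    have "G (-1/2) = 2 / (D * \<bar>w\<bar>) * arctan (- u2)"
      unfolding G_def u2_def by (simp add: minus_divide_left[symmetric] del: minus_divide_left) (simp add: minus_divide_left)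
    then have G2: "G (-1/2) = - (2 / (D * \<bar>w\<bar>) * arctan u2)" by (simp add: arctan_minus)
    have G1: "G (1/2) = 2 / (D * \<bar>w\<bar>) * arctan u1" by (simp add: G_def u1_def)
    define c where "c = (4 * D + 4 * pi * \<bar>B\<bar>) / A"
    have b: "\<bar>arctan u1 - pi / 2\<bar> \<le> c * \<bar>w\<bar>" "\<bar>arctan u2 - pi / 2\<bar> \<le> c * \<bar>w\<bar>"
      using abs_arctan_minus_half_pi_le[OF A D(1) w, of B] abs_arctan_minus_half_pi_le[OF A D(1) w, of "-B"]
      by (simp_all add: u1_def u2_def c_def)
    have "G (1/2) - G (-1/2) - 2 * pi / D / \<bar>w\<bar> = 2 / (D * \<bar>w\<bar>) * ((arctan u1 - pi / 2) + (arctan u2 - pi / 2))"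
      unfolding G1 G2 using D w by (simp add: field_simps)
    also have "\<bar>\<dots>\<bar> \<le> 2 / (D * \<bar>w\<bar>) * (2 * c * \<bar>w\<bar>)"
      unfolding abs_mult using D w b by (intro mult_mono) (auto simp: abs_le_iff)
    also have "\<dots> = 4 * c / D" using D w by simp
    finally show "\<bar>integral {-1/2..1/2} (\<lambda>s. 2 / binary_form A B C s w) - 2 * pi / sqrt (A * C - B\<^sup>2) / \<bar>w\<bar>\<bar>
      \<le> 4 * ((4 * D + 4 * pi * \<bar>B\<bar>) / A) / D"
      unfolding I by (simp add: c_def D_def)
  qed
qed

section \<open>Return times of the flow\<close>

text \<open>The lifted orbit of the linear flow through \<open>(0, y)\<close>, parametrized by the
  first coordinate.\<close>

definition section_point :: "real \<Rightarrow> real \<Rightarrow> real \<Rightarrow> real^2" where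
  "section_point \<alpha> s y = vector [s, s * \<alpha> + y]"

lemma section_point_nth [simp]:
  "section_point \<alpha> s y $ 1 = s" "section_point \<alpha> s y $ 2 = s * \<alpha> + y"
  by (simp_all add: section_point_def)

lemma norm_section_point_le: "norm (section_point \<alpha> s y) \<le> (1 + \<bar>\<alpha>\<bar>) * \<bar>s\<bar> + \<bar>y\<bar>"
proof -
  have "norm (section_point \<alpha> s y) \<le> \<bar>s\<bar> + \<bar>s * \<alpha> + y\<bar>"
    using norm_le_l1_cart[of "section_point \<alpha> s y"] by (simp add: sum_2)
  also have "\<bar>s * \<alpha> + y\<bar> \<le> \<bar>s\<bar> * \<bar>\<alpha>\<bar> + \<bar>y\<bar>"
    using abs_triangle_ineq[of "s * \<alpha>" y] by (simp add: abs_mult)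
  finally show ?thesis by (simp add: algebra_simps)
qed

lemma section_point_eq_0_iff: "section_point \<alpha> s y = 0 \<longleftrightarrow> s = 0 \<and> y = 0"
  by (auto simp: vec_eq_iff forall_2)

lemma to_torus_eq_iff_2: "to_torus x = to_torus y \<longleftrightarrow> x $ 1 - y $ 1 \<in> \<int> \<and> x $ 2 - y $ 2 \<in> \<int>"
  by (simp add: to_torus_eq_iff forall_2)

lemma continuous_on_section_point:
  "continuous_on S f \<Longrightarrow> continuous_on S g \<Longrightarrow> continuous_on S (\<lambda>z. section_point \<alpha> (f z) (g z))"
proof -
  assume *: "continuous_on S f" "continuous_on S g"
  have "section_point \<alpha> s y = s *\<^sub>R vector [1, \<alpha>] + y *\<^sub>R vector [0, 1]" for s y
    by (simp add: vec_eq_iff forall_2)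
  then show ?thesis using * by (auto intro!: continuous_intros)
qed

lemma torus_bounded:
  fixes F :: "torus \<Rightarrow> real"
  assumes "continuous_on UNIV F"
  obtains B where "0 < B" "\<And>z. \<bar>F z\<bar> \<le> B"
proof -
  have "continuous_on (cbox 0 1) (\<lambda>x. F (to_torus x))"
    by (rule continuous_on_compose2[OF assms continuous_on_subset[OF continuous_to_torus]]) auto
  then have "bounded ((\<lambda>x. F (to_torus x)) ` cbox 0 1)"
    by (intro compact_imp_bounded compact_continuous_image compact_cbox)
  then obtain B where B: "0 < B" "\<And>x. x \<in> cbox 0 1 \<Longrightarrow> \<bar>F (to_torus x)\<bar> \<le> B"
    unfolding bounded_pos by auto
  have "\<bar>F z\<bar> \<le> B" for z
  proof -
    define x where "x = (\<chi> i. frac (torus_rep z $ i))"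
    have "to_torus x = to_torus (torus_rep z)"
      unfolding to_torus_eq_iff by (auto simp: x_def frac_def)
    moreover have "x \<in> cbox 0 1" by (auto simp: mem_box_cart x_def less_imp_le[OF frac_lt_1])
    ultimately show ?thesis using B(2)[of x] by simp
  qed
  then show thesis using that B(1) by blast
qed

text \<open>The discriminant of a quadratic form does not change when it is written in the unimodular
  coordinates \<open>(s, y)\<close> given by \<open>section_point\<close>.\<close>

lemma quadratic_form_section_point:
  fixes H :: "real^2^2"
  assumes pd: "positive_definite H" and sym: "H $ 1 $ 2 = H $ 2 $ 1"
  obtains A B C where "0 < A" "0 < C" "0 < det H" "A * C - B\<^sup>2 = det H"
    "\<And>s w. section_point \<alpha> s w \<bullet> (H *v section_point \<alpha> s w) = binary_form A B C s w"
proof -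
  define A where "A = H$1$1 + 2 * \<alpha> * H$2$1 + \<alpha>\<^sup>2 * H$2$2"
  define B where "B = H$2$1 + \<alpha> * H$2$2"
  define C where "C = H$2$2"
  have Q: "section_point \<alpha> s w \<bullet> (H *v section_point \<alpha> s w) = binary_form A B C s w" for s w
    by (simp add: inner_vec_def matrix_vector_mult_def sum_2 A_def B_def C_def sym power2_eq_square algebra_simps)
  have pos: "0 < binary_form A B C s w" if "s \<noteq> 0 \<or> w \<noteq> 0" for s w
  proof -
    have "section_point \<alpha> s w \<noteq> 0" using that by (simp add: section_point_eq_0_iff)
    then show ?thesis using pd unfolding positive_definite_def Q[symmetric] by blast
  qed
  have A: "0 < A" using pos[of 1 0] by simp
  have C: "0 < C" using pos[of 0 1] by simp
  have d: "A * C - B\<^sup>2 = det H"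
    by (simp add: det_2 A_def B_def C_def sym power2_eq_square algebra_simps)
  have "0 < A * (A * C - B\<^sup>2)" using pos[of "-B" A] A by (simp add: power2_eq_square algebra_simps)
  then have "0 < det H" using A d by (simp add: zero_less_mult_iff)
  then show thesis using that[OF A C _ d Q] by blast
qed

text \<open>The error is split evenly between \<open>1 / \<psi>\<close>, which the Hessian controls,
  and \<open>F\<close>, which is continuous at the stop. It is relative to the singular kernel, so
  it survives integration over a passage.\<close>

lemma near_stop:
  fixes \<psi> F :: "torus \<Rightarrow> real" and x0 :: "real^2" and \<alpha> :: real
  assumes C3: "torus_class_C 3 \<psi>" and zero: "\<psi> (to_torus x0) = 0" and nonneg: "\<And>z. 0 \<le> \<psi> z"
    and pd: "positive_definite (torus_hessian \<psi> (to_torus x0))" and F: "continuous_on UNIV F" and e: "0 < \<epsilon>"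
  defines "Q \<equiv> \<lambda>s w. section_point \<alpha> s w \<bullet> (torus_hessian \<psi> (to_torus x0) *v section_point \<alpha> s w)"
  shows "\<exists>\<eta>>0. \<forall>s w. \<bar>s\<bar> < \<eta> \<longrightarrow> \<bar>w\<bar> < \<eta> \<longrightarrow> w \<noteq> 0 \<longrightarrow>
    \<bar>F (to_torus (x0 + section_point \<alpha> s w)) / \<psi> (to_torus (x0 + section_point \<alpha> s w)) - F (to_torus x0) * (2 / Q s w)\<bar>
      \<le> \<epsilon> * (2 / Q s w)"
proof -
  obtain B where B: "0 < B" "\<And>z. \<bar>F z\<bar> \<le> B" using torus_bounded[OF F] by blast
  have C2: "class_C (Suc (Suc 1)) (\<lambda>x. \<psi> (to_torus x))"
    using C3 by (simp only: torus_class_C_def numeral_3_eq_3 One_nat_def)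
  have eB: "0 < \<epsilon> / (2 * B)" using e B by simp
  obtain d1 where d1: "0 < d1" "\<And>u. 0 < norm u \<Longrightarrow> norm u < d1 \<Longrightarrow>
    \<bar>1 / \<psi> (to_torus (x0 + u)) - 2 / (u \<bullet> (hessian (\<lambda>x. \<psi> (to_torus x)) x0 *v u))\<bar>
      \<le> \<epsilon> / (2 * B) * (2 / (u \<bullet> (hessian (\<lambda>x. \<psi> (to_torus x)) x0 *v u)))"
    using inverse_approx_at_nondegenerate_zero[OF C2 zero nonneg pd[unfolded torus_hessian_to_torus] eB] by blast
  have "isCont (\<lambda>x. F (to_torus x)) x0"
    using continuous_on_compose2[OF F continuous_to_torus] by (simp add: continuous_on_eq_continuous_at)
  moreover have "0 < \<epsilon> / 2" using e by simp
  ultimately obtain d2 where d2: "0 < d2" "\<And>x. dist x x0 < d2 \<Longrightarrow> dist (F (to_torus x)) (F (to_torus x0)) < \<epsilon> / 2"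
    unfolding continuous_at_eps_delta by blast
  define \<eta> where "\<eta> = min d1 d2 / (2 + \<bar>\<alpha>\<bar>)"
  show ?thesis
  proof (intro exI[of _ \<eta>] conjI allI impI)
    show "0 < \<eta>" using d1 d2 by (simp add: \<eta>_def add_pos_nonneg)
    fix s w assume sw: "\<bar>s\<bar> < \<eta>" "\<bar>w\<bar> < \<eta>" "w \<noteq> 0"
    let ?u = "section_point \<alpha> s w"
    have "norm ?u \<le> (1 + \<bar>\<alpha>\<bar>) * \<bar>s\<bar> + \<bar>w\<bar>" by (rule norm_section_point_le)
    also have "\<dots> < (1 + \<bar>\<alpha>\<bar>) * \<eta> + \<eta>"
      using sw by (intro add_le_less_mono mult_left_mono) auto
    also have "\<dots> = (2 + \<bar>\<alpha>\<bar>) * \<eta>" by (simp add: algebra_simps)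
    also have "\<dots> = min d1 d2" unfolding \<eta>_def by (simp add: add_eq_0_iff)
    finally have u: "norm ?u < d1" "norm ?u < d2" by simp_all
    have u0: "?u \<noteq> 0" using sw by (simp add: section_point_eq_0_iff)
    then have Q0: "0 < Q s w" using pd by (simp add: positive_definite_def Q_def)
    let ?F = "F (to_torus (x0 + ?u))" and ?p = "\<psi> (to_torus (x0 + ?u))"
    have "\<bar>1 / ?p - 2 / Q s w\<bar> \<le> \<epsilon> / (2 * B) * (2 / Q s w)"
      using d1(2)[OF _ u(1)] u0 by (simp add: Q_def torus_hessian_to_torus)
    then have "\<bar>?F\<bar> * \<bar>1 / ?p - 2 / Q s w\<bar> \<le> B * (\<epsilon> / (2 * B) * (2 / Q s w))"
      using B by (intro mult_mono) auto
    also have "\<dots> = \<epsilon> / 2 * (2 / Q s w)" using B by simp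
    finally have 1: "\<bar>?F * (1 / ?p - 2 / Q s w)\<bar> \<le> \<epsilon> / 2 * (2 / Q s w)" by (simp only: abs_mult)
    have "\<bar>?F - F (to_torus x0)\<bar> \<le> \<epsilon> / 2"
      using d2(2)[of "x0 + ?u"] u(2) by (simp add: dist_norm)
    then have 2: "\<bar>(?F - F (to_torus x0)) * (2 / Q s w)\<bar> \<le> \<epsilon> / 2 * (2 / Q s w)"
      using Q0 e unfolding abs_mult by (intro mult_mono) auto
    have "?F / ?p - F (to_torus x0) * (2 / Q s w) =
        ?F * (1 / ?p - 2 / Q s w) + (?F - F (to_torus x0)) * (2 / Q s w)"
      by (simp add: algebra_simps)
    then have "\<bar>?F / ?p - F (to_torus x0) * (2 / Q s w)\<bar> \<le>
        \<bar>?F * (1 / ?p - 2 / Q s w)\<bar> + \<bar>(?F - F (to_torus x0)) * (2 / Q s w)\<bar>"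
      by (simp only: abs_triangle_ineq)
    also have "\<dots> \<le> \<epsilon> / 2 * (2 / Q s w) + \<epsilon> / 2 * (2 / Q s w)" using 1 2 by (rule add_mono)
    also have "\<dots> = \<epsilon> * (2 / Q s w)" by simp
    finally show "\<bar>?F / ?p - F (to_torus x0) * (2 / Q s w)\<bar> \<le> \<epsilon> * (2 / Q s w)" .
  qed
qed

text \<open>The sign is kept because the quadratic form has a cross term and depends on the side on
  which the orbit passes the stop.\<close>

definition centered :: "real \<Rightarrow> real" where
  "centered y = y - of_int (round y)"

lemma abs_centered: "\<bar>centered y\<bar> = nint_dist y"
  by (simp add: centered_def nint_dist_def)

lemma centered_eq_0_iff: "centered y = 0 \<longleftrightarrow> nint_dist y = 0"
  by (simp flip: abs_centered)

locale two_stops =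
  fixes \<alpha> \<beta> :: real and \<psi> :: "torus \<Rightarrow> real" and p q :: torus
  assumes p_def: "p = to_torus (vector [0, 0])" and q_def: "q = to_torus (vector [0, - \<beta>])"
    and C3: "torus_class_C 3 \<psi>" and p_neq_q: "p \<noteq> q" and \<psi>_p: "\<psi> p = 0" and \<psi>_q: "\<psi> q = 0"
    and \<psi>_pos: "\<And>z. z \<noteq> p \<Longrightarrow> z \<noteq> q \<Longrightarrow> 0 < \<psi> z"
    and pd_p: "positive_definite (torus_hessian \<psi> p)" and pd_q: "positive_definite (torus_hessian \<psi> q)"
begin

abbreviation pt :: "real \<Rightarrow> real \<Rightarrow> torus" where
  "pt s y \<equiv> to_torus (section_point \<alpha> s y)"

lemma \<psi>_nonneg: "0 \<le> \<psi> z"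
  using \<psi>_pos[of z] \<psi>_p \<psi>_q by (cases "z = p"; cases "z = q") (auto simp: less_imp_le)

lemma continuous_\<psi>: "continuous_on S (\<lambda>x. \<psi> (to_torus x))"
proof -
  have "(\<lambda>x. \<psi> (to_torus x)) differentiable_on UNIV"
    using C3 by (simp add: torus_class_C_def eval_nat_numeral)
  then show ?thesis using differentiable_imp_continuous_on continuous_on_subset by blast
qed

lemma to_torus_section_p: "pt s y = p \<longleftrightarrow> s \<in> \<int> \<and> s * \<alpha> + y \<in> \<int>"
  by (simp add: p_def to_torus_eq_iff_2)

lemma to_torus_section_q: "pt s y = q \<longleftrightarrow> s \<in> \<int> \<and> s * \<alpha> + y + \<beta> \<in> \<int>"
  by (simp add: q_def to_torus_eq_iff_2)

lemma nint_dist_\<beta>: "0 < nint_dist \<beta>"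
proof -
  have "\<beta> \<notin> \<int>" using p_neq_q by (simp add: p_def q_def to_torus_eq_iff_2)
  then show ?thesis using nint_dist_eq_0_iff[of \<beta>] nint_dist_nonneg[of \<beta>] by linarith
qed

lemma hessian_symmetric_stop: "torus_hessian \<psi> (to_torus x) $ 1 $ 2 = torus_hessian \<psi> (to_torus x) $ 2 $ 1"
proof -
  have "class_C (Suc (Suc 1)) (\<lambda>x. \<psi> (to_torus x))"
    using C3 by (simp only: torus_class_C_def numeral_3_eq_3 One_nat_def)
  from hessian_symmetric[OF this] show ?thesis by (simp add: torus_hessian_to_torus)
qed

text \<open>After \<open>y\<close> is reduced modulo 1, the points in question form a compact set
  without zeros of \<open>\<psi>\<close>.\<close>

lemma inverse_\<psi>_bounded_away:
  assumes \<eta>: "0 < \<eta>"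
  obtains M where "0 < M" "\<And>s y. \<bar>s\<bar> \<le> 1/2 \<Longrightarrow> \<eta> \<le> \<bar>s\<bar> \<or> \<eta> \<le> nint_dist y \<Longrightarrow>
    \<eta> \<le> \<bar>s\<bar> \<or> \<eta> \<le> nint_dist (y + \<beta>) \<Longrightarrow> 1 / \<psi> (pt s y) \<le> M"
proof -
  let ?R = "{-1/2..1/2} \<times> {-1/2..1/2} :: (real \<times> real) set"
  define S where "S = ?R \<inter> (({z. \<eta> \<le> \<bar>fst z\<bar>} \<union> {z. \<eta> \<le> nint_dist (snd z)}) \<inter>
      ({z. \<eta> \<le> \<bar>fst z\<bar>} \<union> {z. \<eta> \<le> nint_dist (snd z + \<beta>)}))"
  define g where "g z = \<psi> (pt (fst z) (snd z))" for z
  have cs: "compact S" unfolding S_def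
    by (intro compact_Int_closed compact_Times closed_Int closed_Un closed_Collect_le continuous_intros
      continuous_on_compose2[OF continuous_on_nint_dist[of UNIV]]) auto
  have pos: "0 < g z" if "z \<in> S" for z
  proof -
    obtain s y where z: "z = (s, y)" by fastforce
    have s0: "s = 0" if "s \<in> \<int>"
      using that \<open>z \<in> S\<close> unfolding S_def z by (auto elim!: Ints_cases)
    have "pt s y \<noteq> p"
      unfolding to_torus_section_p using s0 \<open>z \<in> S\<close> \<eta> nint_dist_eq_0_iff[of y] unfolding S_def z by auto
    moreover have "pt s y \<noteq> q"
      unfolding to_torus_section_q using s0 \<open>z \<in> S\<close> \<eta> nint_dist_eq_0_iff[of "y + \<beta>"] unfolding S_def z by auto
    ultimately show ?thesis unfolding g_def z by (simp add: \<psi>_pos)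
  qed
  have "continuous_on S g" unfolding g_def
    by (intro continuous_on_compose2[OF continuous_\<psi>[of UNIV]] continuous_on_section_point continuous_intros) auto
  then have "continuous_on S (\<lambda>z. 1 / g z)" using pos by (intro continuous_intros) (auto simp: less_imp_neq[symmetric])
  then have "bounded ((\<lambda>z. 1 / g z) ` S)" by (intro compact_imp_bounded compact_continuous_image cs)
  then obtain M where M: "0 < M" "\<And>z. z \<in> S \<Longrightarrow> \<bar>1 / g z\<bar> \<le> M" unfolding bounded_pos by auto
  show thesis
  proof (rule that[OF M(1)])
    fix s y :: real
    assume s: "\<bar>s\<bar> \<le> 1/2" and 1: "\<eta> \<le> \<bar>s\<bar> \<or> \<eta> \<le> nint_dist y" and 2: "\<eta> \<le> \<bar>s\<bar> \<or> \<eta> \<le> nint_dist (y + \<beta>)"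
    define w where "w = centered y"
    have "\<bar>w\<bar> \<le> 1/2" unfolding w_def centered_def using of_int_round_abs_le[of y] by (simp add: abs_minus_commute)
    moreover have "nint_dist w = nint_dist y" by (simp add: w_def centered_def)
    moreover have "w + \<beta> = (y + \<beta>) - of_int (round y)" by (simp add: w_def centered_def)
    then have "nint_dist (w + \<beta>) = nint_dist (y + \<beta>)" by (simp only: nint_dist_diff_int)
    ultimately have "(s, w) \<in> S" using s 1 2 by (auto simp: S_def abs_le_iff)
    moreover have "pt s w = pt s y"
      by (simp add: to_torus_eq_iff_2 w_def centered_def)
    ultimately show "1 / \<psi> (pt s y) \<le> M" using M(2)[of "(s, w)"] \<psi>_nonneg by (simp add: g_def)
  qed
qed

text \<open>The leading term of \<open>1 / \<psi>\<close> at a stop, where \<open>\<psi>\<close> is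
  about half of its Hessian form.\<close>

definition stop_kernel :: "torus \<Rightarrow> real \<Rightarrow> real \<Rightarrow> real" where
  "stop_kernel z s w = 2 / (section_point \<alpha> s w \<bullet> (torus_hessian \<psi> z *v section_point \<alpha> s w))"

lemma stop_kernel_pos:
  assumes "positive_definite (torus_hessian \<psi> z)" "w \<noteq> 0"
  shows "0 < stop_kernel z s w"
  using assms by (simp add: stop_kernel_def positive_definite_def section_point_eq_0_iff)

lemma stop_kernel_form:
  assumes "positive_definite (torus_hessian \<psi> z)"
  shows "\<exists>A B C. 0 < A \<and> 0 < C \<and> 0 < det (torus_hessian \<psi> z) \<and> A * C - B\<^sup>2 = det (torus_hessian \<psi> z) \<and>
    (\<forall>s w. stop_kernel z s w = 2 / binary_form A B C s w)"
proof -
  have sym: "torus_hessian \<psi> z $ 1 $ 2 = torus_hessian \<psi> z $ 2 $ 1"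
    using hessian_symmetric_stop[of "torus_rep z"] by simp
  show ?thesis
  proof (rule quadratic_form_section_point[OF assms sym, of \<alpha>])
    fix A B C
    assume *: "0 < A" "0 < C" "0 < det (torus_hessian \<psi> z)" "A * C - B\<^sup>2 = det (torus_hessian \<psi> z)"
      "\<And>s w. section_point \<alpha> s w \<bullet> (torus_hessian \<psi> z *v section_point \<alpha> s w) =
        binary_form A B C s w"
    then show ?thesis unfolding stop_kernel_def by (intro exI[of _ A] exI[of _ B] exI[of _ C]) simp
  qed
qed

lemma stop_kernel_bounded:
  assumes pd: "positive_definite (torus_hessian \<psi> z)" and \<eta>: "0 < \<eta>"
  obtains M where "0 < M" "\<And>s w. \<eta> \<le> \<bar>s\<bar> \<or> \<eta> \<le> \<bar>w\<bar> \<Longrightarrow> stop_kernel z s w \<le> M"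
proof -
  obtain A B C where *: "0 < A" "0 < C" "0 < det (torus_hessian \<psi> z)" "A * C - B\<^sup>2 = det (torus_hessian \<psi> z)"
    "\<And>s w. stop_kernel z s w = 2 / binary_form A B C s w"
    using stop_kernel_form[OF pd] by blast
  define D where "D = det (torus_hessian \<psi> z)"
  define m where "m = min (D / A) (D / C) * \<eta>\<^sup>2"
  have m: "0 < m" using * \<eta> by (simp add: m_def D_def)
  show thesis
  proof (rule that[of "2 / m"])
    fix s w assume sw: "\<eta> \<le> \<bar>s\<bar> \<or> \<eta> \<le> \<bar>w\<bar>"
    have "m \<le> binary_form A B C s w"
    proof (cases "\<eta> \<le> \<bar>w\<bar>")
      case True
      then have "\<eta>\<^sup>2 \<le> w\<^sup>2" using \<eta> by (metis abs_le_square_iff abs_of_pos)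
      then have "m \<le> D / A * w\<^sup>2" unfolding m_def using * by (intro mult_mono) (auto simp: D_def)
      then show ?thesis using quadratic_form_lower_bounds(1)[OF *(1,2), of B w s] *(4) by (simp add: D_def)
    next
      case False
      then have "\<eta>\<^sup>2 \<le> s\<^sup>2" using \<eta> sw by (metis abs_le_square_iff abs_of_pos)
      then have "m \<le> D / C * s\<^sup>2" unfolding m_def using * by (intro mult_mono) (auto simp: D_def)
      then show ?thesis using quadratic_form_lower_bounds(2)[OF *(1,2), of B s w] *(4) by (simp add: D_def)
    qed
    then show "stop_kernel z s w \<le> 2 / m" unfolding *(5) using m by (intro frac_le) auto
  qed (use m in simp)
qed

text \<open>The coefficient of \<open>1 / \<bar>w\<bar>\<close> in the time of a passage at offset
  \<open>w\<close>. Normalizing the two weights to total 1 gives the masses of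
  \<open>mu_infinity\<close>.\<close>

definition weight :: "torus \<Rightarrow> real" where
  "weight z = 2 * pi / sqrt (det (torus_hessian \<psi> z))"

lemma weight_pos: "positive_definite (torus_hessian \<psi> z) \<Longrightarrow> 0 < weight z"
  unfolding weight_def using stop_kernel_form[of z] by auto

lemma stop_kernel_integral:
  assumes pd: "positive_definite (torus_hessian \<psi> z)"
  obtains M where "\<And>w. w \<noteq> 0 \<Longrightarrow> (\<lambda>s. stop_kernel z s w) integrable_on {-1/2..1/2}"
    "\<And>w. w \<noteq> 0 \<Longrightarrow> \<bar>integral {-1/2..1/2} (\<lambda>s. stop_kernel z s w) - weight z / \<bar>w\<bar>\<bar> \<le> M"
proof -
  obtain A B C where *: "0 < A" "0 < C" "0 < det (torus_hessian \<psi> z)" "A * C - B\<^sup>2 = det (torus_hessian \<psi> z)"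
    "\<And>s w. stop_kernel z s w = 2 / binary_form A B C s w"
    using stop_kernel_form[OF pd] by blast
  have "0 < A * C - B\<^sup>2" using * by simp
  then obtain M where M: "\<And>w. w \<noteq> 0 \<Longrightarrow>
    \<bar>integral {-1/2..1/2} (\<lambda>s. 2 / binary_form A B C s w) - 2 * pi / sqrt (A * C - B\<^sup>2) / \<bar>w\<bar>\<bar> \<le> M"
    using passage_integral_approx[OF *(1)] by blast
  show thesis
  proof (rule that)
    fix w :: real assume w: "w \<noteq> 0"
    have "binary_form A B C s w \<noteq> 0" for s
      using stop_kernel_pos[OF pd w, of s] *(5)[of s w] by auto
    then have "continuous_on {-1/2..1/2} (\<lambda>s. stop_kernel z s w)"
      unfolding *(5) by (intro continuous_intros) auto
    then show "(\<lambda>s. stop_kernel z s w) integrable_on {-1/2..1/2}"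
      by (rule integrable_continuous_interval)
    show "\<bar>integral {-1/2..1/2} (\<lambda>s. stop_kernel z s w) - weight z / \<bar>w\<bar>\<bar> \<le> M"
      using M[OF w] *(4) unfolding *(5) weight_def by simp
  qed
qed

text \<open>Near one stop its own kernel is the leading term and the other kernel is bounded; away
  from both stops everything is bounded. Bounded contributions go into \<open>M\<close>.\<close>

lemma section_integrand_approx:
  assumes F: "continuous_on UNIV F" and e: "0 < \<epsilon>"
  obtains M where "0 \<le> M" "\<And>s y. \<bar>s\<bar> \<le> 1/2 \<Longrightarrow> nint_dist y \<noteq> 0 \<Longrightarrow> nint_dist (y + \<beta>) \<noteq> 0 \<Longrightarrow>
    \<bar>F (pt s y) / \<psi> (pt s y)
      - (F p * stop_kernel p s (centered y) + F q * stop_kernel q s (centered (y + \<beta>)))\<bar>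
    \<le> \<epsilon> * (stop_kernel p s (centered y) + stop_kernel q s (centered (y + \<beta>))) + M"
proof -
  obtain B where B: "0 < B" "\<And>z. \<bar>F z\<bar> \<le> B" using torus_bounded[OF F] by blast
  obtain \<eta>p where \<eta>p: "0 < \<eta>p" "\<And>s w. \<bar>s\<bar> < \<eta>p \<Longrightarrow> \<bar>w\<bar> < \<eta>p \<Longrightarrow> w \<noteq> 0 \<Longrightarrow>
    \<bar>F (to_torus (vector [0, 0] + section_point \<alpha> s w)) / \<psi> (to_torus (vector [0, 0] + section_point \<alpha> s w)) - F p * stop_kernel p s w\<bar>
      \<le> \<epsilon> * stop_kernel p s w"
    using near_stop[OF C3 \<psi>_p[unfolded p_def] \<psi>_nonneg pd_p[unfolded p_def] F e, of \<alpha>]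
    unfolding p_def stop_kernel_def by blast
  obtain \<eta>q where \<eta>q: "0 < \<eta>q" "\<And>s w. \<bar>s\<bar> < \<eta>q \<Longrightarrow> \<bar>w\<bar> < \<eta>q \<Longrightarrow> w \<noteq> 0 \<Longrightarrow>
    \<bar>F (to_torus (vector [0, - \<beta>] + section_point \<alpha> s w)) / \<psi> (to_torus (vector [0, - \<beta>] + section_point \<alpha> s w)) - F q * stop_kernel q s w\<bar>
      \<le> \<epsilon> * stop_kernel q s w"
    using near_stop[OF C3 \<psi>_q[unfolded q_def] \<psi>_nonneg pd_q[unfolded q_def] F e, of \<alpha>]
    unfolding q_def stop_kernel_def by blast
  \<comment> \<open>Half the distance between the stops on the circle, so that no point is close to
    both.\<close>
  define \<eta> where "\<eta> = min (min \<eta>p \<eta>q) (nint_dist \<beta> / 2)"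
  have \<eta>: "0 < \<eta>" "\<eta> \<le> \<eta>p" "\<eta> \<le> \<eta>q" "2 * \<eta> \<le> nint_dist \<beta>"
    using \<eta>p(1) \<eta>q(1) nint_dist_\<beta> by (auto simp: \<eta>_def min_def)
  obtain Mp where Mp: "0 < Mp" "\<And>s w. \<eta> \<le> \<bar>s\<bar> \<or> \<eta> \<le> \<bar>w\<bar> \<Longrightarrow> stop_kernel p s w \<le> Mp"
    using stop_kernel_bounded[OF pd_p \<eta>(1)] by blast
  obtain Mq where Mq: "0 < Mq" "\<And>s w. \<eta> \<le> \<bar>s\<bar> \<or> \<eta> \<le> \<bar>w\<bar> \<Longrightarrow> stop_kernel q s w \<le> Mq"
    using stop_kernel_bounded[OF pd_q \<eta>(1)] by blast
  obtain M1 where M1: "0 < M1" "\<And>s y. \<bar>s\<bar> \<le> 1/2 \<Longrightarrow> \<eta> \<le> \<bar>s\<bar> \<or> \<eta> \<le> nint_dist y \<Longrightarrow>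
    \<eta> \<le> \<bar>s\<bar> \<or> \<eta> \<le> nint_dist (y + \<beta>) \<Longrightarrow> 1 / \<psi> (pt s y) \<le> M1"
    using inverse_\<psi>_bounded_away[OF \<eta>(1)] by blast
  show thesis
  proof (rule that[of "B * (M1 + Mp + Mq)"])
    show "0 \<le> B * (M1 + Mp + Mq)" using B M1 Mp Mq by simp
    fix s y :: real
    assume s: "\<bar>s\<bar> \<le> 1/2" and y: "nint_dist y \<noteq> 0" "nint_dist (y + \<beta>) \<noteq> 0"
    let ?x = "pt s y"
    define P where "P = stop_kernel p s (centered y)"
    define Q where "Q = stop_kernel q s (centered (y + \<beta>))"
    have P0: "0 < P" unfolding P_def using y by (intro stop_kernel_pos pd_p) (simp add: centered_eq_0_iff)
    have Q0: "0 < Q" unfolding Q_def using y by (intro stop_kernel_pos pd_q) (simp add: centered_eq_0_iff)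
    have xp: "to_torus (vector [0, 0] + section_point \<alpha> s (centered y)) = ?x"
      by (simp add: to_torus_eq_iff_2 centered_def)
    have xq: "to_torus (vector [0, - \<beta>] + section_point \<alpha> s (centered (y + \<beta>))) = ?x"
      by (simp add: to_torus_eq_iff_2 centered_def)
    have FP: "\<bar>F p * P\<bar> \<le> B * P" using B P0 by (simp add: abs_mult mult_right_mono)
    have FQ: "\<bar>F q * Q\<bar> \<le> B * Q" using B Q0 by (simp add: abs_mult mult_right_mono)
    have pos: "0 \<le> B * M1" "0 \<le> B * Mp" "0 \<le> B * Mq" "0 \<le> \<epsilon> * P" "0 \<le> \<epsilon> * Q"
      using B M1 Mp Mq P0 Q0 e by simp_all
    have "nint_dist \<beta> \<le> nint_dist (y + \<beta>) + nint_dist y"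
      using nint_dist_add_le[of "y + \<beta>" "- centered y"] abs_centered[of y] by (simp add: centered_def)
    then have sep: "nint_dist y < \<eta> \<Longrightarrow> \<eta> \<le> nint_dist (y + \<beta>)" using \<eta>(4) by linarith
    consider "\<bar>s\<bar> < \<eta>" "nint_dist y < \<eta>" | "\<bar>s\<bar> < \<eta>" "nint_dist (y + \<beta>) < \<eta>"
      | "\<eta> \<le> \<bar>s\<bar> \<or> \<eta> \<le> nint_dist y" "\<eta> \<le> \<bar>s\<bar> \<or> \<eta> \<le> nint_dist (y + \<beta>)" by linarith
    then have "\<bar>F ?x / \<psi> ?x - (F p * P + F q * Q)\<bar> \<le> \<epsilon> * P + \<epsilon> * Q + (B * M1 + B * Mp + B * Mq)"
    proof cases
      case 1
      have "\<bar>F ?x / \<psi> ?x - F p * P\<bar> \<le> \<epsilon> * P"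
        using \<eta>p(2)[of s "centered y"] 1 \<eta>(2) y(1) unfolding xp P_def by (simp add: abs_centered centered_eq_0_iff)
      moreover have "B * Q \<le> B * Mq"
        using Mq(2)[of s "centered (y + \<beta>)"] sep[OF 1(2)] B by (simp add: abs_centered Q_def)
      ultimately show ?thesis using FQ pos unfolding abs_le_iff by linarith
    next
      case 2
      have "\<bar>F ?x / \<psi> ?x - F q * Q\<bar> \<le> \<epsilon> * Q"
        using \<eta>q(2)[of s "centered (y + \<beta>)"] 2 \<eta>(3) y(2) unfolding xq Q_def by (simp add: abs_centered centered_eq_0_iff)
      moreover have "\<eta> \<le> nint_dist y" using sep 2(2) by linarith
      then have "B * P \<le> B * Mp"
        using Mp(2)[of s "centered y"] B by (simp add: abs_centered P_def)
      ultimately show ?thesis using FP pos unfolding abs_le_iff by linarith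
    next
      case 3
      have "\<bar>F ?x\<bar> * (1 / \<psi> ?x) \<le> B * M1"
        using M1(2)[OF s 3] B \<psi>_nonneg by (intro mult_mono) auto
      then have "\<bar>F ?x / \<psi> ?x\<bar> \<le> B * M1" using \<psi>_nonneg[of ?x] by (simp add: abs_divide)
      moreover have "B * P \<le> B * Mp" using Mp(2)[of s "centered y"] B 3(1) by (simp add: abs_centered P_def)
      moreover have "B * Q \<le> B * Mq" using Mq(2)[of s "centered (y + \<beta>)"] B 3(2) by (simp add: abs_centered Q_def)
      ultimately show ?thesis using FP FQ pos unfolding abs_le_iff by linarith
    qed
    then show "\<bar>F ?x / \<psi> ?x - (F p * stop_kernel p s (centered y) + F q * stop_kernel q s (centered (y + \<beta>)))\<bar>
      \<le> \<epsilon> * (stop_kernel p s (centered y) + stop_kernel q s (centered (y + \<beta>))) + B * (M1 + Mp + Mq)"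
      by (simp add: P_def Q_def distrib_left)
  qed
qed

text \<open>With \<open>F = 1\<close> this is the time spent on one lap. The lap is centred at the
  circle that carries both stops, so each close passage lies in the interior of one lap.\<close>

definition roof :: "(torus \<Rightarrow> real) \<Rightarrow> real \<Rightarrow> real" where
  "roof F y = integral {-1/2..1/2} (\<lambda>s. F (pt s y) / \<psi> (pt s y))"

lemma continuous_on_section_integrand:
  assumes F: "continuous_on UNIV F" and pos: "\<And>s. s \<in> S \<Longrightarrow> 0 < \<psi> (pt s y)"
  shows "continuous_on S (\<lambda>s. F (pt s y) / \<psi> (pt s y))"
proof -
  have c: "continuous_on S (\<lambda>s. section_point \<alpha> s y)" by (intro continuous_on_section_point continuous_intros)
  have "continuous_on S (\<lambda>s. F (pt s y))"
    by (rule continuous_on_compose2[OF continuous_on_compose2[OF F continuous_to_torus] c]) auto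
  moreover have "continuous_on S (\<lambda>s. \<psi> (pt s y))"
    by (rule continuous_on_compose2[OF continuous_\<psi>[of UNIV] c]) auto
  ultimately show ?thesis using pos by (intro continuous_on_divide) (auto simp: less_imp_neq[symmetric])
qed

lemma \<psi>_section_pos:
  assumes "\<bar>s\<bar> \<le> 1/2" "nint_dist y \<noteq> 0" "nint_dist (y + \<beta>) \<noteq> 0"
  shows "0 < \<psi> (pt s y)"
proof (rule \<psi>_pos)
  have s0: "s = 0" if "s \<in> \<int>" using that assms(1) by (auto elim!: Ints_cases)
  show "pt s y \<noteq> p"
    unfolding to_torus_section_p using s0 assms(2) nint_dist_eq_0_iff[of y] by auto
  show "pt s y \<noteq> q"
    unfolding to_torus_section_q using s0 assms(3) nint_dist_eq_0_iff[of "y + \<beta>"] by auto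
qed

text \<open>The kernel approximation is integrated over a lap. The kernel integrals equal
  \<open>weight / distance\<close> up to a constant, which joins \<open>M\<close>.\<close>

lemma roof_approx:
  assumes F: "continuous_on UNIV F" and e: "0 < \<epsilon>"
  shows "\<exists>M\<ge>0. \<forall>y. nint_dist y \<noteq> 0 \<longrightarrow> nint_dist (y + \<beta>) \<noteq> 0 \<longrightarrow>
    \<bar>roof F y - (F p * weight p / nint_dist y + F q * weight q / nint_dist (y + \<beta>))\<bar>
      \<le> \<epsilon> * (1 / nint_dist y + 1 / nint_dist (y + \<beta>)) + M"
proof -
  obtain B where B: "0 < B" "\<And>z. \<bar>F z\<bar> \<le> B" using torus_bounded[OF F] by blast
  define W where "W = max (weight p) (weight q)"
  have W: "0 < W" "weight p \<le> W" "weight q \<le> W" using weight_pos[OF pd_p] by (auto simp: W_def)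
  \<comment> \<open>Integration multiplies the relative error by a weight, hence the division by the
    larger one.\<close>
  define e' where "e' = \<epsilon> / W"
  have e': "0 < e'" using e W by (simp add: e'_def)
  obtain M where M: "0 \<le> M" "\<And>s y. \<bar>s\<bar> \<le> 1/2 \<Longrightarrow> nint_dist y \<noteq> 0 \<Longrightarrow> nint_dist (y + \<beta>) \<noteq> 0 \<Longrightarrow>
    \<bar>F (pt s y) / \<psi> (pt s y)
      - (F p * stop_kernel p s (centered y) + F q * stop_kernel q s (centered (y + \<beta>)))\<bar>
    \<le> e' * (stop_kernel p s (centered y) + stop_kernel q s (centered (y + \<beta>))) + M"
    using section_integrand_approx[OF F e'] by blast
  obtain Mp where Mp: "\<And>w. w \<noteq> 0 \<Longrightarrow> (\<lambda>s. stop_kernel p s w) integrable_on {-1/2..1/2}"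
    "\<And>w. w \<noteq> 0 \<Longrightarrow> \<bar>integral {-1/2..1/2} (\<lambda>s. stop_kernel p s w) - weight p / \<bar>w\<bar>\<bar> \<le> Mp"
    using stop_kernel_integral[OF pd_p] by blast
  obtain Mq where Mq: "\<And>w. w \<noteq> 0 \<Longrightarrow> (\<lambda>s. stop_kernel q s w) integrable_on {-1/2..1/2}"
    "\<And>w. w \<noteq> 0 \<Longrightarrow> \<bar>integral {-1/2..1/2} (\<lambda>s. stop_kernel q s w) - weight q / \<bar>w\<bar>\<bar> \<le> Mq"
    using stop_kernel_integral[OF pd_q] by blast
  have M0: "0 \<le> Mp" "0 \<le> Mq" using Mp(2)[of 1] Mq(2)[of 1] by linarith+
  show ?thesis
  proof (intro exI[of _ "(B + e') * (Mp + Mq) + M"] conjI allI impI)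
    show "0 \<le> (B + e') * (Mp + Mq) + M" using B e' M M0 by simp
    fix y assume y: "nint_dist y \<noteq> 0" "nint_dist (y + \<beta>) \<noteq> 0"
    define f where "f s = F (pt s y) / \<psi> (pt s y)" for s
    define kp where "kp s = stop_kernel p s (centered y)" for s
    define kq where "kq s = stop_kernel q s (centered (y + \<beta>))" for s
    have c: "centered y \<noteq> 0" "centered (y + \<beta>) \<noteq> 0" using y by (simp_all add: centered_eq_0_iff)
    have i: "f integrable_on {-1/2..1/2}" "kp integrable_on {-1/2..1/2}" "kq integrable_on {-1/2..1/2}"
    proof -
      show "f integrable_on {-1/2..1/2}" unfolding f_def
        by (intro integrable_continuous_interval continuous_on_section_integrand F \<psi>_section_pos y) (auto simp: abs_le_iff)
      show "kp integrable_on {-1/2..1/2}" unfolding kp_def by (rule Mp(1)[OF c(1)])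
      show "kq integrable_on {-1/2..1/2}" unfolding kq_def by (rule Mq(1)[OF c(2)])
    qed
    let ?I = "integral {-1/2..1/2::real}"
    have "norm (?I (\<lambda>s. f s - (F p * kp s + F q * kq s))) \<le> ?I (\<lambda>s. e' * (kp s + kq s) + M)"
    proof (rule integral_norm_bound_integral)
      show "(\<lambda>s. f s - (F p * kp s + F q * kq s)) integrable_on {-1/2..1/2}"
        using i by (intro integrable_diff integrable_add integrable_on_mult_right) auto
      show "(\<lambda>s. e' * (kp s + kq s) + M) integrable_on {-1/2..1/2}"
        using i by (intro integrable_add integrable_on_mult_right integrable_const_ivl) auto
      fix s :: real assume "s \<in> {-1/2..1/2}"
      then have "\<bar>s\<bar> \<le> 1/2" by (auto simp: abs_le_iff)
      then show "norm (f s - (F p * kp s + F q * kq s)) \<le> e' * (kp s + kq s) + M"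
        using M(2)[OF _ y, of s] by (simp add: f_def kp_def kq_def)
    qed
    moreover have "?I (\<lambda>s. f s - (F p * kp s + F q * kq s)) = ?I f - (F p * ?I kp + F q * ?I kq)"
      using i by (simp add: integral_diff integral_add integrable_add integrable_on_mult_right)
    moreover have "?I (\<lambda>s. e' * (kp s + kq s) + M) = e' * (?I kp + ?I kq) + M"
      using i by (simp add: integral_add integrable_add integrable_on_mult_right integrable_const_ivl)
    ultimately have 1: "\<bar>?I f - (F p * ?I kp + F q * ?I kq)\<bar> \<le> e' * (?I kp + ?I kq) + M" by simp
    define P where "P = weight p / nint_dist y"
    define Q where "Q = weight q / nint_dist (y + \<beta>)"
    have P: "\<bar>?I kp - P\<bar> \<le> Mp" using Mp(2)[OF c(1)] by (simp add: kp_def[abs_def] P_def abs_centered)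
    have Q: "\<bar>?I kq - Q\<bar> \<le> Mq" using Mq(2)[OF c(2)] by (simp add: kq_def[abs_def] Q_def abs_centered)
    have "\<bar>F p * (?I kp - P)\<bar> \<le> B * Mp"
      unfolding abs_mult by (intro mult_mono B(2) P abs_ge_zero less_imp_le[OF B(1)])
    moreover have "\<bar>F q * (?I kq - Q)\<bar> \<le> B * Mq"
      unfolding abs_mult by (intro mult_mono B(2) Q abs_ge_zero less_imp_le[OF B(1)])
    moreover have "(F p * ?I kp + F q * ?I kq) - (F p * P + F q * Q) = F p * (?I kp - P) + F q * (?I kq - Q)"
      by (simp only: right_diff_distrib)
    ultimately have 2: "\<bar>(F p * ?I kp + F q * ?I kq) - (F p * P + F q * Q)\<bar> \<le> B * Mp + B * Mq"
      using abs_triangle_ineq[of "F p * (?I kp - P)" "F q * (?I kq - Q)"] by linarith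
    have "e' * ?I kp \<le> e' * (P + Mp)" using P e' by (intro mult_left_mono) linarith+
    moreover have "e' * ?I kq \<le> e' * (Q + Mq)" using Q e' by (intro mult_left_mono) linarith+
    ultimately have 3: "e' * (?I kp + ?I kq) \<le> e' * P + e' * Q + (e' * Mp + e' * Mq)"
      unfolding distrib_left by linarith
    have eW: "e' * W = \<epsilon>" using W by (simp add: e'_def)
    have "e' * weight p \<le> \<epsilon>" "e' * weight q \<le> \<epsilon>"
      unfolding eW[symmetric] by (intro mult_left_mono W less_imp_le[OF e'])+
    then have "e' * weight p / nint_dist y \<le> \<epsilon> / nint_dist y" "e' * weight q / nint_dist (y + \<beta>) \<le> \<epsilon> / nint_dist (y + \<beta>)"
      by (auto intro!: divide_right_mono)
    then have 4: "e' * P + e' * Q \<le> \<epsilon> * (1 / nint_dist y + 1 / nint_dist (y + \<beta>))"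
      by (simp add: P_def Q_def distrib_left)
    have "\<bar>?I f - (F p * P + F q * Q)\<bar> \<le> \<epsilon> * (1 / nint_dist y + 1 / nint_dist (y + \<beta>)) + ((B + e') * (Mp + Mq) + M)"
      using 1 2 3 4 unfolding distrib_right[of B e'] distrib_left[of B] distrib_left[of e' Mp] abs_le_iff by linarith
    then show "\<bar>roof F y - (F p * weight p / nint_dist y + F q * weight q / nint_dist (y + \<beta>))\<bar>
      \<le> \<epsilon> * (1 / nint_dist y + 1 / nint_dist (y + \<beta>)) + ((B + e') * (Mp + Mq) + M)"
      by (simp add: roof_def f_def[abs_def] P_def Q_def)
  qed
qed

end

section \<open>Time averages along an orbit\<close>

locale good_orbit = two_stops +
  fixes y :: real
  assumes spike_y: "spike_free \<alpha> y" and spike_y': "spike_free \<alpha> (y + \<beta>)"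
    and ratio: "(\<lambda>n. orbit_sum \<alpha> n (y + \<beta>) / orbit_sum \<alpha> n y) \<longlonglongrightarrow> 1"
    and orbit_sum_div: "filterlim (\<lambda>n. orbit_sum \<alpha> n y / real n) at_top at_top"
begin

abbreviation "a n \<equiv> orbit_sum \<alpha> n y"
abbreviation "b n \<equiv> orbit_sum \<alpha> n (y + \<beta>)"

lemma avoids: "avoids_zero \<alpha> y" "avoids_zero \<alpha> (y + \<beta>)"
  using spike_y spike_y' by (auto simp: spike_free_def)

lemma nint_dist_orbit_pos: "0 < orbit_dist \<alpha> y k" "0 < nint_dist (y + real k * \<alpha> + \<beta>)"
  using avoids_zero_pos[OF avoids(1), of k] avoids_zero_pos[OF avoids(2), of k]
  by (simp_all add: algebra_simps)

lemma n_div_a: "(\<lambda>n. real n / a n) \<longlonglongrightarrow> 0"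
  using tendsto_inverse_0_at_top[OF orbit_sum_div] by simp

lemmas a_at_top = filterlim_at_top_of_div[OF orbit_sum_div]

lemma a_pos: "\<forall>\<^sub>F n in sequentially. 0 < a n"
  using a_at_top unfolding filterlim_at_top_dense by blast

lemma spike_tendsto_0:
  assumes "spike_free \<alpha> z"
  shows "(\<lambda>n. (1 / orbit_dist \<alpha> z n) / orbit_sum \<alpha> (Suc n) z) \<longlonglongrightarrow> 0"
proof (rule tendstoI)
  fix e :: real assume "0 < e"
  then have e2: "0 < e / 2" by simp
  obtain n0 where n0: "\<And>n k. n0 \<le> n \<Longrightarrow> k < n \<Longrightarrow> 1 / orbit_dist \<alpha> z k \<le> e / 2 * orbit_sum \<alpha> n z"
    using assms e2 unfolding spike_free_def by meson
  show "\<forall>\<^sub>F n in sequentially. dist ((1 / orbit_dist \<alpha> z n) / orbit_sum \<alpha> (Suc n) z) 0 < e"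
  proof (rule eventually_sequentiallyI[of n0])
    fix n assume "n0 \<le> n"
    then have le: "1 / orbit_dist \<alpha> z n \<le> e / 2 * orbit_sum \<alpha> (Suc n) z" by (intro n0) auto
    have "(1 / orbit_dist \<alpha> z n) / orbit_sum \<alpha> (Suc n) z \<le> e / 2"
    proof (cases "orbit_sum \<alpha> (Suc n) z = 0")
      case False
      then have "0 < orbit_sum \<alpha> (Suc n) z" using orbit_sum_nonneg[of \<alpha> "Suc n" z] by linarith
      then show ?thesis using le by (simp only: divide_le_eq if_True)
    qed (use e2 in simp)
    then show "dist ((1 / orbit_dist \<alpha> z n) / orbit_sum \<alpha> (Suc n) z) 0 < e"
      using \<open>0 < e\<close> by (simp add: dist_real_def)
  qed
qed

definition limit_sum :: "(torus \<Rightarrow> real) \<Rightarrow> real" where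
  "limit_sum F = F p * weight p + F q * weight q"

text \<open>Both stops can be measured in units of \<open>a n\<close> because
  \<open>b n / a n\<close> tends to 1, and the bounded error per lap disappears because
  \<open>n / a n\<close> tends to 0.\<close>

lemma sum_roof_tendsto:
  assumes F: "continuous_on UNIV F"
  shows "(\<lambda>n. (\<Sum>k<n. roof F (y + real k * \<alpha>)) / a n) \<longlonglongrightarrow> limit_sum F"
proof -
  let ?S = "\<lambda>n. \<Sum>k<n. roof F (y + real k * \<alpha>)"
  let ?P = "F p * weight p" and ?Q = "F q * weight q"
  have "(\<lambda>n. (?S n - (?P * a n + ?Q * b n)) / a n) \<longlonglongrightarrow> 0"
  proof (rule tendstoI)
    fix e :: real assume e: "0 < e"
    then have e4: "0 < e / 4" by simp
    obtain M where M: "0 \<le> M" "\<And>y. nint_dist y \<noteq> 0 \<Longrightarrow> nint_dist (y + \<beta>) \<noteq> 0 \<Longrightarrow>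
      \<bar>roof F y - (?P / nint_dist y + ?Q / nint_dist (y + \<beta>))\<bar>
        \<le> e / 4 * (1 / nint_dist y + 1 / nint_dist (y + \<beta>)) + M"
      using roof_approx[OF F e4] by blast
    have bound: "\<bar>?S n - (?P * a n + ?Q * b n)\<bar> \<le> e / 4 * (a n + b n) + M * real n" for n
    proof -
      have ba: "b n = (\<Sum>k<n. 1 / nint_dist (y + real k * \<alpha> + \<beta>))"
        unfolding orbit_sum_def by (intro sum.cong refl) (simp add: algebra_simps)
      have eq: "?S n - (?P * a n + ?Q * b n) =
          (\<Sum>k<n. roof F (y + real k * \<alpha>) - (?P / orbit_dist \<alpha> y k + ?Q / nint_dist (y + real k * \<alpha> + \<beta>)))"
        unfolding ba by (simp add: sum_subtractf sum.distrib orbit_sum_def sum_distrib_left)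
      have "\<bar>?S n - (?P * a n + ?Q * b n)\<bar> \<le> (\<Sum>k<n. \<bar>roof F (y + real k * \<alpha>) - (?P / orbit_dist \<alpha> y k + ?Q / nint_dist (y + real k * \<alpha> + \<beta>))\<bar>)"
        unfolding eq by (rule sum_abs)
      also have "\<dots> \<le> (\<Sum>k<n. e / 4 * (1 / orbit_dist \<alpha> y k + 1 / nint_dist (y + real k * \<alpha> + \<beta>)) + M)"
      proof (rule sum_mono)
        fix k
        show "\<bar>roof F (y + real k * \<alpha>) - (?P / orbit_dist \<alpha> y k + ?Q / nint_dist (y + real k * \<alpha> + \<beta>))\<bar>
          \<le> e / 4 * (1 / orbit_dist \<alpha> y k + 1 / nint_dist (y + real k * \<alpha> + \<beta>)) + M"
          by (rule M(2)) (use nint_dist_orbit_pos[of k] in auto)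
      qed
      also have "\<dots> = e / 4 * (a n + b n) + M * real n"
        unfolding ba by (simp add: sum.distrib orbit_sum_def sum_distrib_left distrib_left)
      finally show ?thesis .
    qed
    have "(\<lambda>n. M * (real n / a n)) \<longlonglongrightarrow> M * 0" by (intro tendsto_mult tendsto_const n_div_a)
    then have "\<forall>\<^sub>F n in sequentially. M * (real n / a n) < e / 4"
      using e by (intro order_tendstoD(2)[where y = "M * 0"]) auto
    moreover have "\<forall>\<^sub>F n in sequentially. b n / a n < 2"
      using ratio by (rule order_tendstoD(2)) simp
    ultimately show "\<forall>\<^sub>F n in sequentially. dist ((?S n - (?P * a n + ?Q * b n)) / a n) 0 < e"
      using a_pos
    proof eventually_elim
      case (elim n)
      have 1: "\<bar>(?S n - (?P * a n + ?Q * b n)) / a n\<bar> \<le> (e / 4 * (a n + b n) + M * real n) / a n"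
        using bound[of n] elim(3) by (simp add: abs_divide divide_right_mono)
      have 2: "(e / 4 * (a n + b n) + M * real n) / a n = e / 4 * (1 + b n / a n) + M * (real n / a n)"
        using elim(3) by (simp add: field_simps)
      have "e / 4 * (1 + b n / a n) < e / 4 * 3"
        using elim(2) e by (intro mult_strict_left_mono) auto
      with 1 2 elim(1) have "\<bar>(?S n - (?P * a n + ?Q * b n)) / a n\<bar> < e" by linarith
      then show ?case by (simp only: dist_real_def diff_zero)
    qed
  qed
  moreover have "(\<lambda>n. ?P + ?Q * (b n / a n)) \<longlonglongrightarrow> ?P + ?Q * 1"
    by (intro tendsto_intros ratio)
  ultimately have "(\<lambda>n. (?S n - (?P * a n + ?Q * b n)) / a n + (?P + ?Q * (b n / a n))) \<longlonglongrightarrow> 0 + (?P + ?Q * 1)"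
    by (rule tendsto_add)
  moreover have "\<forall>\<^sub>F n in sequentially. (?S n - (?P * a n + ?Q * b n)) / a n + (?P + ?Q * (b n / a n)) = ?S n / a n"
    using a_pos by eventually_elim (simp add: field_simps)
  ultimately show ?thesis by (simp add: limit_sum_def Lim_transform_eventually)
qed

lemma roof_one_nonneg: "0 \<le> roof (\<lambda>_. 1) z"
proof (cases "(\<lambda>s. 1 / \<psi> (pt s z)) integrable_on {-1/2..1/2}")
  case True
  then show ?thesis unfolding roof_def by (rule integral_nonneg) (simp add: \<psi>_nonneg)
qed (simp add: roof_def not_integrable_integral)

text \<open>A lap is dominated by one term from each of the two orbit sums, so absence of spikes at
  both base points makes it negligible. This allows stopping in the middle of a lap.\<close>

lemma last_roof_tendsto: "(\<lambda>n. roof (\<lambda>_. 1) (y + real n * \<alpha>) / a (Suc n)) \<longlonglongrightarrow> 0"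
proof -
  obtain M where M: "0 \<le> M" "\<And>y. nint_dist y \<noteq> 0 \<Longrightarrow> nint_dist (y + \<beta>) \<noteq> 0 \<Longrightarrow>
      \<bar>roof (\<lambda>_. 1) y - (1 * weight p / nint_dist y + 1 * weight q / nint_dist (y + \<beta>))\<bar>
        \<le> 1 * (1 / nint_dist y + 1 / nint_dist (y + \<beta>)) + M"
    using roof_approx[of "\<lambda>_. 1" 1] by auto
  define s where "s n = 1 / orbit_dist \<alpha> y n" for n
  define s' where "s' n = 1 / orbit_dist \<alpha> (y + \<beta>) n" for n
  let ?h = "\<lambda>n. (weight p + 1) * (s n / a (Suc n)) + (weight q + 1) * (s' n / b (Suc n)) * (b (Suc n) / a (Suc n)) + M * (1 / a (Suc n))"
  have "?h \<longlonglongrightarrow> (weight p + 1) * 0 + (weight q + 1) * 0 * 1 + M * 0"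
  proof (intro tendsto_add tendsto_mult tendsto_const)
    show "(\<lambda>n. s n / a (Suc n)) \<longlonglongrightarrow> 0" unfolding s_def by (rule spike_tendsto_0[OF spike_y])
    show "(\<lambda>n. s' n / b (Suc n)) \<longlonglongrightarrow> 0" unfolding s'_def by (rule spike_tendsto_0[OF spike_y'])
    show "(\<lambda>n. b (Suc n) / a (Suc n)) \<longlonglongrightarrow> 1" using ratio by (rule LIMSEQ_Suc)
    show "(\<lambda>n. 1 / a (Suc n)) \<longlonglongrightarrow> 0"
      using LIMSEQ_Suc[OF tendsto_inverse_0_at_top[OF a_at_top]] by (simp add: divide_inverse)
  qed
  then have lim: "?h \<longlonglongrightarrow> 0" by simp
  show ?thesis
  proof (rule tendsto_sandwich[OF _ _ tendsto_const lim])
    show "\<forall>\<^sub>F n in sequentially. 0 \<le> roof (\<lambda>_. 1) (y + real n * \<alpha>) / a (Suc n)"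
      by (intro always_eventually allI divide_nonneg_nonneg roof_one_nonneg orbit_sum_nonneg)
    show "\<forall>\<^sub>F n in sequentially. roof (\<lambda>_. 1) (y + real n * \<alpha>) / a (Suc n) \<le>
      ?h n"
    proof (intro always_eventually allI)
      fix n
      have ss: "s' n = 1 / nint_dist (y + real n * \<alpha> + \<beta>)" by (simp add: s'_def algebra_simps)
      have a0: "0 < a (Suc n)" and b0: "0 < b (Suc n)"
        unfolding orbit_sum_def using avoids_zero_pos[OF avoids(1)] avoids_zero_pos[OF avoids(2)]
        by (auto intro!: sum_pos simp del: sum.lessThan_Suc)
      have "roof (\<lambda>_. 1) (y + real n * \<alpha>) \<le> (weight p + 1) * s n + (weight q + 1) * s' n + M"
        using M(2)[of "y + real n * \<alpha>"] nint_dist_orbit_pos[of n] unfolding ss s_def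
        by (simp add: abs_le_iff distrib_right add_divide_distrib)
      then have "roof (\<lambda>_. 1) (y + real n * \<alpha>) / a (Suc n) \<le> ((weight p + 1) * s n + (weight q + 1) * s' n + M) / a (Suc n)"
        using a0 by (intro divide_right_mono) auto
      also have "\<dots> = ?h n"
        using b0 by (simp add: add_divide_distrib)
      finally show "roof (\<lambda>_. 1) (y + real n * \<alpha>) / a (Suc n) \<le>
      ?h n" .
    qed
  qed
qed

section \<open>Integrals along the linear orbit and the change of time\<close>

definition line_integrand :: "(torus \<Rightarrow> real) \<Rightarrow> real \<Rightarrow> real" where
  "line_integrand F u = F (pt u y) / \<psi> (pt u y)"

text \<open>Starting at \<open>-1/2\<close> makes the integral up to \<open>n - 1/2\<close> a sum of
  exactly \<open>n\<close> laps.\<close>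

definition line_integral :: "(torus \<Rightarrow> real) \<Rightarrow> real \<Rightarrow> real" where
  "line_integral F T = integral {-1/2..T} (line_integrand F)"

lemma \<psi>_line_pos:
  assumes "-1/2 \<le> u"
  shows "0 < \<psi> (pt u y)"
proof (rule \<psi>_pos)
  have nat: "\<exists>k::nat. u = real k" if u: "u \<in> \<int>"
  proof -
    obtain m where m: "u = of_int m" using u by (rule Ints_cases)
    then have "0 \<le> m" using assms by linarith
    then show ?thesis using m by (metis of_int_of_nat_eq zero_le_imp_eq_int)
  qed
  show "pt u y \<noteq> p"
    unfolding to_torus_section_p using nat avoids(1) by (auto simp: avoids_zero_def add.commute)
  show "pt u y \<noteq> q"
    unfolding to_torus_section_q using nat avoids(2) by (auto simp: avoids_zero_def algebra_simps)
qed

lemma continuous_line_integrand: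
  assumes "continuous_on UNIV F"
  shows "continuous_on {-1/2..T} (line_integrand F)"
  unfolding line_integrand_def by (intro continuous_on_section_integrand assms \<psi>_line_pos) simp

text \<open>On the torus, moving the first coordinate by \<open>k\<close> is the same as raising the
  base point by \<open>k * \<alpha>\<close>.\<close>

lemma integral_line_integrand_period:
  "integral {real k - 1/2..real k + 1/2} (line_integrand F) = roof F (y + real k * \<alpha>)"
proof -
  have eq: "line_integrand F (s + real k) =
      F (pt s (y + real k * \<alpha>)) / \<psi> (pt s (y + real k * \<alpha>))" for s
  proof -
    have "pt (s + real k) y = pt s (y + real k * \<alpha>)"
      by (simp add: to_torus_eq_iff_2 algebra_simps)
    then show ?thesis by (simp add: line_integrand_def)
  qed
  show ?thesis
    using integral_shift_real_ivl[of "real k - 1/2" "real k" "real k + 1/2" "line_integrand F"]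
    by (simp add: eq roof_def)
qed

lemma line_integral_split:
  assumes F: "continuous_on UNIV F" and "-1/2 \<le> S" "S \<le> T"
  shows "line_integral F T = line_integral F S + integral {S..T} (line_integrand F)"
  unfolding line_integral_def
  by (rule Henstock_Kurzweil_Integration.integral_combine[OF assms(2,3) integrable_continuous_interval[OF continuous_line_integrand[OF F]], symmetric])

lemma line_integral_half_integer:
  assumes F: "continuous_on UNIV F"
  shows "line_integral F (real n - 1/2) = (\<Sum>k<n. roof F (y + real k * \<alpha>))"
proof (induction n)
  case (Suc n)
  have "line_integral F (real (Suc n) - 1/2) = line_integral F (real n - 1/2) + integral {real n - 1/2..real (Suc n) - 1/2} (line_integrand F)"
    by (rule line_integral_split[OF F]) auto
  then show ?case using Suc integral_line_integrand_period[of n F] by (simp add: algebra_simps)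
qed (simp add: line_integral_def)

definition lap :: "real \<Rightarrow> nat" where
  "lap T = nat \<lfloor>T + 1/2\<rfloor>"

lemma filterlim_lap: "filterlim lap at_top at_top"
  unfolding filterlim_at_top
proof
  fix Z :: nat
  show "\<forall>\<^sub>F T in at_top. Z \<le> lap T"
    using eventually_ge_at_top[of "real Z"] by eventually_elim (simp add: lap_def le_nat_iff le_floor_iff)
qed

text \<open>Completing the current lap changes the integral by at most \<open>B\<close> times the
  duration of that lap, which is negligible.\<close>

lemma line_integral_tendsto:
  assumes F: "continuous_on UNIV F"
  shows "((\<lambda>T. line_integral F T / a (Suc (lap T))) \<longlongrightarrow> limit_sum F) at_top"
proof -
  obtain B where B: "0 < B" "\<And>z. \<bar>F z\<bar> \<le> B" using torus_bounded[OF F] by blast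
  let ?S = "\<lambda>n. \<Sum>k<n. roof F (y + real k * \<alpha>)"
  let ?R = "\<lambda>n. roof (\<lambda>_. 1) (y + real n * \<alpha>)"
  have part: "\<bar>integral {S..T} (line_integrand F)\<bar> \<le> B * ?R n"
    if "real n - 1/2 \<le> S" "S \<le> T" "T \<le> real n + 1/2" for S T n
  proof -
    have sub: "{S..T} \<subseteq> {-1/2..real n + 1/2}" "{S..T} \<subseteq> {real n - 1/2..real n + 1/2}" "{real n - 1/2..real n + 1/2} \<subseteq> {-1/2..real n + 1/2}"
      using that by auto
    have c1: "continuous_on {-1/2..real n + 1/2} (line_integrand (\<lambda>_. 1))"
      by (intro continuous_line_integrand continuous_intros)
    have "norm (integral {S..T} (line_integrand F)) \<le> integral {S..T} (\<lambda>u. B * line_integrand (\<lambda>_. 1) u)"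
    proof (rule integral_norm_bound_integral)
      show "line_integrand F integrable_on {S..T}"
        by (intro integrable_continuous_interval continuous_on_subset[OF continuous_line_integrand[OF F] sub(1)])
      show "(\<lambda>u. B * line_integrand (\<lambda>_. 1) u) integrable_on {S..T}"
        by (intro integrable_continuous_interval continuous_intros continuous_on_subset[OF c1 sub(1)])
      fix u assume "u \<in> {S..T}"
      show "norm (line_integrand F u) \<le> B * line_integrand (\<lambda>_. 1) u"
        using B(2) \<psi>_nonneg by (simp add: line_integrand_def abs_divide divide_right_mono)
    qed
    also have "\<dots> \<le> integral {real n - 1/2..real n + 1/2} (\<lambda>u. B * line_integrand (\<lambda>_. 1) u)"
      using B \<psi>_nonneg
      by (intro integral_subset_le sub integrable_continuous_interval continuous_intros continuous_on_subset[OF c1 sub(1)]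
          continuous_on_subset[OF c1 sub(3)]) (auto simp: line_integrand_def)
    also have "\<dots> = B * ?R n" using integral_line_integrand_period[of n "\<lambda>_. 1"] by simp
    finally show ?thesis by simp
  qed
  have bound: "\<bar>line_integral F T / a (Suc (lap T)) - ?S (Suc (lap T)) / a (Suc (lap T))\<bar> \<le> B * (?R (lap T) / a (Suc (lap T)))"
    if T: "0 \<le> T" for T
  proof -
    define n where "n = lap T"
    have n: "real n - 1/2 \<le> T" "T \<le> real n + 1/2"
      using T unfolding n_def lap_def by linarith+
    have "?S (Suc n) = line_integral F (real (Suc n) - 1/2)" by (rule line_integral_half_integer[OF F, symmetric])
    also have "\<dots> = line_integral F T + integral {T..real (Suc n) - 1/2} (line_integrand F)"
      using n T by (intro line_integral_split[OF F]) auto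
    finally have "line_integral F T - ?S (Suc n) = - integral {T..real n + 1/2} (line_integrand F)"
      by (simp add: algebra_simps)
    then have "\<bar>line_integral F T - ?S (Suc n)\<bar> \<le> B * ?R n" using part[of n T "real n + 1/2"] n by simp
    then have "\<bar>line_integral F T - ?S (Suc n)\<bar> / a (Suc n) \<le> B * ?R n / a (Suc n)"
      by (intro divide_right_mono orbit_sum_nonneg)
    then show ?thesis unfolding n_def by (simp add: abs_divide flip: diff_divide_distrib)
  qed
  have lapS: "filterlim (\<lambda>T. Suc (lap T)) at_top at_top"
    by (rule filterlim_compose[OF filterlim_Suc filterlim_lap])
  have 1: "((\<lambda>T. ?S (Suc (lap T)) / a (Suc (lap T))) \<longlongrightarrow> limit_sum F) at_top"
    by (rule filterlim_compose[OF sum_roof_tendsto[OF F] lapS])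
  have "((\<lambda>T. B * (?R (lap T) / a (Suc (lap T)))) \<longlongrightarrow> B * 0) at_top"
    by (intro tendsto_mult tendsto_const filterlim_compose[OF last_roof_tendsto filterlim_lap])
  then have "((\<lambda>T. B * (?R (lap T) / a (Suc (lap T)))) \<longlongrightarrow> 0) at_top" by simp
  moreover have "\<forall>\<^sub>F T in at_top. norm (line_integral F T / a (Suc (lap T)) - ?S (Suc (lap T)) / a (Suc (lap T))) \<le> B * (?R (lap T) / a (Suc (lap T)))"
    using eventually_ge_at_top[of 0] by eventually_elim (simp only: real_norm_def bound)
  ultimately have "((\<lambda>T. line_integral F T / a (Suc (lap T)) - ?S (Suc (lap T)) / a (Suc (lap T))) \<longlongrightarrow> 0) at_top"
    by (rule Lim_null_comparison[rotated])
  from tendsto_add[OF this 1] show ?thesis by (simp only: diff_add_cancel add_0)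
qed

lemma limit_sum_one_pos: "0 < limit_sum (\<lambda>_. 1)"
  using weight_pos[OF pd_p] weight_pos[OF pd_q] by (simp add: limit_sum_def)

text \<open>The constants \<open>c\<close> and \<open>d\<close> stand for the part of the orbit
  before its starting point; they vanish against the diverging \<open>a n\<close>.\<close>

lemma line_integral_ratio_tendsto:
  assumes F: "continuous_on UNIV F"
  shows "((\<lambda>T. (line_integral F T - c) / (line_integral (\<lambda>_. 1) T - d)) \<longlongrightarrow> limit_sum F / limit_sum (\<lambda>_. 1)) at_top"
proof -
  have lapS: "filterlim (\<lambda>T. Suc (lap T)) at_top at_top"
    by (rule filterlim_compose[OF filterlim_Suc filterlim_lap])
  have aS: "filterlim (\<lambda>T. a (Suc (lap T))) at_top at_top"
    by (rule filterlim_compose[OF a_at_top lapS])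
  have shift: "((\<lambda>T. (line_integral G T - k) / a (Suc (lap T))) \<longlongrightarrow> limit_sum G) at_top"
    if G: "continuous_on UNIV G" for G k
  proof -
    have "((\<lambda>T. line_integral G T / a (Suc (lap T)) - k * inverse (a (Suc (lap T)))) \<longlongrightarrow> limit_sum G - k * 0) at_top"
      by (intro tendsto_diff tendsto_mult tendsto_const line_integral_tendsto G tendsto_inverse_0_at_top aS)
    then show ?thesis by (simp add: left_diff_distrib divide_inverse)
  qed
  have "((\<lambda>T. ((line_integral F T - c) / a (Suc (lap T))) / ((line_integral (\<lambda>_. 1) T - d) / a (Suc (lap T))))
      \<longlongrightarrow> limit_sum F / limit_sum (\<lambda>_. 1)) at_top"
    using limit_sum_one_pos by (intro tendsto_divide shift F continuous_intros) auto
  moreover have "\<forall>\<^sub>F T in at_top. ((line_integral F T - c) / a (Suc (lap T))) / ((line_integral (\<lambda>_. 1) T - d) / a (Suc (lap T)))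
      = (line_integral F T - c) / (line_integral (\<lambda>_. 1) T - d)"
  proof -
    have "\<forall>\<^sub>F T in at_top. 0 < a (Suc (lap T))"
      using aS unfolding filterlim_at_top_dense by blast
    then show ?thesis by eventually_elim simp
  qed
  ultimately show ?thesis by (rule Lim_transform_eventually)
qed

lemma limit_ratio_eq:
  assumes F: "continuous_on UNIV F"
  shows "limit_sum F / limit_sum (\<lambda>_. 1) = integral\<^sup>L (mu_infinity \<psi> p q) F"
proof -
  define dp dq where "dp = sqrt (det (torus_hessian \<psi> p))" and "dq = sqrt (det (torus_hessian \<psi> q))"
  have pos: "0 < det (torus_hessian \<psi> p)" "0 < det (torus_hessian \<psi> q)"
    using stop_kernel_form[OF pd_p] stop_kernel_form[OF pd_q] by auto
  then have d: "0 < dp" "0 < dq" by (auto simp: dp_def dq_def)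
  have "limit_sum F / limit_sum (\<lambda>_. 1) = (F p * (2 * pi / dp) + F q * (2 * pi / dq)) / (2 * pi / dp + 2 * pi / dq)"
    by (simp add: limit_sum_def weight_def dp_def dq_def)
  also have "\<dots> = (2 * pi * (F p * dq + F q * dp) / (dp * dq)) / (2 * pi * (dp + dq) / (dp * dq))"
    using d by (simp add: field_simps)
  also have "\<dots> = (F p * dq + F q * dp) / (dp + dq)" using d by simp
  also have "\<dots> = dq / (dp + dq) * F p + dp / (dp + dq) * F q"
    by (simp add: add_divide_distrib mult.commute)
  also have "\<dots> = integral\<^sup>L (mu_infinity \<psi> p q) F"
    unfolding dp_def dq_def using pos
    by (intro integral_mu_infinity[OF p_neq_q F refl refl, symmetric]) auto
  finally show ?thesis .
qed

lemma line_integral_has_derivative: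
  assumes F: "continuous_on UNIV F" and u: "-1/2 < u"
  shows "(line_integral F has_real_derivative line_integrand F u) (at u)"
proof -
  have "(line_integral F has_real_derivative line_integrand F u) (at u within {-1/2..u+1})"
    unfolding line_integral_def
    by (rule integral_has_real_derivative[OF continuous_line_integrand[OF F]]) (use u in auto)
  then show ?thesis using u by (simp add: at_within_Icc_at)
qed

text \<open>With \<open>u\<close> the first coordinate of the orbit, \<open>u' = \<psi>\<close>;
  hence \<open>line_integral F (u t)\<close> has derivative \<open>F / \<psi> * \<psi> = F\<close>
  along the orbit, and a time average becomes a quotient of two line integrals.\<close>

lemma weak_star_limit_orbit:
  fixes x :: "real^2"
  assumes flow: "flow_generated_by (\<lambda>z. \<psi> z *\<^sub>R vector [1, \<alpha>]) \<phi>"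
    and x: "0 \<le> x $ 1" "y = x $ 2 - \<alpha> * x $ 1"
  shows "weak_star_limit (\<lambda>t. empirical_measure \<phi> t (to_torus x)) (mu_infinity \<psi> p q)"
  unfolding weak_star_limit_def
proof (intro allI impI)
  fix F :: "torus \<Rightarrow> real" assume F: "continuous_on UNIV F"
  obtain c :: "real \<Rightarrow> real^2" where c0: "c 0 = x"
    and c': "\<And>t. (c has_vector_derivative \<psi> (to_torus (c t)) *\<^sub>R vector [1, \<alpha>]) (at t)"
    and \<phi>: "\<And>t. \<phi> t (to_torus x) = to_torus (c t)"
    using flow unfolding flow_generated_by_def by blast
  define u where "u t = c t $ 1" for t
  have comp: "((\<lambda>t. c t $ i) has_real_derivative \<psi> (to_torus (c t)) * (vector [1, \<alpha>] :: real^2) $ i) (at t)" for i t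
    using bounded_linear.has_vector_derivative[OF bounded_linear_vec_nth c'[of t], of i]
    by (simp add: has_real_derivative_iff_has_vector_derivative)
  have u': "(u has_real_derivative \<psi> (to_torus (c t))) (at t)" for t
    using comp[of 1 t] by (simp add: u_def[abs_def])
  \<comment> \<open>The velocity is always parallel to \<open>(1, \<alpha>)\<close>, so the orbit
    stays on one line.\<close>
  have "((\<lambda>t. c t $ 2 - \<alpha> * u t) has_real_derivative 0) (at t)" for t
    using DERIV_diff[OF comp[of 2 t] DERIV_cmult[OF u'[of t], of \<alpha>]] by (simp add: mult.commute)
  then have const: "c t $ 2 - \<alpha> * u t = y" for t
    using DERIV_isconst_all[of "\<lambda>t. c t $ 2 - \<alpha> * u t" t 0] c0 x(2) by (simp add: u_def)
  have c_eq: "c t = section_point \<alpha> (u t) y" for t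
    using const[of t] by (simp add: vec_eq_iff forall_2 u_def algebra_simps)
  have mono: "u s \<le> u t" if "s \<le> t" for s t
    using that by (rule DERIV_nonneg_imp_nondecreasing) (use u' \<psi>_nonneg in blast)
  have u0: "u 0 = x $ 1" by (simp add: u_def c0)
  have u_ge: "0 \<le> u t" if "0 \<le> t" for t using mono[OF that] u0 x(1) by simp
  have change: "integral {0..t} (\<lambda>s. G (to_torus (c s))) = line_integral G (u t) - line_integral G (x $ 1)"
    if G: "continuous_on UNIV G" and t: "0 \<le> t" for G t
  proof -
    have "((\<lambda>s. line_integral G (u s)) has_real_derivative G (to_torus (c s))) (at s)" if "0 \<le> s" for s
    proof -
      have "-1/2 < u s" using u_ge[OF that] by simp
      from DERIV_chain2[OF line_integral_has_derivative[OF G this] u'[of s]]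
      show ?thesis using \<psi>_line_pos[of "u s"] \<open>-1/2 < u s\<close>
        by (simp add: line_integrand_def c_eq)
    qed
    then have "((\<lambda>s. G (to_torus (c s))) has_integral (line_integral G (u t) - line_integral G (u 0))) {0..t}"
      using t by (intro fundamental_theorem_of_calculus)
        (auto simp: has_real_derivative_iff_has_vector_derivative[symmetric] intro: has_field_derivative_at_within)
    then show ?thesis by (simp add: integral_unique u0)
  qed
  have time: "t = line_integral (\<lambda>_. 1) (u t) - line_integral (\<lambda>_. 1) (x $ 1)" if "0 \<le> t" for t
    using change[of "\<lambda>_. 1" t] that by simp
  \<comment> \<open>The elapsed time is the line integral of 1 up to \<open>u t\<close>, which is
    finite for every bounded \<open>u\<close>; unbounded time therefore requires unbounded
    \<open>u\<close>.\<close>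
  have u_top: "filterlim u at_top at_top"
    unfolding filterlim_at_top
  proof
    fix Z :: real
    define t0 where "t0 = max 0 (line_integral (\<lambda>_. 1) (max Z 0) - line_integral (\<lambda>_. 1) (x $ 1) + 1)"
    show "\<forall>\<^sub>F t in at_top. Z \<le> u t"
      using eventually_ge_at_top[of t0]
    proof eventually_elim
      case (elim t)
      show ?case
      proof (rule ccontr)
        assume "\<not> Z \<le> u t"
        have t: "0 \<le> t" using elim by (simp add: t0_def)
        have "line_integral (\<lambda>_. 1) (max Z 0) = line_integral (\<lambda>_. 1) (u t) + integral {u t..max Z 0} (line_integrand (\<lambda>_. 1))"
          using u_ge[OF t] \<open>\<not> Z \<le> u t\<close> by (intro line_integral_split continuous_intros) auto
        moreover have "0 \<le> integral {u t..max Z 0} (line_integrand (\<lambda>_. 1))"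
          using u_ge[OF t] \<psi>_nonneg
          by (intro integral_nonneg integrable_continuous_interval
            continuous_on_subset[OF continuous_line_integrand[of "\<lambda>_. 1" "max Z 0"]] continuous_intros)
            (auto simp: line_integrand_def)
        ultimately show False using time[OF t] elim by (simp add: t0_def)
      qed
    qed
  qed
  have "((\<lambda>t. (line_integral F (u t) - line_integral F (x $ 1)) / (line_integral (\<lambda>_. 1) (u t) - line_integral (\<lambda>_. 1) (x $ 1)))
      \<longlongrightarrow> integral\<^sup>L (mu_infinity \<psi> p q) F) at_top"
    using filterlim_compose[OF line_integral_ratio_tendsto[OF F] u_top] limit_ratio_eq[OF F] by simp
  moreover have "\<forall>\<^sub>F t in at_top. (line_integral F (u t) - line_integral F (x $ 1)) / (line_integral (\<lambda>_. 1) (u t) - line_integral (\<lambda>_. 1) (x $ 1))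
      = integral\<^sup>L (empirical_measure \<phi> t (to_torus x)) F"
    using eventually_gt_at_top[of 0]
  proof eventually_elim
    case (elim t)
    have "continuous_on UNIV (\<lambda>s. F (\<phi> s (to_torus x)))"
      by (rule continuous_on_compose2[OF F flow_continuous[OF flow]]) auto
    then have "set_integrable lborel {0..t} (\<lambda>s. F (\<phi> s (to_torus x)))"
      by (intro borel_integrable_atLeastAtMost') (rule continuous_on_subset[OF _ subset_UNIV])
    then have "(LINT s:{0..t}|lborel. F (\<phi> s (to_torus x))) = integral {0..t} (\<lambda>s. F (\<phi> s (to_torus x)))"
      by (rule set_borel_integral_eq_integral)
    also have "\<dots> = line_integral F (u t) - line_integral F (x $ 1)"
      using change[OF F, of t] elim by (simp add: \<phi>)
    finally show ?case
      using integral_empirical_measure[OF flow F elim] time[of t] elim by simp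
  qed
  ultimately show "((\<lambda>t. integral\<^sup>L (empirical_measure \<phi> t (to_torus x)) F) \<longlongrightarrow> integral\<^sup>L (mu_infinity \<psi> p q) F) at_top"
    by (rule Lim_transform_eventually)
qed

end

section \<open>Null sets of the torus\<close>

lemma AE_lborel_translate:
  fixes c :: real
  assumes "AE y in lborel. P y"
  shows "AE y in lborel. P (y + c)"
proof -
  have "AE y in distr lborel borel ((+) c). P y" unfolding lborel_distr_plus by (rule assms)
  then have "AE y in lborel. P (c + y)" by (rule AE_distrD[rotated]) simp
  then show ?thesis by (simp add: add.commute)
qed

text \<open>Presents the plane as a product of two lines so that Fubini applies; agreement on boxes
  determines Lebesgue measure.\<close>

lemma lborel_eq_distr_pair:
  "(lborel :: (real^2) measure) = distr (lborel \<Otimes>\<^sub>M lborel) borel (\<lambda>(a, b). vector [a, b])"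
proof (rule lborel_eqI)
  have cont: "continuous_on UNIV (\<lambda>(a::real, b::real). vector [a, b] :: real^2)"
  proof -
    have "(\<lambda>(a::real, b::real). vector [a, b] :: real^2) = (\<lambda>z. fst z *\<^sub>R vector [1, 0] + snd z *\<^sub>R vector [0, 1])"
      by (auto simp: vec_eq_iff forall_2)
    then show ?thesis by (simp only:) (intro continuous_intros)
  qed
  have meas: "(\<lambda>(a, b). vector [a, b] :: real^2) \<in> measurable (lborel \<Otimes>\<^sub>M lborel) borel"
    using borel_measurable_continuous_onI[OF cont] by (simp add: lborel_prod)
  fix l u :: "real^2" assume le: "\<And>b. b \<in> Basis \<Longrightarrow> l \<bullet> b \<le> u \<bullet> b"
  then have le': "l $ i \<le> u $ i" for i using le[of "axis i 1"] by (simp add: inner_axis axis_in_Basis_iff)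
  have "(\<lambda>(a, b). vector [a, b]) -` box l u \<inter> space (lborel \<Otimes>\<^sub>M lborel) = {l$1<..<u$1} \<times> {l$2<..<u$2}"
    by (auto simp: mem_box_cart forall_2 space_pair_measure)
  then have "emeasure (distr (lborel \<Otimes>\<^sub>M lborel) borel (\<lambda>(a, b). vector [a, b])) (box l u) =
      emeasure (lborel \<Otimes>\<^sub>M lborel) ({l$1<..<u$1} \<times> {l$2<..<u$2})"
    by (simp add: emeasure_distr[OF meas])
  also have "\<dots> = ennreal (u$1 - l$1) * ennreal (u$2 - l$2)"
    using le' by (subst lborel.emeasure_pair_measure_Times) auto
  also have "\<dots> = ennreal (\<Prod>i\<in>UNIV. u$i - l$i)"
    using le' by (simp add: UNIV_2 ennreal_mult)
  also have "(\<Prod>i\<in>UNIV. u$i - l$i) = measure lborel (cbox l u)"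
    using le' by (subst content_cbox_cart) (auto simp: interval_ne_empty_cart)
  also have "\<dots> = (\<Prod>b\<in>Basis. (u - l) \<bullet> b)"
    using le by (simp add: content_cbox)
  finally show "emeasure (distr (lborel \<Otimes>\<^sub>M lborel) borel (\<lambda>(a, b). vector [a, b])) (box l u) = (\<Prod>b\<in>Basis. (u - l) \<bullet> b)" .
qed simp

text \<open>For fixed first coordinate the map is a translation of the second one, which preserves
  null sets; Fubini does the rest.\<close>

lemma AE_lborel_section:
  assumes "AE y in lborel. P y"
  shows "AE x in (lborel :: (real^2) measure). P (x $ 2 - \<alpha> * x $ 1)"
proof -
  obtain N where N: "N \<in> null_sets lborel" "{y. \<not> P y} \<subseteq> N"
    using assms unfolding eventually_ae_filter by auto
  have Nb: "N \<in> sets borel" using N(1) by (simp add: null_sets_def)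
  have "AE z in lborel \<Otimes>\<^sub>M lborel. snd z - \<alpha> * fst z \<notin> N"
  proof (rule lborel_pair.AE_pair_measure)
    have "(\<lambda>z. snd z - \<alpha> * fst z :: real) \<in> borel_measurable (lborel \<Otimes>\<^sub>M lborel)" by measurable
    from measurable_sets[OF this, of "- N"] Nb
    show "{z \<in> space (lborel \<Otimes>\<^sub>M lborel). snd z - \<alpha> * fst z \<notin> N} \<in> sets (lborel \<Otimes>\<^sub>M lborel)"
      by (simp add: vimage_def Int_def conj_commute)
    have "AE b in lborel. b + (- \<alpha> * a) \<notin> N" for a
      by (rule AE_lborel_translate) (rule AE_not_in[OF N(1)])
    then show "AE a in lborel. AE b in lborel. snd (a, b) - \<alpha> * fst (a, b) \<notin> N" by simp
  qed
  then have "AE x in distr (lborel \<Otimes>\<^sub>M lborel) borel (\<lambda>(a, b). vector [a, b] :: real^2). x $ 2 - \<alpha> * x $ 1 \<notin> N"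
  proof (subst AE_distr_iff)
    show "(\<lambda>(a, b). vector [a, b] :: real^2) \<in> measurable (lborel \<Otimes>\<^sub>M lborel) borel"
    proof -
      have "(\<lambda>(a::real, b::real). vector [a, b] :: real^2) = (\<lambda>z. fst z *\<^sub>R vector [1, 0] + snd z *\<^sub>R vector [0, 1])"
        by (auto simp: vec_eq_iff forall_2)
      then show ?thesis by simp
    qed
    have "(\<lambda>x::real^2. x $ 2 - \<alpha> * x $ 1) \<in> borel_measurable borel"
      by (intro borel_measurable_continuous_onI continuous_intros)
    from measurable_sets[OF this, of "- N"] Nb
    show "{x \<in> space borel. x $ 2 - \<alpha> * x $ 1 \<notin> N} \<in> sets (borel :: (real^2) measure)"
      by (simp add: vimage_def)
  qed (auto elim!: eventually_mono)
  then have "AE x in (lborel :: (real^2) measure). x $ 2 - \<alpha> * x $ 1 \<notin> N"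
    by (simp only: lborel_eq_distr_pair[symmetric])
  then show ?thesis by eventually_elim (use N(2) in auto)
qed

section \<open>Borel sets and null sets under the projection to the quotient\<close>

definition open_square :: "(real^2) set" where
  "open_square = {x. \<forall>i. 0 < x $ i \<and> x $ i < 1}"

lemma open_open_square: "open open_square"
proof -
  have eq: "open_square = box 0 1" by (auto simp: open_square_def mem_box_cart)
  show ?thesis unfolding eq by (rule open_box)
qed

lemma inj_on_open_square: "inj_on to_torus open_square"
proof (rule inj_onI)
  fix x y assume xy: "x \<in> open_square" "y \<in> open_square" "to_torus x = to_torus y"
  have "x $ i = y $ i" for i
  proof -
    obtain n where n: "x $ i - y $ i = of_int n" using xy(3) by (auto simp: to_torus_eq_iff elim!: Ints_cases)
    moreover have "0 < x $ i" "x $ i < 1" "0 < y $ i" "y $ i < 1" using xy by (auto simp: open_square_def)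
    ultimately have "n = 0" by linarith
    then show ?thesis using n by simp
  qed
  then show "x = y" by (simp add: vec_eq_iff)
qed

lemma open_to_torus_image:
  assumes "open U"
  shows "open (to_torus ` U)"
proof -
  have "to_torus -` (to_torus ` U) = (\<Union>m\<in>{m. \<forall>i. m $ i \<in> \<int>}. (+) m ` U)"
  proof (intro equalityI subsetI)
    fix x assume "x \<in> to_torus -` (to_torus ` U)"
    then obtain z where z: "z \<in> U" "to_torus x = to_torus z" by auto
    then have "x - z \<in> {m. \<forall>i. m $ i \<in> \<int>}" by (simp add: to_torus_eq_iff)
    moreover have "x = (x - z) + z" by simp
    ultimately show "x \<in> (\<Union>m\<in>{m. \<forall>i. m $ i \<in> \<int>}. (+) m ` U)" using z(1) by blast
  next
    fix x assume "x \<in> (\<Union>m\<in>{m. \<forall>i. m $ i \<in> \<int>}. (+) m ` U)"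
    then obtain m z where "\<forall>i. m $ i \<in> \<int>" "z \<in> U" "x = m + z" by auto
    then have "to_torus x = to_torus z" by (simp add: to_torus_eq_iff)
    then show "x \<in> to_torus -` (to_torus ` U)" using \<open>z \<in> U\<close> by simp
  qed
  moreover have "open (\<Union>m\<in>{m. \<forall>i. m $ i \<in> \<int>}. (+) m ` U)"
    using assms by (auto intro: open_translation)
  ultimately show ?thesis by (simp add: open_torus_def)
qed

text \<open>Induction over the generation of the Borel sets. Complements go through because the
  projection is injective on the open square, so images commute with differences.\<close>

lemma borel_to_torus_image:
  assumes "E \<in> sets borel"
  shows "to_torus ` (E \<inter> open_square) \<in> sets borel"
proof -
  have "E \<in> sigma_sets UNIV {S. open S}" using assms by (simp add: sets_borel)
  then show ?thesis
  proof (induction rule: sigma_sets.induct)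
    case (Basic S)
    then have "open (to_torus ` (S \<inter> open_square))"
      using open_open_square by (intro open_to_torus_image) auto
    then show ?case by (rule borel_open)
  next
    case (Compl S)
    have "to_torus ` ((UNIV - S) \<inter> open_square) = to_torus ` open_square - to_torus ` (S \<inter> open_square)"
      using inj_on_open_square by (auto simp: inj_on_def)
    moreover have "to_torus ` open_square \<in> sets borel"
      by (intro borel_open open_to_torus_image open_open_square)
    ultimately show ?case using Compl by simp
  next
    case (Union S)
    have "to_torus ` ((\<Union>i. S i) \<inter> open_square) = (\<Union>i. to_torus ` (S i \<inter> open_square))" by auto
    then show ?case using Union by simp
  qed simp
qed

text \<open>The bad set is enlarged by the image of the boundary of the square so that it becomes a Borel
  subset of the quotient.\<close>

lemma AE_torus_lebesgueI:
  assumes AE: "AE x in (lborel :: (real^2) measure). (\<forall>i. 0 < x $ i) \<longrightarrow> P (to_torus x)"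
  shows "AE z in torus_lebesgue. P z"
proof -
  define D where "D = {x :: real^2. \<forall>i. 0 \<le> x $ i \<and> x $ i < 1}"
  have "AE x in (lborel :: (real^2) measure). \<forall>i. x $ i \<noteq> 0"
    unfolding AE_all_countable
  proof
    fix i :: 2
    have "AE x in (lborel :: (real^2) measure). x \<bullet> axis i 1 \<noteq> 0"
      by (rule AE_lborel_inner_neq) (simp add: axis_in_Basis_iff)
    then show "AE x in (lborel :: (real^2) measure). x $ i \<noteq> 0" by (simp add: inner_axis)
  qed
  with AE have "AE x in (lborel :: (real^2) measure). ((\<forall>i. 0 < x $ i) \<longrightarrow> P (to_torus x)) \<and> (\<forall>i. x $ i \<noteq> 0)"
    by eventually_elim simp
  then obtain N where N: "N \<in> null_sets lborel"
    "{x. \<not> (((\<forall>i. 0 < x $ i) \<longrightarrow> P (to_torus x)) \<and> (\<forall>i. x $ i \<noteq> 0))} \<subseteq> N"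
    unfolding eventually_ae_filter by auto
  have Nb: "N \<in> sets borel" using N(1) by (simp add: null_sets_def)
  define Z where "Z = to_torus ` (N \<inter> open_square) \<union> (UNIV - to_torus ` open_square)"
  have Zb: "Z \<in> sets borel"
    unfolding Z_def using borel_to_torus_image[OF Nb] borel_to_torus_image[of UNIV] by simp
  have Db: "D \<in> sets borel"
  proof -
    have "D = (\<Inter>i\<in>UNIV. {x. 0 \<le> x $ i} \<inter> {x. x $ i < 1})" by (auto simp: D_def)
    also have "\<dots> \<in> sets borel"
      by (intro sets.finite_INT sets.Int borel_closed borel_open closed_Collect_le open_Collect_less continuous_intros) auto
    finally show ?thesis .
  qed
  have meas: "to_torus \<in> measurable (restrict_space lborel D) borel"
    using borel_measurable_continuous_onI[OF continuous_to_torus]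
    by (intro measurable_restrict_space1) simp
  have sub: "to_torus -` Z \<inter> D \<subseteq> N"
  proof
    fix x assume x: "x \<in> to_torus -` Z \<inter> D"
    show "x \<in> N"
    proof (cases "x \<in> open_square")
      case True
      then have "to_torus x \<in> to_torus ` (N \<inter> open_square)" using x by (auto simp: Z_def)
      then obtain z where "z \<in> N" "z \<in> open_square" "to_torus x = to_torus z" by auto
      then show ?thesis using inj_on_open_square True by (metis inj_onD)
    next
      case False
      then obtain i where "x $ i = 0" using x unfolding D_def open_square_def by (auto simp: less_le)
      then show ?thesis using N(2) by auto
    qed
  qed
  have "Z \<in> null_sets torus_lebesgue"
  proof (rule null_setsI)
    have "emeasure torus_lebesgue Z = emeasure (restrict_space lborel D) (to_torus -` Z \<inter> D)"
      unfolding torus_lebesgue_def D_def[symmetric] using meas Zb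
      by (simp add: emeasure_distr space_restrict_space)
    also have "\<dots> = emeasure lborel (to_torus -` Z \<inter> D)"
      using Db by (intro emeasure_restrict_space) auto
    also have "\<dots> \<le> emeasure lborel N"
      using sub Nb by (intro emeasure_mono) auto
    also have "\<dots> = 0" using N(1) by (simp add: null_sets_def)
    finally show "emeasure torus_lebesgue Z = 0" by simp
    show "Z \<in> sets torus_lebesgue" using Zb by (simp add: torus_lebesgue_def)
  qed
  moreover have "{z \<in> space torus_lebesgue. \<not> P z} \<subseteq> Z"
  proof
    fix z assume z: "z \<in> {z \<in> space torus_lebesgue. \<not> P z}"
    show "z \<in> Z"
    proof (cases "z \<in> to_torus ` open_square")
      case True
      then obtain x where x: "x \<in> open_square" "z = to_torus x" by auto
      then have "x \<in> N" using N(2) z by (auto simp: open_square_def)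
      then show ?thesis using x by (auto simp: Z_def)
    qed (simp add: Z_def)
  qed
  ultimately show ?thesis by (rule AE_I')
qed

section \<open>The physical measure\<close>

lemma has_physical_measure_of_fast_convergents:
  assumes "fast_convergents \<alpha> p q c" and \<beta>: "\<beta> = (\<Sum>n. real (q n) * \<alpha> - of_int (p n))"
    and flow: "reparametrized_linear_flow \<alpha> (to_torus (vector [0, 0])) (to_torus (vector [0, - \<beta>])) \<psi> \<phi>"
  shows "has_physical_measure (to_torus (vector [0, 0])) (to_torus (vector [0, - \<beta>])) \<psi> \<phi>"
proof -
  let ?p = "to_torus (vector [0, 0])" and ?q = "to_torus (vector [0, - \<beta>])"
  let ?W = "\<lambda>z. weak_star_limit (\<lambda>t. empirical_measure \<phi> t z) (mu_infinity \<psi> ?p ?q)"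
  interpret fast_convergents \<alpha> p q c by fact
  interpret two_stops \<alpha> \<beta> \<psi> ?p ?q
    using flow unfolding reparametrized_linear_flow_def by unfold_locales auto
  have gen: "flow_generated_by (\<lambda>z. \<psi> z *\<^sub>R vector [1, \<alpha>]) \<phi>"
    using flow by (simp add: reparametrized_linear_flow_def)
  have "AE y in lborel. spike_free \<alpha> y \<and> spike_free \<alpha> (y + \<beta>)"
    using AE_spike_free AE_lborel_translate[OF AE_spike_free, of \<beta>] by eventually_elim simp
  from AE_lborel_section[OF this, of \<alpha>]
  \<comment> \<open>Positive coordinates keep the starting point inside the range of the line
    integrals; the open unit square still covers almost all of the torus.\<close>
  have "AE x in (lborel :: (real^2) measure). (\<forall>i. 0 < x $ i) \<longrightarrow>
    ?W (to_torus x)"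
  proof eventually_elim
    case (elim x)
    show ?case
    proof
      assume "\<forall>i. 0 < x $ i"
      then have x: "0 \<le> x $ 1" by (simp add: less_imp_le)
      interpret good_orbit \<alpha> \<beta> \<psi> ?p ?q "x $ 2 - \<alpha> * x $ 1"
      proof
        show "spike_free \<alpha> (x $ 2 - \<alpha> * x $ 1)" "spike_free \<alpha> (x $ 2 - \<alpha> * x $ 1 + \<beta>)"
          using elim by auto
        then show "(\<lambda>n. orbit_sum \<alpha> n (x $ 2 - \<alpha> * x $ 1 + \<beta>) / orbit_sum \<alpha> n (x $ 2 - \<alpha> * x $ 1)) \<longlonglongrightarrow> 1"
          by (rule orbit_sum_ratio_tendsto_1[OF \<beta>])
        show "filterlim (\<lambda>n. orbit_sum \<alpha> n (x $ 2 - \<alpha> * x $ 1) / real n) at_top at_top"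
          using elim by (intro orbit_sum_div_at_top) (simp add: spike_free_def)
      qed
      show "?W (to_torus x)"
        by (rule weak_star_limit_orbit[OF gen x refl])
    qed
  qed
  then show ?thesis
    unfolding has_physical_measure_def by (rule AE_torus_lebesgueI)
qed

theorem theorem9p1:
  fixes \<alpha> :: real
    and \<psi> :: "torus \<Rightarrow> real"
    and \<phi> :: "real \<Rightarrow> torus \<Rightarrow> torus"
  assumes "\<alpha> \<notin> \<rat>"
    and "(\<exists>N. (\<forall>n\<ge>N. cf_digit \<alpha> n \<ge> 2) \<and>
              summable (\<lambda>n. 1 / ln (real_of_int (cf_digit \<alpha> (n + N))))) \<or>
         (\<exists>C>0. \<exists>\<gamma>>0. \<forall>n. real_of_int (cf_den \<alpha> n) \<ge> C * exp (real n powr (2 + \<gamma>)))"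
    and "reparametrized_linear_flow \<alpha>
           (to_torus (vector [0, 0])) (to_torus (vector [0, - beta0 \<alpha>])) \<psi> \<phi>"
  shows "has_physical_measure
           (to_torus (vector [0, 0])) (to_torus (vector [0, - beta0 \<alpha>])) \<psi> \<phi>"
proof -
  have "\<exists>c>0. \<forall>\<^sub>F n in sequentially. c * real n ^ 2 \<le> ln (real (nat (cf_den \<alpha> n)))"
    using assms(2) ln_cf_den_ge_of_digits[OF assms(1)] ln_cf_den_ge_of_exp[OF assms(1)] by blast
  then obtain c where c: "0 < c" "\<forall>\<^sub>F n in sequentially. c * real n ^ 2 \<le> ln (real (nat (cf_den \<alpha> n)))"
    by blast
  show ?thesis
  proof (rule has_physical_measure_of_fast_convergents)
    interpret convergents \<alpha> "cf_num \<alpha>" "\<lambda>n. nat (cf_den \<alpha> n)"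
      by (rule convergents_cf[OF assms(1)])
    show "fast_convergents \<alpha> (cf_num \<alpha>) (\<lambda>n. nat (cf_den \<alpha> n)) c"
      by unfold_locales (fact c)+
    show "beta0 \<alpha> = (\<Sum>n. real (nat (cf_den \<alpha> n)) * \<alpha> - of_int (cf_num \<alpha> n))"
      using cf_den_pos[OF assms(1)] by (simp add: beta0_def cf_rho_def less_imp_le)
  qed (fact assms(3))
qed

end
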